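(* Let $\mathcal R_0$ be an indecomposable admissible component of the root groupoid $\mathcal R$ and $v\in\mathcal R_0$. Then: (1) $W(v)\subset\mathrm{Aut}_{\mathcal R}(v)$ is a normal subgroup. (2) $K(v)\subset\mathrm{Aut}_{\mathcal R}(v)$ is a normal subgroup. (3) There is a canonical isomorphism of groups $\mathrm{Aut}_{\mathcal R}(v)/K(v)=\mathrm{Sk}^D(v)$, induced by $\gamma\mapsto\gamma(v)$. (4) $\mathrm{Sk}^D(v)=W(v)\rtimes\mathrm{Sp}^D(v)$ (semidirect product with normal subgroup $W(v)$).
   Context: Root groupoid. Fix a finite set $X$. A root datum is a quadruple $v=(\mathfrak h,a,b,p)$ with $\mathfrak h$ a finite-dimensional complex vector space, $a:X\to\mathfrak h$, $b:X\to\mathfrak h^*$ such that the families $(a(x))_{x\in X}$ and $(b(x))_{x\in X}$ are linearly independent, and $p:X\to\mathbb Z_2$; we write $\mathfrak h(v),a_v,b_v,p_v$. Its Cartan matrix is $a_{xy}=\langle a(x),b(y)\rangle$. An element $x\in X$ is reflectable at $v$ if: $a_{xx}=0$ implies $p(x)=1$; if $a_{xx}\ne 0$ and $p(x)=0$ then $2a_{xy}/a_{xx}\in\mathbb Z_{\le 0}$ for all $y\ne x$; if $a_{xx}\neq 0$ and $p(x)=1$ then $a_{xy}/a_{xx}\in\mathbb Z_{\le 0}$ for all $y\ne x$. For $x$ reflectable at $v$ the reflexion $r_x:v\to v'=(\mathfrak h,a',b',p')$ is defined as follows. Anisotropic case $a_{xx}\ne0$: $p'=p$, $a'(y)=a(y)-2\frac{a_{yx}}{a_{xx}}a(x)$,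 $b'(y)=b(y)-2\frac{a_{xy}}{a_{xx}}b(x)$. Isotropic case $a_{xx}=0$: $(a'(x),b'(x),p'(x))=(-a(x),-b(x),p(x))$; for $y\neq x$ with $a_{xy}=0$, $(a'(y),b'(y),p'(y))=(a(y),b(y),p(y))$; for $y$ with $a_{xy}\ne0$, $(a'(y),b'(y),p'(y))=(a(y)+\frac{a_{yx}}{a_{xy}}a(x),\,b(y)+b(x),\,1+p(y))$. The root groupoid $\mathcal R$ has the root data as objects; its arrows are generated by reflexions, tautological arrows $t_\theta:(\mathfrak h,a,b,p)\to(\mathfrak h',\theta\circ a,(\theta^* )^{-1}\circ b,p)$ for linear isomorphisms $\theta:\mathfrak h\to\mathfrak h'$, and homotheties $h_\lambda:(\mathfrak h,a,b,p)\to(\mathfrak h,\lambda a,b,p)$ for $\lambda:X\to\mathbb C^*$. Each generator induces a linear isomorphism of the spaces $\mathfrak h$ (the identity for reflexions and homotheties, $\theta$ for $t_\theta$), and two compositions of generators $v\to v'$ are identified iff they induce the same isomorphism $\mathfrak h(v)\to\mathfrak h(v')$. Hence $\mathrm{Aut}_{\mathcal R}(v)$ acts faithfully on $\mathfrak h(v)$ (and on $\mathfrak h(v)^*$ by the contragredient action) and is regarded as a subgroup of $GL(\mathfrak h(v))$. A component is a connected component of $\mathcal R$; it is indecomposable if for $v$ in it there is no partition $X=X_1\sqcup X_2$ into nonempty subsets with $a_{xy}=a_{yx}=0$ for $x\in X_1,y\in X_2$. Admissibility. The half-baked Lie superalgebra $\tilde{\mathfrak g}(v)$ is generated by $\mathfrak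 h(v)$ (even) and $\tilde e_x,\tilde f_x$ ($x\in X$, of parity $p(x)$) with relations $[\mathfrak h,\mathfrak h]=0$, $[h,\tilde e_x]=\langle b(x),h\rangle\tilde e_x$, $[h,\tilde f_x]=-\langle b(x),h\rangle\tilde f_x$, $[\tilde e_x,\tilde f_y]=0$ for $x\ne y$, $[\tilde e_x,\tilde f_x]=a(x)$. A component $\mathcal R_0$ is admissible if there is a collection of quotients $\mathfrak g(v)=\tilde{\mathfrak g}(v)/I(v)$, $v\in\mathcal R_0$, with $I(v)\cap\mathfrak h(v)=0$, such that for each arrow $v\to v'$ in $\mathcal R_0$ the induced isomorphism $\mathfrak h(v)\to\mathfrak h(v')$ extends to an isomorphism $\mathfrak g(v)\to\mathfrak g(v')$. Equivalently: at every $v\in\mathcal R_0$, if $x$ is reflectable at $v$ and $a_{xy}=0$ then $a_{yx}=0$. Skeleton, Weyl group and the groups in the statement. $\mathrm{Sk}(v)$ is the set of objects obtained from $v$ by chains of reflexions, $\mathrm{Sp}(v)\subset\mathrm{Sk}(v)$ those obtained by chains of isotropic reflexions; all have the same $\mathfrak h=\mathfrak h(v)$. A real root $\alpha=b_u(x)$ ($u\in\mathrm{Sk}(v)$) with $x$ reflectable at $u$ and $a_{xx}\ne0$ at $u$ is called anisotropic; $\alpha^\vee=2a_u(x)/a_{xx}$ (independent of choices) and $s_\alpha(h)=h-\langle\alpha,h\rangle\alpha^\vee$. $W(v)\subset GL(\mathfrak h)$ is the group generated by all $s_\alpha$, $\alpha$ anisotropic; it is contained in $\mathrm{Aut}_{\mathcal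 R}(v)\subset GL(\mathfrak h)$. $K(v)=\{\theta\in GL(\mathfrak h):\theta(a_v(x))\in\mathbb C^*a_v(x),\ \theta^*(b_v(x))=b_v(x)\ \forall x\in X\}$, the subgroup of automorphisms of $v$ that are compositions of a homothety and a tautological arrow. $\mathrm{Aut}_{\mathcal R}(v)$ acts on $\mathrm{Sk}(v)$: $\gamma(u)$ is the unique vertex of $\mathrm{Sk}(v)$ with $b_{\gamma(u)}(x)=\gamma(b_u(x))$ for all $x\in X$. Cartan data $(A,p)$, $(A',p')$ are $D$-equivalent if $p=p'$ and $A'=DA$ with $D$ an invertible diagonal matrix. $\mathrm{Sk}^D(v)$ is the set of $u\in\mathrm{Sk}(v)$ whose Cartan datum is $D$-equivalent to that of $v$; its group structure is: for $u,u'\in\mathrm{Sk}^D(v)$, if $r_{x_k}\circ\dots\circ r_{x_1}$ is a chain of reflexions from $v$ to $u'$, the product $u\cdot u'$ is the end of the chain of reflexions with the same names $r_{x_1},\dots,r_{x_k}$ starting at $u$ (this is the structure induced from $\mathrm{Aut}_{\mathcal R}(v)$). $\mathrm{Sp}^D(v)=\mathrm{Sp}(v)\cap\mathrm{Sk}^D(v)$, a subgroup. $W(v)$ is identified with its image in $\mathrm{Sk}^D(v)$ under $w\mapsto w(v)$. *)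

theory Defs
  imports
    Complex_Main
    "HOL-Library.Z2"
    "HOL-Library.Nonpos_Ints"
    "HOL-Library.Poly_Mapping"
    "HOL-Algebra.Bij"
    "HOL-Algebra.Coset"
    "HOL-Algebra.Generated_Groups"
begin

section \<open>Complex vector spaces\<close>

text \<open>A type of this class plays the role of a universe: the finite-dimensional vector spaces under
  consideration are the finite-dimensional subspaces of such a type. Linear maps and functionals on
  a subspace are made unique as functions on the whole type: isomorphisms are \<^const>\<open>undefined\<close>
  (as usual for \<^const>\<open>extensional\<close> functions), functionals are zero outside of the subspace.\<close>

class complex_vector = ab_group_add +
  fixes scaleC :: "complex \<Rightarrow> 'a \<Rightarrow> 'a" (infixr "*\<^sub>C" 75)
  assumes scaleC_add_right: "c *\<^sub>C (x + y) = c *\<^sub>C x + c *\<^sub>C y"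
    and scaleC_add_left: "(c + d) *\<^sub>C x = c *\<^sub>C x + d *\<^sub>C x"
    and scaleC_scaleC: "c *\<^sub>C d *\<^sub>C x = (c * d) *\<^sub>C x"
    and scaleC_one: "1 *\<^sub>C x = x"

global_interpretation complex_vector: vector_space "scaleC :: complex \<Rightarrow> 'a \<Rightarrow> 'a::complex_vector"
  by unfold_locales (simp_all add: scaleC_add_right scaleC_add_left scaleC_scaleC scaleC_one)

definition fin_dim_subspace :: "'b::complex_vector set \<Rightarrow> bool" where
  "fin_dim_subspace S \<longleftrightarrow> complex_vector.subspace S \<and> (\<exists>B. finite B \<and> complex_vector.span B = S)"

definition lin_isos :: "'b::complex_vector set \<Rightarrow> 'b set \<Rightarrow> ('b \<Rightarrow> 'b) set" where
  "lin_isos S T = {\<theta> \<in> extensional S. bij_betw \<theta> S T \<and>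
     (\<forall>x\<in>S. \<forall>y\<in>S. \<theta> (x + y) = \<theta> x + \<theta> y) \<and> (\<forall>c. \<forall>x\<in>S. \<theta> (c *\<^sub>C x) = c *\<^sub>C \<theta> x)}"

definition dual_space :: "'b::complex_vector set \<Rightarrow> ('b \<Rightarrow> complex) set" where
  "dual_space S = {f. (\<forall>x\<in>S. \<forall>y\<in>S. f (x + y) = f x + f y) \<and>
     (\<forall>c. \<forall>x\<in>S. f (c *\<^sub>C x) = c * f x) \<and> (\<forall>x. x \<notin> S \<longrightarrow> f x = 0)}"

text \<open>The map $(\theta^*)^{-1}$ on functionals, for an isomorphism \<open>\<theta>\<close> from \<open>S\<close> to \<open>T\<close>.\<close>

definition contragredient ::
    "'b set \<Rightarrow> 'b set \<Rightarrow> ('b \<Rightarrow> 'b) \<Rightarrow> ('b \<Rightarrow> complex) \<Rightarrow> 'b \<Rightarrow> complex" where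
  "contragredient S T \<theta> f = (\<lambda>k. if k \<in> T then f (inv_into S \<theta> k) else 0)"


section \<open>Root data and reflexions\<close>

record ('b, 'x) rdatum =
  space :: "'b set"
  a_of :: "'x \<Rightarrow> 'b"
  b_of :: "'x \<Rightarrow> 'b \<Rightarrow> complex"
  p_of :: "'x \<Rightarrow> bit"

definition root_datum :: "('b::complex_vector, 'x::finite) rdatum \<Rightarrow> bool" where
  "root_datum v \<longleftrightarrow> fin_dim_subspace (space v) \<and>
     (\<forall>x. a_of v x \<in> space v) \<and> (\<forall>x. b_of v x \<in> dual_space (space v)) \<and>
     (\<forall>c. (\<Sum>x\<in>UNIV. c x *\<^sub>C a_of v x) = 0 \<longrightarrow> (\<forall>x. c x = 0)) \<and>
     (\<forall>c. (\<forall>h. (\<Sum>x\<in>UNIV. c x * b_of v x h) = 0) \<longrightarrow> (\<forall>x. c x = 0))"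

definition cartan :: "('b, 'x) rdatum \<Rightarrow> 'x \<Rightarrow> 'x \<Rightarrow> complex" where
  "cartan v x y = b_of v y (a_of v x)"

definition reflectable :: "('b, 'x) rdatum \<Rightarrow> 'x \<Rightarrow> bool" where
  "reflectable v x \<longleftrightarrow>
     (cartan v x x = 0 \<longrightarrow> p_of v x = 1) \<and>
     (cartan v x x \<noteq> 0 \<and> p_of v x = 0 \<longrightarrow>
        (\<forall>y. y \<noteq> x \<longrightarrow> 2 * cartan v x y / cartan v x x \<in> nonpos_Ints)) \<and>
     (cartan v x x \<noteq> 0 \<and> p_of v x = 1 \<longrightarrow>
        (\<forall>y. y \<noteq> x \<longrightarrow> cartan v x y / cartan v x x \<in> nonpos_Ints))"

definition reflexion :: "'x \<Rightarrow> ('b::complex_vector, 'x) rdatum \<Rightarrow> ('b, 'x) rdatum" where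
  "reflexion x v =
    (if cartan v x x \<noteq> 0 then
       v\<lparr>a_of := \<lambda>y. a_of v y - (2 * cartan v y x / cartan v x x) *\<^sub>C a_of v x,
         b_of := \<lambda>y h. b_of v y h - (2 * cartan v x y / cartan v x x) * b_of v x h\<rparr>
     else
       v\<lparr>a_of := \<lambda>y. if y = x then - a_of v x
                    else if cartan v x y = 0 then a_of v y
                    else a_of v y + (cartan v y x / cartan v x y) *\<^sub>C a_of v x,
         b_of := \<lambda>y h. if y = x then - b_of v x h
                      else if cartan v x y = 0 then b_of v y h
                      else b_of v y h + b_of v x h,
         p_of := \<lambda>y. if y = x then p_of v x
                    else if cartan v x y = 0 then p_of v y
                    else 1 + p_of v y\<rparr>)"

definition transport ::
    "'b set \<Rightarrow> ('b \<Rightarrow> 'b) \<Rightarrow> ('b, 'x) rdatum \<Rightarrow> ('b, 'x) rdatum" where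
  "transport T \<theta> v = \<lparr>space = T, a_of = \<lambda>x. \<theta> (a_of v x),
     b_of = \<lambda>x. contragredient (space v) T \<theta> (b_of v x), p_of = p_of v\<rparr>"

definition homothety ::
    "('x \<Rightarrow> complex) \<Rightarrow> ('b::complex_vector, 'x) rdatum \<Rightarrow> ('b, 'x) rdatum" where
  "homothety l v = v\<lparr>a_of := \<lambda>x. l x *\<^sub>C a_of v x\<rparr>"


section \<open>The root groupoid\<close>

text \<open>Arrows with the same source and target are identified iff they induce the same isomorphism of
  vector spaces, so an arrow is a triple: source, induced isomorphism, target. The inverse of a
  generator is a generator, so that closure under composition suffices; the identity arrows are
  transports along the identity.\<close>

inductive arrow ::
    "('b::complex_vector, 'x::finite) rdatum \<Rightarrow> ('b \<Rightarrow> 'b) \<Rightarrow> ('b, 'x) rdatum \<Rightarrow> bool" where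
  reflexion: "root_datum v \<Longrightarrow> reflectable v x \<Longrightarrow> arrow v (\<lambda>h\<in>space v. h) (reflexion x v)"
| tautological: "root_datum v \<Longrightarrow> fin_dim_subspace T \<Longrightarrow> \<theta> \<in> lin_isos (space v) T \<Longrightarrow>
    arrow v \<theta> (transport T \<theta> v)"
| homothety: "root_datum v \<Longrightarrow> (\<forall>x. l x \<noteq> 0) \<Longrightarrow> arrow v (\<lambda>h\<in>space v. h) (homothety l v)"
| composition: "arrow u \<theta> v \<Longrightarrow> arrow v \<eta> w \<Longrightarrow> arrow u (compose (space u) \<eta> \<theta>) w"

definition component :: "('b::complex_vector, 'x::finite) rdatum set \<Rightarrow> bool" where
  "component R \<longleftrightarrow> (\<exists>v. root_datum v \<and> R = {u. \<exists>\<theta>. arrow v \<theta> u})"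

definition indecomposable :: "('b, 'x) rdatum set \<Rightarrow> bool" where
  "indecomposable R \<longleftrightarrow> (\<forall>v\<in>R. \<not> (\<exists>X1 X2. X1 \<noteq> {} \<and> X2 \<noteq> {} \<and> X1 \<inter> X2 = {} \<and> X1 \<union> X2 = UNIV \<and>
     (\<forall>x\<in>X1. \<forall>y\<in>X2. cartan v x y = 0 \<and> cartan v y x = 0)))"

definition Aut :: "('b::complex_vector, 'x::finite) rdatum \<Rightarrow> ('b \<Rightarrow> 'b) set" where
  "Aut v = {\<theta>. arrow v \<theta> v}"

definition GL :: "'b::complex_vector set \<Rightarrow> ('b \<Rightarrow> 'b) monoid" where
  "GL S = (BijGroup S)\<lparr>carrier := lin_isos S S\<rparr>"

definition AutG :: "('b::complex_vector, 'x::finite) rdatum \<Rightarrow> ('b \<Rightarrow> 'b) monoid" where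
  "AutG v = (GL (space v))\<lparr>carrier := Aut v\<rparr>"


section \<open>Superalgebras given by generators and relations\<close>

text \<open>Not necessarily associative complex superalgebras; \<open>part A i\<close> is the homogeneous component of
  parity \<open>i\<close>.\<close>

record 'c superalg =
  elems :: "'c set"
  add :: "'c \<Rightarrow> 'c \<Rightarrow> 'c"
  null :: "'c"
  smul :: "complex \<Rightarrow> 'c \<Rightarrow> 'c"
  brk :: "'c \<Rightarrow> 'c \<Rightarrow> 'c"
  part :: "bit \<Rightarrow> 'c set"

definition superideal :: "'c superalg \<Rightarrow> 'c set \<Rightarrow> bool" where
  "superideal A I \<longleftrightarrow> I \<subseteq> elems A \<and> null A \<in> I \<and>
     (\<forall>i\<in>I. \<forall>j\<in>I. add A i j \<in> I) \<and> (\<forall>c. \<forall>i\<in>I. smul A c i \<in> I) \<and>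
     (\<forall>i\<in>I. \<forall>x\<in>elems A. brk A i x \<in> I \<and> brk A x i \<in> I) \<and>
     (\<forall>i\<in>I. \<exists>y\<in>I \<inter> part A 0. \<exists>z\<in>I \<inter> part A 1. i = add A y z)"

definition generated_superideal :: "'c superalg \<Rightarrow> 'c set \<Rightarrow> 'c set" where
  "generated_superideal A R = \<Inter>{I. superideal A I \<and> R \<subseteq> I}"

definition coset :: "'c superalg \<Rightarrow> 'c set \<Rightarrow> 'c \<Rightarrow> 'c set" where
  "coset A I x = add A x ` I"

definition quotient_superalg :: "'c superalg \<Rightarrow> 'c set \<Rightarrow> 'c set superalg" where
  "quotient_superalg A I =
    \<lparr>elems = coset A I ` elems A,
     add = \<lambda>C D. \<Union>x\<in>C. \<Union>y\<in>D. coset A I (add A x y),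
     null = coset A I (null A),
     smul = \<lambda>c C. \<Union>x\<in>C. coset A I (smul A c x),
     brk = \<lambda>C D. \<Union>x\<in>C. \<Union>y\<in>D. coset A I (brk A x y),
     part = \<lambda>i. coset A I ` part A i\<rparr>"

definition superalg_iso :: "'c superalg \<Rightarrow> 'd superalg \<Rightarrow> ('c \<Rightarrow> 'd) \<Rightarrow> bool" where
  "superalg_iso A B \<phi> \<longleftrightarrow> bij_betw \<phi> (elems A) (elems B) \<and>
     (\<forall>x\<in>elems A. \<forall>y\<in>elems A. \<phi> (add A x y) = add B (\<phi> x) (\<phi> y)) \<and>
     (\<forall>c. \<forall>x\<in>elems A. \<phi> (smul A c x) = smul B c (\<phi> x)) \<and>
     (\<forall>x\<in>elems A. \<forall>y\<in>elems A. \<phi> (brk A x y) = brk B (\<phi> x) (\<phi> y)) \<and>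
     (\<forall>i. \<phi> ` part A i = part B i)"

datatype 'g word = Gen 'g | Brk "'g word" "'g word"

primrec word_parity :: "('g \<Rightarrow> bit) \<Rightarrow> 'g word \<Rightarrow> bit" where
  "word_parity q (Gen g) = q g"
| "word_parity q (Brk s t) = word_parity q s + word_parity q t"

type_synonym 'g free_elem = "'g word \<Rightarrow>\<^sub>0 complex"

definition scal :: "complex \<Rightarrow> 'g free_elem \<Rightarrow> 'g free_elem" where
  "scal c f = Poly_Mapping.map ((*) c) f"

definition fbrk :: "'g free_elem \<Rightarrow> 'g free_elem \<Rightarrow> 'g free_elem" where
  "fbrk f g = (\<Sum>s\<in>Poly_Mapping.keys f. \<Sum>t\<in>Poly_Mapping.keys g.
     Poly_Mapping.single (Brk s t) (Poly_Mapping.lookup f s * Poly_Mapping.lookup g t))"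

definition gen :: "'g \<Rightarrow> 'g free_elem" where
  "gen g = Poly_Mapping.single (Gen g) 1"

text \<open>The free nonassociative superalgebra on the set \<open>G\<close> of generators with parities \<open>q\<close>.\<close>

definition free_superalg :: "'g set \<Rightarrow> ('g \<Rightarrow> bit) \<Rightarrow> 'g free_elem superalg" where
  "free_superalg G q =
    \<lparr>elems = {f. \<forall>w\<in>Poly_Mapping.keys f. set_word w \<subseteq> G}, add = (+), null = 0, smul = scal, brk = fbrk,
     part = \<lambda>i. {f. \<forall>w\<in>Poly_Mapping.keys f. set_word w \<subseteq> G \<and> word_parity q w = i}\<rparr>"

definition koszul :: "bit \<Rightarrow> bit \<Rightarrow> complex" where
  "koszul i j = (if i = 1 \<and> j = 1 then -1 else 1)"

text \<open>Super skew-symmetry and the super Jacobi identity.\<close>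

definition lie_relations :: "'g set \<Rightarrow> ('g \<Rightarrow> bit) \<Rightarrow> 'g free_elem set" where
  "lie_relations G q =
     {fbrk f g + scal (koszul i j) (fbrk g f) | f g i j.
        f \<in> part (free_superalg G q) i \<and> g \<in> part (free_superalg G q) j} \<union>
     {fbrk f (fbrk g k) - fbrk (fbrk f g) k - scal (koszul i j) (fbrk g (fbrk f k)) | f g k i j.
        f \<in> part (free_superalg G q) i \<and> g \<in> part (free_superalg G q) j \<and>
        k \<in> elems (free_superalg G q)}"


section \<open>The half-baked Lie superalgebra and admissibility\<close>

datatype ('b, 'x) hgen = H 'b | E 'x | F 'x

definition hgens :: "('b, 'x) rdatum \<Rightarrow> ('b, 'x) hgen set" where
  "hgens v = H ` space v \<union> Set.range E \<union> Set.range F"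

primrec hparity :: "('b, 'x) rdatum \<Rightarrow> ('b, 'x) hgen \<Rightarrow> bit" where
  "hparity v (H h) = 0"
| "hparity v (E x) = p_of v x"
| "hparity v (F x) = p_of v x"

text \<open>The first two sets of relations make \<open>h \<mapsto> gen (H h)\<close> linear.\<close>

definition hb_relations :: "('b::complex_vector, 'x) rdatum \<Rightarrow> ('b, 'x) hgen free_elem set" where
  "hb_relations v =
     {gen (H (h + k)) - gen (H h) - gen (H k) | h k. h \<in> space v \<and> k \<in> space v} \<union>
     {gen (H (c *\<^sub>C h)) - scal c (gen (H h)) | c h. h \<in> space v} \<union>
     {fbrk (gen (H h)) (gen (H k)) | h k. h \<in> space v \<and> k \<in> space v} \<union>
     {fbrk (gen (H h)) (gen (E x)) - scal (b_of v x h) (gen (E x)) | h x. h \<in> space v} \<union>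
     {fbrk (gen (H h)) (gen (F x)) + scal (b_of v x h) (gen (F x)) | h x. h \<in> space v} \<union>
     {fbrk (gen (E x)) (gen (F y)) | x y. x \<noteq> y} \<union>
     {fbrk (gen (E x)) (gen (F x)) - gen (H (a_of v x)) | x. True}"

definition hb_free :: "('b, 'x) rdatum \<Rightarrow> ('b, 'x) hgen free_elem superalg" where
  "hb_free v = free_superalg (hgens v) (hparity v)"

definition hb_ideal :: "('b::complex_vector, 'x) rdatum \<Rightarrow> ('b, 'x) hgen free_elem set" where
  "hb_ideal v = generated_superideal (hb_free v)
     (lie_relations (hgens v) (hparity v) \<union> hb_relations v)"

definition half_baked ::
    "('b::complex_vector, 'x) rdatum \<Rightarrow> ('b, 'x) hgen free_elem set superalg" where
  "half_baked v = quotient_superalg (hb_free v) (hb_ideal v)"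

definition hb_cartan ::
    "('b::complex_vector, 'x) rdatum \<Rightarrow> 'b \<Rightarrow> ('b, 'x) hgen free_elem set" where
  "hb_cartan v h = coset (hb_free v) (hb_ideal v) (gen (H h))"

text \<open>The space of \<open>v\<close> embeds into the half-baked algebra by \<open>hb_cartan v\<close>; that an ideal intersects
  it trivially is expressed on the level of elements of the space.\<close>

definition admissible :: "('b::complex_vector, 'x::finite) rdatum set \<Rightarrow> bool" where
  "admissible R \<longleftrightarrow> (\<exists>I.
     (\<forall>v\<in>R. superideal (half_baked v) (I v) \<and>
        (\<forall>h\<in>space v. hb_cartan v h \<in> I v \<longrightarrow> h = 0)) \<and>
     (\<forall>v\<in>R. \<forall>u\<in>R. \<forall>\<theta>. arrow v \<theta> u \<longrightarrow>
        (\<exists>\<phi>. superalg_iso (quotient_superalg (half_baked v) (I v))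
                          (quotient_superalg (half_baked u) (I u)) \<phi> \<and>
             (\<forall>h\<in>space v. \<phi> (coset (half_baked v) (I v) (hb_cartan v h)) =
                          coset (half_baked u) (I u) (hb_cartan u (\<theta> h))))))"


section \<open>Skeleton, Weyl group and related groups\<close>

primrec chain ::
    "('b::complex_vector, 'x) rdatum \<Rightarrow> 'x list \<Rightarrow> ('b, 'x) rdatum \<Rightarrow> bool" where
  "chain v [] u \<longleftrightarrow> u = v"
| "chain v (x # xs) u \<longleftrightarrow> (\<exists>w. reflectable v x \<and> w = reflexion x v \<and> chain w xs u)"

definition Sk :: "('b::complex_vector, 'x) rdatum \<Rightarrow> ('b, 'x) rdatum set" where
  "Sk v = {u. \<exists>xs. chain v xs u}"

inductive_set Sp :: "('b::complex_vector, 'x) rdatum \<Rightarrow> ('b, 'x) rdatum set"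
  for v :: "('b::complex_vector, 'x) rdatum" where
  base: "v \<in> Sp v"
| step: "u \<in> Sp v \<Longrightarrow> reflectable u x \<Longrightarrow> cartan u x x = 0 \<Longrightarrow> reflexion x u \<in> Sp v"

text \<open>The reflection $s_\alpha$ for the anisotropic root $\alpha = b_u(x)$.\<close>

definition root_reflection :: "('b::complex_vector, 'x) rdatum \<Rightarrow> 'x \<Rightarrow> 'b \<Rightarrow> 'b" where
  "root_reflection u x =
     (\<lambda>h\<in>space u. h - b_of u x h *\<^sub>C ((2 / cartan u x x) *\<^sub>C a_of u x))"

definition Weyl :: "('b::complex_vector, 'x) rdatum \<Rightarrow> ('b \<Rightarrow> 'b) set" where
  "Weyl v = generate (GL (space v))
     {root_reflection u x | u x. u \<in> Sk v \<and> reflectable u x \<and> cartan u x x \<noteq> 0}"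

definition K :: "('b::complex_vector, 'x) rdatum \<Rightarrow> ('b \<Rightarrow> 'b) set" where
  "K v = {\<theta> \<in> lin_isos (space v) (space v). \<forall>x.
     (\<exists>c. c \<noteq> 0 \<and> \<theta> (a_of v x) = c *\<^sub>C a_of v x) \<and>
     (\<forall>h\<in>space v. b_of v x (\<theta> h) = b_of v x h)}"

definition act ::
    "('b::complex_vector, 'x) rdatum \<Rightarrow> ('b \<Rightarrow> 'b) \<Rightarrow> ('b, 'x) rdatum \<Rightarrow> ('b, 'x) rdatum" where
  "act v \<gamma> u = (THE w. w \<in> Sk v \<and>
     (\<forall>x. b_of w x = contragredient (space v) (space v) \<gamma> (b_of u x)))"

definition D_equivalent :: "('b, 'x) rdatum \<Rightarrow> ('b, 'x) rdatum \<Rightarrow> bool" where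
  "D_equivalent v u \<longleftrightarrow> p_of v = p_of u \<and>
     (\<exists>d. (\<forall>x. d x \<noteq> 0) \<and> (\<forall>x y. cartan u x y = d x * cartan v x y))"

definition SkD :: "('b::complex_vector, 'x) rdatum \<Rightarrow> ('b, 'x) rdatum set" where
  "SkD v = {u \<in> Sk v. D_equivalent v u}"

definition SpD :: "('b::complex_vector, 'x) rdatum \<Rightarrow> ('b, 'x) rdatum set" where
  "SpD v = Sp v \<inter> SkD v"

text \<open>The product of \<open>u\<close> and \<open>u'\<close> is the common endpoint of all chains from \<open>u\<close> having the same names
  as some chain from \<open>v\<close> to \<open>u'\<close>.\<close>

definition SkDG :: "('b::complex_vector, 'x) rdatum \<Rightarrow> ('b, 'x) rdatum monoid" where
  "SkDG v = \<lparr>carrier = SkD v,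
     mult = \<lambda>u u'. THE w. \<exists>xs. chain v xs u' \<and> chain u xs w,
     one = v\<rparr>"

definition semidirect_product :: "('g, 'm) monoid_scheme \<Rightarrow> 'g set \<Rightarrow> 'g set \<Rightarrow> bool" where
  "semidirect_product G N Q \<longleftrightarrow>
     N \<lhd> G \<and> subgroup Q G \<and> N \<inter> Q = {\<one>\<^bsub>G\<^esub>} \<and> N <#>\<^bsub>G\<^esub> Q = carrier G"

end

theory Submission
  imports Defs
begin

text \<open>Admissibility enters only through three facts about two root data \<open>v\<close> and \<open>u\<close> joined by
  reflexions: every \<open>b_v(x)\<close> is a nonnegative or a nonpositive integral combination of the \<open>b_u(y)\<close>;
  \<open>b_v(x) = b_u(y)\<close> forces \<open>a_v(x)\<close> and \<open>a_u(y)\<close> to be proportional; and \<open>a_xy = 0\<close> implies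
  \<open>a_yx = 0\<close> for reflectable \<open>x\<close>. They follow by comparing weight spaces, since a quotient of the
  half-baked algebra that is injective on the Cartan subalgebra has a triangular decomposition in
  which the weight spaces of weight \<open>\<plusminus> b(x)\<close> are lines.

  The rest is an exchange argument in the style of Coxeter groups. A reflexion at \<open>x\<close> changes the
  sign of no root except \<open>\<plusminus> b(x)\<close>. Hence the signs of anisotropic roots are constant on \<open>Sp(v)\<close>, the
  Weyl group is generated by the reflections in the anisotropic roots that are simple at some vertex
  of \<open>Sp(v)\<close>, and an element preserving the positive anisotropic roots is trivial. Chains of isotropic
  reflexions satisfy an exchange property as well, because two isotropic simple roots that are both
  negative at \<open>v\<close> are orthogonal. Together these show that a vertex of \<open>Sk(v)\<close> is determined by its
  family \<open>b\<close>, so that \<open>\<gamma> \<mapsto> \<gamma>(v)\<close> is a well-defined homomorphism with kernel \<open>K(v)\<close>. It is onto since a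
  D-equivalence of vertices lifts to a linear automorphism, and
  \<open>Sk(v) = W(v) Sp(v)\<close>, \<open>W(v) \<inter> Sp(v) = 1\<close> give the semidirect product.\<close>

section \<open>Root data\<close>

text \<open>All later arguments run through similarities (\<open>sim\<close>): linear isomorphisms
  carrying one root datum to another, exactly on \<open>b\<close> and \<open>p\<close> and up to
  nonzero factors on \<open>a\<close>. They commute with reflexions of the same name, so every arrow
  is a chain of reflexions followed by one similarity, and \<open>Aut v\<close> consists of the
  similarities from \<open>v\<close> to vertices of \<open>Sk v\<close>.

  Two obstacles shape the proof. The isomorphisms supplied by admissibility are known only on the
  Cartan subalgebra, not on the generators, so information can be read off only from weights. And
  there is no fixed base of simple roots for the Weyl group: isotropic reflexions change the base
  without in general being induced by a linear map, so positivity has to be compared between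
  different bases.

  The group law of \<open>SkDG v\<close> refers to names of reflexions, and it is well defined only
  because \<open>b\<close> determines the vertex. A similarity prescribes just \<open>b\<close> and
  \<open>p\<close> of its target, while \<open>a\<close> could differ by factors. Reflections in
  anisotropic roots have all factors 1, and this exactness lets the exchange argument end in an
  equality of vertices.\<close>

lemma root_datumD:
  assumes "root_datum v"
  shows "complex_vector.subspace (space v)" "a_of v x \<in> space v" "b_of v x \<in> dual_space (space v)"
  using assms by (auto simp: root_datum_def fin_dim_subspace_def)

lemma b_linear:
  assumes "root_datum v"
  shows "h \<in> space v \<Longrightarrow> k \<in> space v \<Longrightarrow> b_of v x (h + k) = b_of v x h + b_of v x k"
    and "h \<in> space v \<Longrightarrow> b_of v x (c *\<^sub>C h) = c * b_of v x h"
    and "h \<notin> space v \<Longrightarrow> b_of v x h = 0"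
  using root_datumD(3)[OF assms, of x] by (auto simp: dual_space_def)

lemma a_independent:
  assumes "root_datum v" "(\<Sum>y\<in>UNIV. c y *\<^sub>C a_of v y) = (\<Sum>y\<in>UNIV. d y *\<^sub>C a_of v y)"
  shows "c = d"
proof -
  have "(\<Sum>y\<in>UNIV. (c y - d y) *\<^sub>C a_of v y) = 0"
    using assms(2) by (simp add: complex_vector.scale_left_diff_distrib sum_subtractf)
  then have "\<forall>x. c x - d x = 0"
    using assms(1) by (auto simp: root_datum_def)
  then show ?thesis by auto
qed

lemma a_nonzero:
  assumes "root_datum v" shows "a_of v x \<noteq> 0"
proof
  assume "a_of v x = 0"
  then have "(\<Sum>y\<in>UNIV. (if y = x then 1 else 0) *\<^sub>C a_of v y) = (\<Sum>y\<in>UNIV. 0 *\<^sub>C a_of v y)"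
    by (intro sum.cong) auto
  from fun_cong[OF a_independent[OF assms this], of x] show False by simp
qed

lemma b_independent:
  assumes "root_datum v" "\<And>h. (\<Sum>y\<in>UNIV. c y * b_of v y h) = (\<Sum>y\<in>UNIV. d y * b_of v y h)"
  shows "c = d"
proof -
  have "\<forall>h. (\<Sum>y\<in>UNIV. (c y - d y) * b_of v y h) = 0"
    using assms(2) by (simp add: algebra_simps sum_subtractf)
  then have "\<forall>x. c x - d x = 0"
    using assms(1) by (auto simp: root_datum_def)
  then show ?thesis by auto
qed

section \<open>Free superalgebras and their quotients\<close>

lemma lookup_scal [simp]:
  "Poly_Mapping.lookup (scal c f) w = c * Poly_Mapping.lookup f w"
  by (simp add: scal_def Poly_Mapping.map.rep_eq when_def)

global_interpretation scal: vector_space "scal :: complex \<Rightarrow> 'g free_elem \<Rightarrow> 'g free_elem"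
  by unfold_locales (auto intro!: poly_mapping_eqI simp: lookup_add algebra_simps)

lemma scal_single [simp]: "scal c (Poly_Mapping.single w d) = Poly_Mapping.single w (c * d)"
  by (rule poly_mapping_eqI) (simp add: lookup_single when_def)

lemma free_elem_eq_sum_single:
  "f = (\<Sum>w\<in>Poly_Mapping.keys f. Poly_Mapping.single w (Poly_Mapping.lookup f w))"
proof (rule poly_mapping_eqI)
  fix k
  have "(\<Sum>w\<in>Poly_Mapping.keys f. Poly_Mapping.lookup f w when w = k)
      = (if k \<in> Poly_Mapping.keys f then Poly_Mapping.lookup f k else 0)"
    by (simp add: when_def)
  then show "Poly_Mapping.lookup f k = Poly_Mapping.lookup
      (\<Sum>w\<in>Poly_Mapping.keys f. Poly_Mapping.single w (Poly_Mapping.lookup f w)) k"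
    by (simp add: lookup_sum lookup_single in_keys_iff)
qed

text \<open>Terms outside the supports vanish, so the double sum may run over any finite supersets.
  This supplies common index sets for the bilinearity of \<open>fbrk\<close>, where the supports of
  \<open>f\<close>, \<open>f'\<close> and \<open>f + f'\<close> all differ.\<close>

lemma fbrk_eq_sum:
  assumes "finite S" "finite T" "Poly_Mapping.keys f \<subseteq> S" "Poly_Mapping.keys g \<subseteq> T"
  shows "fbrk f g = (\<Sum>s\<in>S. \<Sum>t\<in>T.
     Poly_Mapping.single (Brk s t) (Poly_Mapping.lookup f s * Poly_Mapping.lookup g t))"
proof -
  have "fbrk f g = (\<Sum>s\<in>Poly_Mapping.keys f. \<Sum>t\<in>T.
     Poly_Mapping.single (Brk s t) (Poly_Mapping.lookup f s * Poly_Mapping.lookup g t))"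
    unfolding fbrk_def using assms
    by (intro sum.cong refl sum.mono_neutral_left) (auto simp: in_keys_iff)
  also have "\<dots> = (\<Sum>s\<in>S. \<Sum>t\<in>T.
     Poly_Mapping.single (Brk s t) (Poly_Mapping.lookup f s * Poly_Mapping.lookup g t))"
    using assms by (intro sum.mono_neutral_left) (auto simp: in_keys_iff)
  finally show ?thesis .
qed

lemma fbrk_add_left: "fbrk (f + f') g = fbrk f g + fbrk f' g"
proof -
  let ?S = "Poly_Mapping.keys f \<union> Poly_Mapping.keys f' \<union> Poly_Mapping.keys (f + f')"
  show ?thesis
    by (subst (1 2 3) fbrk_eq_sum[of ?S "Poly_Mapping.keys g"])
      (auto simp: lookup_add algebra_simps single_add sum.distrib)
qed

lemma fbrk_add_right: "fbrk f (g + g') = fbrk f g + fbrk f g'"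
proof -
  let ?T = "Poly_Mapping.keys g \<union> Poly_Mapping.keys g' \<union> Poly_Mapping.keys (g + g')"
  show ?thesis
    by (subst (1 2 3) fbrk_eq_sum[of "Poly_Mapping.keys f" ?T])
      (auto simp: lookup_add algebra_simps single_add sum.distrib)
qed

lemma fbrk_scal_left [simp]: "fbrk (scal c f) g = scal c (fbrk f g)"
proof -
  let ?S = "Poly_Mapping.keys f \<union> Poly_Mapping.keys (scal c f)"
  show ?thesis
    by (subst (1 2) fbrk_eq_sum[of ?S "Poly_Mapping.keys g"])
      (auto simp: scal.scale_sum_right algebra_simps)
qed

lemma fbrk_scal_right [simp]: "fbrk f (scal c g) = scal c (fbrk f g)"
proof -
  let ?T = "Poly_Mapping.keys g \<union> Poly_Mapping.keys (scal c g)"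
  show ?thesis
    by (subst (1 2) fbrk_eq_sum[of "Poly_Mapping.keys f" ?T])
      (auto simp: scal.scale_sum_right algebra_simps)
qed

lemma fbrk_single [simp]:
  "fbrk (Poly_Mapping.single s c) (Poly_Mapping.single t d) = Poly_Mapping.single (Brk s t) (c * d)"
  by (subst fbrk_eq_sum[of "{s}" "{t}"]) auto

lemma fbrk_zero [simp]: "fbrk 0 g = 0" "fbrk f 0 = 0"
  by (simp_all add: fbrk_def)

lemma fbrk_diff_left: "fbrk (f - f') g = fbrk f g - fbrk f' g"
  using fbrk_add_left[of "f - f'" f' g] by (simp add: eq_diff_eq)

lemma fbrk_diff_right: "fbrk f (g - g') = fbrk f g - fbrk f g'"
  using fbrk_add_right[of f "g - g'" g'] by (simp add: eq_diff_eq)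

lemma free_superalg_simps [simp]:
  "add (free_superalg G q) = (+)" "null (free_superalg G q) = 0"
  "smul (free_superalg G q) = scal" "brk (free_superalg G q) = fbrk"
  by (simp_all add: free_superalg_def)

lemma elems_free_iff:
  "f \<in> elems (free_superalg G q) \<longleftrightarrow> (\<forall>w\<in>Poly_Mapping.keys f. set_word w \<subseteq> G)"
  by (simp add: free_superalg_def)

lemma part_free_iff:
  "f \<in> part (free_superalg G q) i \<longleftrightarrow>
    (\<forall>w\<in>Poly_Mapping.keys f. set_word w \<subseteq> G \<and> word_parity q w = i)"
  by (simp add: free_superalg_def)

lemma single_in_elems_free:
  "set_word w \<subseteq> G \<Longrightarrow> Poly_Mapping.single w c \<in> elems (free_superalg G q)"
  by (auto simp: elems_free_iff split: if_splits)

lemma single_in_part_free: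
  "set_word w \<subseteq> G \<Longrightarrow> Poly_Mapping.single w c \<in> part (free_superalg G q) (word_parity q w)"
  by (auto simp: part_free_iff split: if_splits)

lemma gen_in_elems_free: "g \<in> G \<Longrightarrow> gen g \<in> elems (free_superalg G q)"
  by (simp add: gen_def single_in_elems_free)

lemma gen_in_part_free: "g \<in> G \<Longrightarrow> gen g \<in> part (free_superalg G q) (q g)"
  using single_in_part_free[of "Gen g" G 1 q] by (simp add: gen_def)

lemma zero_in_elems_free: "0 \<in> elems (free_superalg G q)"
  by (simp add: elems_free_iff)

lemma add_in_elems_free:
  "f \<in> elems (free_superalg G q) \<Longrightarrow> g \<in> elems (free_superalg G q) \<Longrightarrow>
    f + g \<in> elems (free_superalg G q)"
  using keys_add[of f g] by (auto simp: elems_free_iff)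

lemma scal_in_elems_free:
  "f \<in> elems (free_superalg G q) \<Longrightarrow> scal c f \<in> elems (free_superalg G q)"
  by (auto simp: elems_free_iff in_keys_iff)

lemma sum_in_elems_free:
  "(\<And>i. i \<in> M \<Longrightarrow> f i \<in> elems (free_superalg G q)) \<Longrightarrow> sum f M \<in> elems (free_superalg G q)"
  by (induction M rule: infinite_finite_induct) (auto simp: zero_in_elems_free add_in_elems_free)

lemma fbrk_in_elems_free:
  assumes "f \<in> elems (free_superalg G q)" "g \<in> elems (free_superalg G q)"
  shows "fbrk f g \<in> elems (free_superalg G q)"
  unfolding fbrk_def using assms
  by (intro sum_in_elems_free single_in_elems_free) (auto simp: elems_free_iff)

lemma elems_free_induct [consumes 1, case_names zero single add]:
  assumes "f \<in> elems (free_superalg G q)" and "P 0"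
    and "\<And>w c. set_word w \<subseteq> G \<Longrightarrow> P (Poly_Mapping.single w c)"
    and "\<And>f g. P f \<Longrightarrow> P g \<Longrightarrow> P (f + g)"
  shows "P f"
proof -
  have "P (\<Sum>w\<in>M. Poly_Mapping.single w (Poly_Mapping.lookup f w))"
    if "finite M" "M \<subseteq> Poly_Mapping.keys f" for M
    using that by (induction M rule: finite_induct) (use assms in \<open>auto simp: elems_free_iff\<close>)
  from this[of "Poly_Mapping.keys f"] show ?thesis
    by (subst free_elem_eq_sum_single) simp
qed

section \<open>Quotients of nonassociative algebras by ideals\<close>

lemma UN2_const:
  assumes "x \<in> C" "y \<in> D" "\<And>x' y'. x' \<in> C \<Longrightarrow> y' \<in> D \<Longrightarrow> f x' y' = k"
  shows "(\<Union>x'\<in>C. \<Union>y'\<in>D. f x' y') = k"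
  using assms by blast

text \<open>The axioms suffice to compute with cosets and pass to quotients. The same coset calculus
  therefore serves twice: for the half-baked algebra as a quotient of the free one, and for its
  further quotient by an admissibility ideal.\<close>

locale nonassoc_alg =
  fixes A :: "'c superalg"
  assumes add_closed: "x \<in> elems A \<Longrightarrow> y \<in> elems A \<Longrightarrow> add A x y \<in> elems A"
    and add_assoc: "x \<in> elems A \<Longrightarrow> y \<in> elems A \<Longrightarrow> z \<in> elems A \<Longrightarrow>
      add A (add A x y) z = add A x (add A y z)"
    and add_comm: "x \<in> elems A \<Longrightarrow> y \<in> elems A \<Longrightarrow> add A x y = add A y x"
    and null_closed: "null A \<in> elems A"
    and add_null: "x \<in> elems A \<Longrightarrow> add A x (null A) = x"
    and smul_closed: "x \<in> elems A \<Longrightarrow> smul A c x \<in> elems A"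
    and smul_add: "x \<in> elems A \<Longrightarrow> y \<in> elems A \<Longrightarrow>
      smul A c (add A x y) = add A (smul A c x) (smul A c y)"
    and add_inverse: "x \<in> elems A \<Longrightarrow> add A x (smul A (-1) x) = null A"
    and brk_closed: "x \<in> elems A \<Longrightarrow> y \<in> elems A \<Longrightarrow> brk A x y \<in> elems A"
    and brk_add_left: "x \<in> elems A \<Longrightarrow> y \<in> elems A \<Longrightarrow> z \<in> elems A \<Longrightarrow>
      brk A (add A x y) z = add A (brk A x z) (brk A y z)"
    and brk_add_right: "x \<in> elems A \<Longrightarrow> y \<in> elems A \<Longrightarrow> z \<in> elems A \<Longrightarrow>
      brk A x (add A y z) = add A (brk A x y) (brk A x z)"

lemma nonassoc_alg_free: "nonassoc_alg (free_superalg G q)"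
proof
  fix x y :: "'a free_elem"
  show "add (free_superalg G q) x (smul (free_superalg G q) (- 1) x) = null (free_superalg G q)"
    using scal.scale_minus_left[of 1 x] by simp
qed (auto simp: add_in_elems_free zero_in_elems_free scal_in_elems_free fbrk_in_elems_free
    algebra_simps scal.scale_right_distrib fbrk_add_left fbrk_add_right)

locale nonassoc_ideal = nonassoc_alg +
  fixes I
  assumes I_sub: "I \<subseteq> elems A"
    and I_null: "null A \<in> I"
    and I_add: "i \<in> I \<Longrightarrow> j \<in> I \<Longrightarrow> add A i j \<in> I"
    and I_smul: "i \<in> I \<Longrightarrow> smul A c i \<in> I"
    and I_brk: "i \<in> I \<Longrightarrow> x \<in> elems A \<Longrightarrow> brk A i x \<in> I \<and> brk A x i \<in> I"
begin

lemma I_elems: "i \<in> I \<Longrightarrow> i \<in> elems A"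
  using I_sub by blast

lemma coset_iff: "y \<in> coset A I x \<longleftrightarrow> (\<exists>i\<in>I. y = add A x i)"
  by (auto simp: coset_def)

lemma self_in_coset: "x \<in> elems A \<Longrightarrow> x \<in> coset A I x"
  using I_null add_null by (force simp: coset_iff)

lemma coset_add_ideal:
  assumes "x \<in> elems A" "i \<in> I" shows "coset A I (add A x i) = coset A I x"
proof
  show "coset A I (add A x i) \<subseteq> coset A I x"
  proof
    fix z assume "z \<in> coset A I (add A x i)"
    then obtain j where "j \<in> I" "z = add A (add A x i) j" by (auto simp: coset_iff)
    then show "z \<in> coset A I x"
      unfolding coset_iff using assms by (intro bexI[of _ "add A i j"]) (auto simp: add_assoc I_elems I_add)
  qed
  show "coset A I x \<subseteq> coset A I (add A x i)"
  proof
    fix z assume "z \<in> coset A I x"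
    then obtain j where j: "j \<in> I" "z = add A x j" by (auto simp: coset_iff)
    let ?k = "add A (smul A (-1) i) j"
    have "add A (add A x i) ?k = add A x (add A (add A i (smul A (-1) i)) j)"
      using assms j by (simp add: add_assoc I_elems I_smul smul_closed add_closed)
    also have "\<dots> = z"
      using assms j by (simp add: add_inverse I_elems add_comm[OF null_closed] add_null)
    finally show "z \<in> coset A I (add A x i)"
      unfolding coset_iff using assms j by (intro bexI[of _ ?k]) (auto simp: I_smul I_add)
  qed
qed

lemma coset_eq_iff:
  assumes "x \<in> elems A" "y \<in> elems A"
  shows "coset A I x = coset A I y \<longleftrightarrow> add A x (smul A (-1) y) \<in> I"
proof
  assume "coset A I x = coset A I y"
  then obtain i where i: "i \<in> I" "x = add A y i"
    using self_in_coset[OF assms(1)] by (auto simp: coset_iff)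
  have "add A x (smul A (-1) y) = add A (add A i y) (smul A (-1) y)"
    using i assms by (simp add: add_comm I_elems)
  also have "\<dots> = i"
    using i assms by (simp add: add_assoc I_elems smul_closed add_inverse add_null)
  finally show "add A x (smul A (-1) y) \<in> I" using i by simp
next
  assume *: "add A x (smul A (-1) y) \<in> I"
  have "add A y (add A x (smul A (-1) y)) = add A (add A x (smul A (-1) y)) y"
    using assms by (simp add: add_comm add_closed smul_closed)
  also have "\<dots> = add A x (add A y (smul A (-1) y))"
    using assms by (simp add: add_assoc smul_closed add_comm)
  also have "\<dots> = x"
    using assms by (simp add: add_inverse add_null)
  finally show "coset A I x = coset A I y"
    using coset_add_ideal[OF assms(2) *] by simp
qed

lemma quotient_elems: "elems (quotient_superalg A I) = coset A I ` elems A"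
  by (simp add: quotient_superalg_def)

lemma quotient_null: "null (quotient_superalg A I) = coset A I (null A)"
  by (simp add: quotient_superalg_def)

lemma quotient_add:
  assumes "x \<in> elems A" "y \<in> elems A"
  shows "add (quotient_superalg A I) (coset A I x) (coset A I y) = coset A I (add A x y)"
proof -
  have "coset A I (add A x' y') = coset A I (add A x y)"
    if "x' \<in> coset A I x" "y' \<in> coset A I y" for x' y'
  proof -
    obtain i j where ij: "i \<in> I" "j \<in> I" "x' = add A x i" "y' = add A y j"
      using \<open>x' \<in> coset A I x\<close> \<open>y' \<in> coset A I y\<close> by (auto simp: coset_iff)
    have "add A x' y' = add A x (add A (add A i y) j)"
      using ij assms by (simp add: add_assoc I_elems add_closed)
    also have "\<dots> = add A (add A x y) (add A i j)"
      using ij assms by (simp add: add_assoc I_elems add_closed add_comm[of i y])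
    finally show ?thesis using ij assms by (simp add: coset_add_ideal add_closed I_add)
  qed
  then show ?thesis
    using self_in_coset assms unfolding quotient_superalg_def superalg.simps by (intro UN2_const)
qed

lemma quotient_smul:
  assumes "x \<in> elems A"
  shows "smul (quotient_superalg A I) c (coset A I x) = coset A I (smul A c x)"
proof -
  have "coset A I (smul A c x') = coset A I (smul A c x)" if "x' \<in> coset A I x" for x'
    using that assms by (auto simp: coset_iff smul_add I_elems coset_add_ideal smul_closed I_smul)
  then show ?thesis
    using self_in_coset[OF assms] unfolding quotient_superalg_def superalg.simps by blast
qed

lemma quotient_brk:
  assumes "x \<in> elems A" "y \<in> elems A"
  shows "brk (quotient_superalg A I) (coset A I x) (coset A I y) = coset A I (brk A x y)"
proof -
  have "coset A I (brk A x' y') = coset A I (brk A x y)"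
    if "x' \<in> coset A I x" "y' \<in> coset A I y" for x' y'
  proof -
    obtain i j where ij: "i \<in> I" "j \<in> I" "x' = add A x i" "y' = add A y j"
      using \<open>x' \<in> coset A I x\<close> \<open>y' \<in> coset A I y\<close> by (auto simp: coset_iff)
    \<comment> \<open>The product \<open>(x + i)(y + j)\<close> is split with \<open>y'\<close> kept
      whole, so that the only error terms are \<open>x j\<close> and \<open>i y'\<close>, both in
      the ideal.\<close>
    have "brk A x' y' = add A (brk A x y') (brk A i y')"
      unfolding ij(3) using ij assms by (intro brk_add_left) (auto simp: I_elems add_closed)
    moreover have "brk A x y' = add A (brk A x y) (brk A x j)"
      unfolding ij(4) using ij assms by (intro brk_add_right) (auto simp: I_elems)
    ultimately have "brk A x' y' = add A (brk A x y) (add A (brk A x j) (brk A i y'))"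
      using ij assms by (simp only: add_assoc I_elems add_closed brk_closed)
    then show ?thesis
      using ij assms by (simp add: coset_add_ideal brk_closed I_add I_brk I_elems add_closed)
  qed
  then show ?thesis
    using self_in_coset assms unfolding quotient_superalg_def superalg.simps by (intro UN2_const)
qed

lemma nonassoc_alg_quotient: "nonassoc_alg (quotient_superalg A I)"
proof (unfold_locales, goal_cases)
  case (3 x y)
  then show ?case by (auto simp: quotient_elems quotient_add add_comm)
qed (auto simp: quotient_elems quotient_null quotient_add quotient_smul quotient_brk
      add_closed add_assoc add_null null_closed smul_closed smul_add add_inverse brk_closed
      brk_add_left brk_add_right)

end

lemma nonassoc_ideal_superideal: "nonassoc_alg A \<Longrightarrow> superideal A I \<Longrightarrow> nonassoc_ideal A I"
  by (auto simp: nonassoc_ideal_def nonassoc_ideal_axioms_def superideal_def)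

text \<open>Words are homogeneous, so every element splits into an even and an odd part. The whole
  algebra is thus a member of the family intersected in \<open>generated_superideal\<close>, which
  keeps the intersection inside the algebra.\<close>

lemma superideal_elems_free: "superideal (free_superalg G q) (elems (free_superalg G q))"
proof -
  let ?A = "free_superalg G q"
  have "\<exists>y\<in>part ?A 0. \<exists>z\<in>part ?A 1. f = y + z" if "f \<in> elems ?A" for f
    using that
  proof (induction rule: elems_free_induct)
    case zero
    then show ?case by (intro bexI[of _ 0]) (auto simp: part_free_iff)
  next
    case (single w c)
    then have *: "Poly_Mapping.single w c \<in> part ?A (word_parity q w)"
      by (rule single_in_part_free)
    show ?case
    proof (cases "word_parity q w")
      case zero
      with * show ?thesis by (intro bexI[of _ 0] bexI[of _ "Poly_Mapping.single w c"]) (auto simp: part_free_iff)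
    next
      case one
      with * show ?thesis by (intro bexI[of _ 0] bexI[of _ "Poly_Mapping.single w c"]) (auto simp: part_free_iff)
    qed
  next
    case (add f g)
    then obtain y z y' z' where *: "y \<in> part ?A 0" "z \<in> part ?A 1" "f = y + z"
      "y' \<in> part ?A 0" "z' \<in> part ?A 1" "g = y' + z'" by blast
    then have "y + y' \<in> part ?A 0" "z + z' \<in> part ?A 1"
      using keys_add[of y y'] keys_add[of z z'] unfolding part_free_iff by blast+
    moreover have "f + g = (y + y') + (z + z')" using * by (simp add: algebra_simps)
    ultimately show ?case by blast
  qed
  moreover have "part ?A i \<subseteq> elems ?A" for i by (auto simp: part_free_iff elems_free_iff)
  ultimately have "\<exists>y\<in>elems ?A \<inter> part ?A 0. \<exists>z\<in>elems ?A \<inter> part ?A 1. f = y + z"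
    if "f \<in> elems ?A" for f
    using that by blast
  then show ?thesis
    unfolding superideal_def
    by (auto simp: zero_in_elems_free add_in_elems_free scal_in_elems_free fbrk_in_elems_free)
qed

lemma nonassoc_ideal_generated:
  assumes "R \<subseteq> elems (free_superalg G q)"
  shows "nonassoc_ideal (free_superalg G q) (generated_superideal (free_superalg G q) R)"
proof -
  interpret nonassoc_alg "free_superalg G q" by (rule nonassoc_alg_free)
  have "superideal (free_superalg G q) (elems (free_superalg G q))"
    by (rule superideal_elems_free)
  then show ?thesis
    using assms
    by unfold_locales (auto simp: generated_superideal_def superideal_def)
qed

section \<open>Triangular decomposition modulo an ideal\<close>

text \<open>\<open>J\<close> stands for the preimage in the free superalgebra of all that vanishes
  in \<open>g(v)\<close>. Identities in \<open>g(v)\<close> become congruences modulo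
  \<open>J\<close> between free elements, which avoids arithmetic with cosets of cosets;
  \<open>H_J\<close> says that the Cartan subalgebra embeds.\<close>

locale realization =
  fixes v :: "('b::complex_vector, 'x::finite) rdatum" and J
  assumes root_datum: "root_datum v"
    and J_sub: "J \<subseteq> elems (hb_free v)"
    and J_zero: "0 \<in> J"
    and J_add: "f \<in> J \<Longrightarrow> g \<in> J \<Longrightarrow> f + g \<in> J"
    and J_scal: "f \<in> J \<Longrightarrow> scal c f \<in> J"
    and J_brk_left: "f \<in> J \<Longrightarrow> g \<in> elems (hb_free v) \<Longrightarrow> fbrk f g \<in> J"
    and J_brk_right: "f \<in> J \<Longrightarrow> g \<in> elems (hb_free v) \<Longrightarrow> fbrk g f \<in> J"
    and lie_J: "lie_relations (hgens v) (hparity v) \<subseteq> J"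
    and hb_J: "hb_relations v \<subseteq> J"
    and H_J: "h \<in> space v \<Longrightarrow> gen (H h) \<in> J \<Longrightarrow> h = 0"
begin

abbreviation "L \<equiv> elems (hb_free v)"

lemmas subspace_space = root_datumD(1)[OF root_datum]
  and a_in_space = root_datumD(2)[OF root_datum]
  and b_dual = root_datumD(3)[OF root_datum]

lemma J_uminus: "f \<in> J \<Longrightarrow> - f \<in> J"
  using J_scal[of f "-1"] by simp

lemma J_diff: "f \<in> J \<Longrightarrow> g \<in> J \<Longrightarrow> f - g \<in> J"
  using J_add[of f "- g"] J_uminus[of g] by simp

lemma J_sum: "(\<And>i. i \<in> M \<Longrightarrow> f i \<in> J) \<Longrightarrow> sum f M \<in> J"
  by (induction M rule: infinite_finite_induct) (auto simp: J_zero J_add)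

lemma J_scal_cancel: "scal c f \<in> J \<Longrightarrow> c \<noteq> 0 \<Longrightarrow> f \<in> J"
  using J_scal[of "scal c f" "inverse c"] by simp

lemma L_J: "f \<in> J \<Longrightarrow> f \<in> L"
  using J_sub by blast

lemma L_zero: "0 \<in> L" and L_add: "f \<in> L \<Longrightarrow> g \<in> L \<Longrightarrow> f + g \<in> L"
  and L_scal: "f \<in> L \<Longrightarrow> scal c f \<in> L" and L_brk: "f \<in> L \<Longrightarrow> g \<in> L \<Longrightarrow> fbrk f g \<in> L"
  by (simp_all add: hb_free_def zero_in_elems_free add_in_elems_free scal_in_elems_free
      fbrk_in_elems_free)

lemma L_uminus: "f \<in> L \<Longrightarrow> - f \<in> L"
  using L_scal[of f "-1"] by simp

lemma L_diff: "f \<in> L \<Longrightarrow> g \<in> L \<Longrightarrow> f - g \<in> L"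
  using L_add[of f "- g"] L_uminus[of g] by simp

lemma L_gen: "h \<in> space v \<Longrightarrow> gen (H h) \<in> L" "gen (E x) \<in> L" "gen (F x) \<in> L"
  by (auto simp: hb_free_def hgens_def intro!: gen_in_elems_free)

lemma part_gen:
  "h \<in> space v \<Longrightarrow> gen (H h) \<in> part (hb_free v) 0"
  "gen (E x) \<in> part (hb_free v) (p_of v x)" "gen (F x) \<in> part (hb_free v) (p_of v x)"
  using gen_in_part_free[of "H h" "hgens v" "hparity v"] gen_in_part_free[of "E x" "hgens v" "hparity v"]
    gen_in_part_free[of "F x" "hgens v" "hparity v"]
  by (auto simp: hb_free_def hgens_def)

lemma L_part: "f \<in> part (hb_free v) i \<Longrightarrow> f \<in> L"
  by (simp add: hb_free_def part_free_iff elems_free_iff)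

lemma skew: "f \<in> part (hb_free v) i \<Longrightarrow> g \<in> part (hb_free v) j \<Longrightarrow>
    fbrk f g + scal (koszul i j) (fbrk g f) \<in> J"
  by (rule subsetD[OF lie_J], unfold lie_relations_def hb_free_def, rule UnI1) blast

lemma jacobi: "f \<in> part (hb_free v) i \<Longrightarrow> g \<in> part (hb_free v) j \<Longrightarrow> k \<in> L \<Longrightarrow>
    fbrk f (fbrk g k) - fbrk (fbrk f g) k - scal (koszul i j) (fbrk g (fbrk f k)) \<in> J"
  by (rule subsetD[OF lie_J], unfold lie_relations_def hb_free_def, rule UnI2) blast

lemma rel_H_add: "h \<in> space v \<Longrightarrow> k \<in> space v \<Longrightarrow> gen (H (h + k)) - gen (H h) - gen (H k) \<in> J"
  and rel_H_scal: "h \<in> space v \<Longrightarrow> gen (H (c *\<^sub>C h)) - scal c (gen (H h)) \<in> J"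
  and rel_HH: "h \<in> space v \<Longrightarrow> k \<in> space v \<Longrightarrow> fbrk (gen (H h)) (gen (H k)) \<in> J"
  and rel_HE: "h \<in> space v \<Longrightarrow>
    fbrk (gen (H h)) (gen (E x)) - scal (b_of v x h) (gen (E x)) \<in> J"
  and rel_HF: "h \<in> space v \<Longrightarrow>
    fbrk (gen (H h)) (gen (F x)) + scal (b_of v x h) (gen (F x)) \<in> J"
  and rel_EF: "x \<noteq> y \<Longrightarrow> fbrk (gen (E x)) (gen (F y)) \<in> J"
  and rel_EF_same: "fbrk (gen (E x)) (gen (F x)) - gen (H (a_of v x)) \<in> J"
  by (rule subsetD[OF hb_J], unfold hb_relations_def, blast)+

lemma rel_H_zero: "gen (H 0) \<in> J"
  using rel_H_scal[of 0 0] subspace_space by (simp add: complex_vector.subspace_0)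

text \<open>Otherwise its bracket with \<open>gen (F x)\<close> would vanish too, but that bracket
  is the nonzero coroot \<open>a_of v x\<close>.\<close>

lemma E_notin_J: "gen (E x) \<notin> J"
proof
  assume "gen (E x) \<in> J"
  then have "fbrk (gen (E x)) (gen (F x)) \<in> J"
    by (intro J_brk_left L_gen)
  then have "gen (H (a_of v x)) \<in> J"
    using rel_EF_same[of x] J_diff by fastforce
  then show False using H_J[OF a_in_space] a_nonzero[OF root_datum] by blast
qed

section \<open>Weight vectors modulo the ideal\<close>

definition weight_vec :: "('b \<Rightarrow> complex) \<Rightarrow> ('b, 'x) hgen free_elem \<Rightarrow> bool" where
  "weight_vec \<alpha> f \<longleftrightarrow> f \<in> L \<and> (\<forall>h\<in>space v. fbrk (gen (H h)) f - scal (\<alpha> h) f \<in> J)"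

lemma weight_vec_J: "f \<in> J \<Longrightarrow> weight_vec \<alpha> f"
  by (auto simp: weight_vec_def L_J L_gen intro!: J_diff J_scal J_brk_right)

lemma weight_vec_add: "weight_vec \<alpha> f \<Longrightarrow> weight_vec \<alpha> g \<Longrightarrow> weight_vec \<alpha> (f + g)"
  unfolding weight_vec_def
  by (auto simp: L_add fbrk_add_right scal.scale_right_distrib add_diff_add intro!: J_add)

lemma weight_vec_scal: "weight_vec \<alpha> f \<Longrightarrow> weight_vec \<alpha> (scal c f)"
proof -
  assume *: "weight_vec \<alpha> f"
  have "fbrk (gen (H h)) (scal c f) - scal (\<alpha> h) (scal c f)
      = scal c (fbrk (gen (H h)) f - scal (\<alpha> h) f)" for h
    by (simp add: scal.scale_right_diff_distrib mult.commute)
  then show ?thesis using * by (auto simp: weight_vec_def L_scal intro: J_scal)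
qed

text \<open>Bracketing with a Cartan element is a derivation, by the Jacobi relation, whose sign is
  trivial because Cartan elements are even. The factor \<open>e\<close> is homogeneous since that
  relation is imposed for homogeneous first and second arguments.\<close>

lemma weight_vec_brk:
  assumes "weight_vec \<alpha> e" "e \<in> part (hb_free v) i" "weight_vec \<beta> f"
  shows "weight_vec (\<lambda>h. \<alpha> h + \<beta> h) (fbrk e f)"
proof -
  have "fbrk (gen (H h)) (fbrk e f) - scal (\<alpha> h + \<beta> h) (fbrk e f) \<in> J" if h: "h \<in> space v" for h
  proof -
    have "fbrk (gen (H h)) (fbrk e f) - scal (\<alpha> h + \<beta> h) (fbrk e f)
      = (fbrk (gen (H h)) (fbrk e f) - fbrk (fbrk (gen (H h)) e) f - scal (koszul 0 i) (fbrk e (fbrk (gen (H h)) f)))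
      + fbrk (fbrk (gen (H h)) e - scal (\<alpha> h) e) f + fbrk e (fbrk (gen (H h)) f - scal (\<beta> h) f)"
      by (simp add: fbrk_diff_left fbrk_diff_right koszul_def scal.scale_left_distrib)
    also have "\<dots> \<in> J"
      using assms h by (intro J_add jacobi J_brk_left J_brk_right part_gen) (auto simp: weight_vec_def)
    finally show ?thesis .
  qed
  then show ?thesis using assms by (auto simp: weight_vec_def L_brk)
qed

text \<open>The usual argument for eigenvectors, relative to \<open>J\<close>: applying
  \<open>ad h - \<beta>(h)\<close> removes the \<beta>-term and multiplies the \<gamma>-term by the
  nonzero number \<open>\<gamma> h - \<beta> h\<close>.\<close>

lemma weight_vec_independent:
  assumes "finite M" "\<And>\<alpha>. \<alpha> \<in> M \<Longrightarrow> weight_vec \<alpha> (t \<alpha>)"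
    "\<And>\<alpha>. \<alpha> \<in> M \<Longrightarrow> \<alpha> \<in> dual_space (space v)" "sum t M \<in> J" "\<alpha> \<in> M"
  shows "t \<alpha> \<in> J"
  using assms
proof (induction M arbitrary: t \<alpha> rule: finite_induct)
  case (insert \<beta> M)
  have *: "t \<gamma> \<in> J" if \<gamma>: "\<gamma> \<in> M" for \<gamma>
  proof -
    \<comment> \<open>Distinct functionals in \<open>dual_space\<close> differ somewhere on the
      space itself, because they are all zero outside it.\<close>
    have "\<exists>h\<in>space v. \<gamma> h \<noteq> \<beta> h"
    proof (rule ccontr)
      assume "\<not> ?thesis"
      moreover have "\<gamma> k = 0" "\<beta> k = 0" if "k \<notin> space v" for k
        using insert.prems(2)[of \<gamma>] insert.prems(2)[of \<beta>] \<gamma> that by (auto simp: dual_space_def)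
      ultimately have "\<gamma> = \<beta>" by (intro ext) metis
      then show False using \<gamma> insert.hyps by simp
    qed
    then obtain h where h: "h \<in> space v" "\<gamma> h \<noteq> \<beta> h" by blast
    have "fbrk (gen (H h)) (sum t (insert \<beta> M)) - scal (\<beta> h) (sum t (insert \<beta> M))
        = (\<Sum>\<delta>\<in>insert \<beta> M. fbrk (gen (H h)) (t \<delta>) - scal (\<beta> h) (t \<delta>))"
    proof -
      have "fbrk (gen (H h)) (sum t N) = (\<Sum>\<delta>\<in>N. fbrk (gen (H h)) (t \<delta>))" for N
        by (induction N rule: infinite_finite_induct) (auto simp: fbrk_add_right)
      then show ?thesis by (simp only: sum_subtractf scal.scale_sum_right)
    qed
    also have "\<dots> = (\<Sum>\<delta>\<in>insert \<beta> M. fbrk (gen (H h)) (t \<delta>) - scal (\<delta> h) (t \<delta>))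
         + (\<Sum>\<delta>\<in>insert \<beta> M. scal (\<delta> h - \<beta> h) (t \<delta>))"
      by (simp only: sum.distrib[symmetric]) (simp add: scal.scale_left_diff_distrib)
    finally have eq: "(\<Sum>\<delta>\<in>insert \<beta> M. scal (\<delta> h - \<beta> h) (t \<delta>))
       = fbrk (gen (H h)) (sum t (insert \<beta> M)) - scal (\<beta> h) (sum t (insert \<beta> M))
         - (\<Sum>\<delta>\<in>insert \<beta> M. fbrk (gen (H h)) (t \<delta>) - scal (\<delta> h) (t \<delta>))"
      by simp
    have "(\<Sum>\<delta>\<in>insert \<beta> M. scal (\<delta> h - \<beta> h) (t \<delta>)) \<in> J"
    proof -
      have "(\<Sum>\<delta>\<in>insert \<beta> M. fbrk (gen (H h)) (t \<delta>) - scal (\<delta> h) (t \<delta>)) \<in> J"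
        using h insert.prems by (intro J_sum) (auto simp: weight_vec_def)
      moreover have "fbrk (gen (H h)) (sum t (insert \<beta> M)) \<in> J"
        using h insert.prems by (intro J_brk_right L_gen)
      moreover have "scal (\<beta> h) (sum t (insert \<beta> M)) \<in> J"
        using insert.prems by (intro J_scal)
      ultimately show ?thesis unfolding eq by (intro J_diff)
    qed
    then have "(\<Sum>\<delta>\<in>M. scal (\<delta> h - \<beta> h) (t \<delta>)) \<in> J"
      using insert.hyps by simp
    then have "scal (\<gamma> h - \<beta> h) (t \<gamma>) \<in> J"
      using insert.prems \<gamma> insert.IH[of "\<lambda>\<delta>. scal (\<delta> h - \<beta> h) (t \<delta>)" \<gamma>]
      by (auto intro: weight_vec_scal)
    then show ?thesis using h by (auto intro: J_scal_cancel)
  qed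
  have "t \<beta> = sum t (insert \<beta> M) - sum t M" using insert.hyps by simp
  then have "t \<beta> \<in> J" using J_diff[OF insert.prems(3) J_sum[of M t]] * by simp
  with * insert.prems show ?case by blast
qed simp

end

text \<open>One of the two halves of the triangular decomposition: the \<open>e x\<close> are raising and the \<open>f x\<close>
  lowering operators, or the other way round.\<close>

locale half_realization = realization v J
  for v :: "('b::complex_vector, 'x::finite) rdatum" and J +
  fixes e f :: "'x \<Rightarrow> ('b, 'x) hgen free_elem" and B :: "'x \<Rightarrow> 'b \<Rightarrow> complex" and A :: "'x \<Rightarrow> 'b"
  assumes e_part: "e x \<in> part (hb_free v) (p_of v x)"
    and f_part: "f x \<in> part (hb_free v) (p_of v x)"
    and He: "h \<in> space v \<Longrightarrow> fbrk (gen (H h)) (e x) - scal (B x h) (e x) \<in> J"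
    and Hf: "h \<in> space v \<Longrightarrow> fbrk (gen (H h)) (f x) + scal (B x h) (f x) \<in> J"
    and fe: "x \<noteq> y \<Longrightarrow> fbrk (f x) (e y) \<in> J"
    and fe_same: "fbrk (f x) (e x) - gen (H (A x)) \<in> J"
    and A_in_space: "A x \<in> space v"
begin

lemma e_L: "e x \<in> L" and f_L: "f x \<in> L"
  using e_part f_part L_part by blast+

text \<open>The span, modulo \<open>J\<close>, of the iterated brackets of the \<open>e x\<close> in which each \<open>e y\<close> occurs
  \<open>n y\<close> times; for \<open>n = 0\<close> it is the Cartan subalgebra.\<close>

inductive graded :: "('x \<Rightarrow> nat) \<Rightarrow> ('b, 'x) hgen free_elem \<Rightarrow> bool" where
  Cartan: "h \<in> space v \<Longrightarrow> graded (\<lambda>_. 0) (gen (H h))"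
| base: "graded ((\<lambda>_. 0)(x := Suc 0)) (e x)"
| brk: "graded n t \<Longrightarrow> graded (n(x := Suc (n x))) (fbrk (e x) t)"
| ideal: "g \<in> J \<Longrightarrow> graded n g"
| add: "graded n s \<Longrightarrow> graded n t \<Longrightarrow> graded n (s + t)"
| scal: "graded n t \<Longrightarrow> graded n (scal c t)"

lemma graded_cong: "graded n s \<Longrightarrow> t - s \<in> J \<Longrightarrow> graded n t"
  using graded.add[of n s "t - s"] graded.ideal[of "t - s" n] by simp

lemma graded_L: "graded n t \<Longrightarrow> t \<in> L"
  by (induction rule: graded.induct) (auto simp: L_gen e_L L_brk L_J L_add L_scal)

lemma weight_vec_e: "weight_vec (B x) (e x)"
  by (auto simp: weight_vec_def e_L He)

lemma graded_weight: "graded n t \<Longrightarrow> weight_vec (\<lambda>h. \<Sum>y\<in>UNIV. of_nat (n y) * B y h) t"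
proof (induction rule: graded.induct)
  case (Cartan h)
  then show ?case by (auto simp: weight_vec_def L_gen rel_HH)
next
  case (base x)
  have "(\<Sum>y\<in>UNIV. of_nat (((\<lambda>_. 0)(x := Suc 0)) y) * B y h) = B x h" for h
    by (subst sum.remove[of _ x]) auto
  then show ?case by (simp add: weight_vec_e)
next
  case (brk n t x)
  have "(\<Sum>y\<in>UNIV. of_nat ((n(x := Suc (n x))) y) * B y h)
      = B x h + (\<Sum>y\<in>UNIV. of_nat (n y) * B y h)" for h
    by (subst (1 2) sum.remove[of _ x]) (auto simp: algebra_simps intro!: sum.cong)
  then show ?case using weight_vec_brk[OF weight_vec_e e_part brk.IH] by simp
qed (auto intro: weight_vec_J weight_vec_add weight_vec_scal)

lemma graded_ad_H:
  assumes "graded n t" "h \<in> space v" shows "graded n (fbrk (gen (H h)) t)"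
  using graded_weight[OF assms(1)] assms
  by (auto simp: weight_vec_def intro: graded_cong graded.scal)

text \<open>The rules \<open>base\<close> and \<open>brk\<close> produce a positive count, so degree
  zero is reached only from Cartan elements and \<open>J\<close> by linear combinations. Linearity
  of \<open>gen (H h)\<close> modulo \<open>J\<close> then gives a single Cartan element.\<close>

lemma graded_zero:
  "graded n t \<Longrightarrow> n = (\<lambda>_. 0) \<Longrightarrow> \<exists>h\<in>space v. t - gen (H h) \<in> J"
proof (induction rule: graded.induct)
  case (Cartan h)
  then show ?case using J_zero by (intro bexI[of _ h]) auto
next
  case (base x)
  then show ?case using fun_cong[OF base.prems, of x] by simp
next
  case (brk n t x)
  then show ?case using fun_cong[OF brk.prems, of x] by simp
next
  case (ideal g n)
  then show ?case
    using subspace_space rel_H_zero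
    by (intro bexI[of _ 0] J_diff) (auto simp: complex_vector.subspace_0)
next
  case (add n s t)
  then obtain h k where hk: "h \<in> space v" "k \<in> space v" "s - gen (H h) \<in> J" "t - gen (H k) \<in> J"
    by blast
  have "s + t - gen (H (h + k)) = (s - gen (H h)) + (t - gen (H k))
      - (gen (H (h + k)) - gen (H h) - gen (H k))" by simp
  also have "\<dots> \<in> J" using hk by (intro J_add J_diff[OF _ rel_H_add]) auto
  finally show ?case using hk subspace_space by (auto intro: complex_vector.subspace_add)
next
  case (scal n t c)
  then obtain h where h: "h \<in> space v" "t - gen (H h) \<in> J" by blast
  have "scal c t - gen (H (c *\<^sub>C h)) = scal c (t - gen (H h))
      - (gen (H (c *\<^sub>C h)) - scal c (gen (H h)))" by (simp add: scal.scale_right_diff_distrib)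
  also have "\<dots> \<in> J" using h by (intro J_diff[OF _ rel_H_scal] J_scal) auto
  finally show ?case using h subspace_space by (auto intro: complex_vector.subspace_scale)
qed

lemma eH: "h \<in> space v \<Longrightarrow> fbrk (e x) (gen (H h)) + scal (B x h) (e x) \<in> J"
proof -
  assume h: "h \<in> space v"
  have "fbrk (e x) (gen (H h)) + scal (B x h) (e x)
    = (fbrk (e x) (gen (H h)) + scal (koszul (p_of v x) 0) (fbrk (gen (H h)) (e x)))
      - (fbrk (gen (H h)) (e x) - scal (B x h) (e x))" by (simp add: koszul_def)
  also have "\<dots> \<in> J" using h by (intro J_diff skew He e_part part_gen)
  finally show ?thesis .
qed

lemma fH: "h \<in> space v \<Longrightarrow> fbrk (f x) (gen (H h)) - scal (B x h) (f x) \<in> J"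
proof -
  assume h: "h \<in> space v"
  have "fbrk (f x) (gen (H h)) - scal (B x h) (f x)
    = (fbrk (f x) (gen (H h)) + scal (koszul (p_of v x) 0) (fbrk (gen (H h)) (f x)))
      - (fbrk (gen (H h)) (f x) + scal (B x h) (f x))" by (simp add: koszul_def)
  also have "\<dots> \<in> J" using h by (intro J_diff skew Hf f_part part_gen)
  finally show ?thesis .
qed

lemma brk_e_graded_zero:
  assumes "graded (\<lambda>_. 0) t" shows "\<exists>c. fbrk (e x) t - scal c (e x) \<in> J"
proof -
  obtain h where h: "h \<in> space v" "t - gen (H h) \<in> J" using graded_zero assms by blast
  have "fbrk (e x) t - scal (- B x h) (e x) = fbrk (e x) (t - gen (H h))
      + (fbrk (e x) (gen (H h)) + scal (B x h) (e x))" by (simp add: fbrk_diff_right)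
  also have "\<dots> \<in> J" using h by (intro J_add J_brk_right eH e_L)
  finally show ?thesis by blast
qed

lemma brk_f_graded_zero:
  assumes "graded (\<lambda>_. 0) t" shows "\<exists>c. fbrk (f x) t - scal c (f x) \<in> J"
proof -
  obtain h where h: "h \<in> space v" "t - gen (H h) \<in> J" using graded_zero assms by blast
  have "fbrk (f x) t - scal (B x h) (f x) = fbrk (f x) (t - gen (H h))
      + (fbrk (f x) (gen (H h)) - scal (B x h) (f x))" by (simp add: fbrk_diff_right)
  also have "\<dots> \<in> J" using h by (intro J_add J_brk_right fH f_L)
  finally show ?thesis by blast
qed

text \<open>A bracket of this degree must be \<open>[e x, t]\<close> with \<open>t\<close> of degree
  zero, hence with \<open>t\<close> in the Cartan subalgebra modulo \<open>J\<close>, and it is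
  again a multiple of \<open>e x\<close>.\<close>

lemma graded_one:
  "graded n t \<Longrightarrow> n = (\<lambda>_. 0)(x := Suc 0) \<Longrightarrow> \<exists>c. t - scal c (e x) \<in> J"
proof (induction rule: graded.induct)
  case (Cartan h)
  then show ?case using fun_cong[OF Cartan.prems, of x] by simp
next
  case (base y)
  then have "y = x" using fun_cong[OF base.prems, of y] by (auto split: if_splits)
  then show ?case using J_zero by (intro exI[of _ 1]) auto
next
  case (brk n t y)
  then have "y = x" using fun_cong[OF brk.prems, of y] by (auto split: if_splits)
  moreover have "n = (\<lambda>_. 0)"
  proof
    fix z show "n z = 0"
      using fun_cong[OF brk.prems, of z] \<open>y = x\<close> by (auto split: if_splits)
  qed
  ultimately show ?case using brk_e_graded_zero brk.hyps by blast
next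
  case (ideal g n)
  then show ?case by (intro exI[of _ 0]) auto
next
  case (add n s t)
  then obtain c d where "s - scal c (e x) \<in> J" "t - scal d (e x) \<in> J" by blast
  then show ?case
    using J_add[of "s - scal c (e x)" "t - scal d (e x)"]
    by (intro exI[of _ "c + d"]) (simp add: scal.scale_left_distrib add_diff_add)
next
  case (scal n t c)
  then obtain d where "t - scal d (e x) \<in> J" by blast
  then show ?case
    using J_scal[of "t - scal d (e x)" c]
    by (intro exI[of _ "c * d"]) (simp add: scal.scale_right_diff_distrib)
qed

lemma jacobi_fe:
  assumes "t \<in> L"
  shows "fbrk (f y) (fbrk (e x) t) - (fbrk (fbrk (f y) (e x)) t
     + scal (koszul (p_of v y) (p_of v x)) (fbrk (e x) (fbrk (f y) t))) \<in> J"
  using jacobi[OF f_part e_part assms, of y x] by (simp add: diff_diff_eq)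

lemma graded_fe:
  assumes "graded n t" shows "graded n (fbrk (fbrk (f x) (e x)) t)"
proof -
  have "fbrk (fbrk (f x) (e x)) t - fbrk (gen (H (A x))) t \<in> J"
    using J_brk_left[OF fe_same graded_L[OF assms]] by (simp add: fbrk_diff_left)
  then show ?thesis using graded_cong graded_ad_H[OF assms A_in_space] by blast
qed

text \<open>Induction by the Jacobi relation \<open>[f,[e,t]] = [[f,e],t] + sign [e,[f,t]]\<close>,
  where \<open>[f y, e x]\<close> is a Cartan element or 0 modulo \<open>J\<close>: bracketing with
  \<open>f y\<close> takes away one \<open>e y\<close>. Degree zero is excepted from the first claim
  because there \<open>[f y, h]\<close> is a multiple of \<open>f y\<close>.\<close>

lemma graded_ad_f:
  "graded n t \<Longrightarrow> (n \<noteq> (\<lambda>_. 0) \<and> n y = 0 \<longrightarrow> fbrk (f y) t \<in> J) \<and>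
     (n y \<noteq> 0 \<longrightarrow> graded (n(y := n y - 1)) (fbrk (f y) t))"
proof (induction rule: graded.induct)
  case (Cartan h)
  then show ?case by simp
next
  case (base x)
  have "graded (\<lambda>_. 0) (fbrk (f x) (e x))"
    using fe_same by (rule graded_cong[OF graded.Cartan[OF A_in_space]])
  moreover have "(\<lambda>_. 0) = ((\<lambda>_. 0)(x := Suc 0))(x := ((\<lambda>_. 0)(x := Suc 0)) x - 1)"
    by auto
  ultimately have "graded (((\<lambda>_. 0)(x := Suc 0))(x := ((\<lambda>_. 0)(x := Suc 0)) x - 1))
      (fbrk (f x) (e x))" by (rule subst[rotated])
  then show ?case using fe[of y x]
    by (cases "y = x") (simp_all only: fun_upd_same fun_upd_other simp_thms nat.distinct)
next
  case (brk n t x)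
  let ?s = "fbrk (f y) (fbrk (e x) t)"
  let ?k = "koszul (p_of v y) (p_of v x)"
  have t: "t \<in> L" using brk.hyps by (rule graded_L)
  have vanish: "fbrk (fbrk (f y) (e x)) t \<in> J" if "y \<noteq> x"
    using J_brk_left[OF fe[OF that] t] .
  have split: "graded m ?s" if "graded m (fbrk (fbrk (f y) (e x)) t)"
      "graded m (fbrk (e x) (fbrk (f y) t))" for m
    using that by (intro graded_cong[OF _ jacobi_fe] graded.add graded.scal t)
  have vanish': "fbrk (e x) (fbrk (f y) t) \<in> J" if "fbrk (f y) t \<in> J"
    using J_brk_right[OF that e_L] .
  show ?case
  proof (cases "y = x")
    case True
    have "graded n (fbrk (e x) (fbrk (f y) t))"
    proof (cases "n = (\<lambda>_. 0)")
      \<comment> \<open>The induction hypothesis is empty for Cartan elements: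
        \<open>fbrk (f y) t\<close> is a multiple of \<open>f y\<close>, and only the bracket with
        \<open>e x\<close> leads back to the Cartan subalgebra.\<close>
      case zero: True
      then obtain c where c: "fbrk (f y) t - scal c (f y) \<in> J"
        using brk_f_graded_zero brk.hyps by blast
      have "fbrk (e x) (f y) + scal (koszul (p_of v x) (p_of v x)) (fbrk (f y) (e x)) \<in> J"
        using skew[OF e_part f_part] True by simp
      moreover have "graded n (fbrk (f y) (e x))"
        using fe_same[of x] graded_cong[OF graded.Cartan[OF A_in_space]] True zero by blast
      ultimately have "graded n (fbrk (e x) (f y))"
        using graded_cong[OF graded.scal[of n "fbrk (f y) (e x)" "- koszul (p_of v x) (p_of v x)"]]
        by simp
      moreover have "fbrk (e x) (fbrk (f y) t) - scal c (fbrk (e x) (f y)) \<in> J"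
        using J_brk_right[OF c e_L] by (simp add: fbrk_diff_right)
      ultimately show ?thesis by (blast intro: graded_cong graded.scal)
    next
      case nonzero: False
      show ?thesis
      proof (cases "n y = 0")
        case True
        then show ?thesis using brk.IH nonzero vanish' by (blast intro: graded.ideal)
      next
        case False
        then have "graded (n(y := n y - 1)) (fbrk (f y) t)" using brk.IH by blast
        from graded.brk[OF this, of x] show ?thesis using True False by simp
      qed
    qed
    then have "graded n ?s"
      using split[of n] graded_fe[OF brk.hyps, of x] True by simp
    moreover have "n = (n(x := Suc (n x)))(y := (n(x := Suc (n x))) y - 1)"
      using True by auto
    ultimately show ?thesis using True by (simp only: fun_upd_same nat.distinct simp_thms)
  next
    case False
    show ?thesis
    proof (intro conjI impI)
      assume *: "n(x := Suc (n x)) \<noteq> (\<lambda>_. 0) \<and> (n(x := Suc (n x))) y = 0"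
      have r: "fbrk (e x) (fbrk (f y) t) \<in> J"
      proof (cases "n = (\<lambda>_. 0)")
        case zero: True
        then obtain c where c: "fbrk (f y) t - scal c (f y) \<in> J"
          using brk_f_graded_zero brk.hyps by blast
        have "fbrk (e x) (f y) + scal (koszul (p_of v x) (p_of v y)) (fbrk (f y) (e x)) \<in> J"
          using skew[OF e_part f_part] by simp
        from J_diff[OF this J_scal[OF fe[OF False], of "koszul (p_of v x) (p_of v y)"]] have "fbrk (e x) (f y) \<in> J" by simp
        moreover have "fbrk (e x) (fbrk (f y) t) - scal c (fbrk (e x) (f y)) \<in> J"
          using J_brk_right[OF c e_L] by (simp add: fbrk_diff_right)
        ultimately show ?thesis
          using J_add[OF _ J_scal[of "fbrk (e x) (f y)" c]] by fastforce
      next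
        case nonzero: False
        then show ?thesis using brk.IH * False vanish' by auto
      qed
      show "?s \<in> J"
        using J_add[OF jacobi_fe[OF t, of y x] J_add[OF vanish[OF False] J_scal[OF r, of ?k]]] by simp
    next
      assume "(n(x := Suc (n x))) y \<noteq> 0"
      then have "n y \<noteq> 0" using False by simp
      then have "graded (n(y := n y - 1)) (fbrk (f y) t)" using brk.IH by blast
      from graded.brk[OF this, of x]
      have "graded ((n(y := n y - 1))(x := Suc (n x))) (fbrk (e x) (fbrk (f y) t))"
        by (simp only: fun_upd_other[OF not_sym[OF False]])
      moreover have "(n(y := n y - 1))(x := Suc (n x))
          = (n(x := Suc (n x)))(y := (n(x := Suc (n x))) y - 1)"
        using False by auto
      ultimately have "graded ((n(x := Suc (n x)))(y := (n(x := Suc (n x))) y - 1))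
          (fbrk (e x) (fbrk (f y) t))" by (simp only:)
      then show "graded ((n(x := Suc (n x)))(y := (n(x := Suc (n x))) y - 1)) ?s"
        using split vanish[OF False] by (blast intro: graded.ideal)
    qed
  qed
next
  case (ideal g n)
  then show ?case by (auto intro: graded.ideal J_brk_right f_L)
next
  case (add n s t)
  then show ?case by (auto simp: fbrk_add_right intro: J_add graded.add)
next
  case (scal n t c)
  then show ?case by (auto intro: J_scal graded.scal)
qed

end

text \<open>For roots this is positivity relative to the base at \<open>v\<close>.\<close>

definition nat_comb :: "('b, 'x::finite) rdatum \<Rightarrow> ('b \<Rightarrow> complex) \<Rightarrow> bool" where
  "nat_comb v \<alpha> \<longleftrightarrow> (\<exists>n :: 'x \<Rightarrow> nat. \<alpha> = (\<lambda>h. \<Sum>y\<in>UNIV. of_nat (n y) * b_of v y h))"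

lemma sum_delta_mult: "(\<Sum>y\<in>(UNIV::'x::finite set). (if y = x then 1 else 0) * g y) = (g x :: complex)"
  by (subst sum.remove[of _ x]) auto

lemma sum_unit_mult:
  "(\<Sum>y\<in>(UNIV::'x::finite set). of_nat (((\<lambda>_. 0)(x := Suc 0)) y) * g y) = (g x :: complex)"
  by (subst sum.remove[of _ x]) auto

section \<open>Both halves together span the algebra\<close>

context realization
begin

text \<open>The coroot carries the sign \<open>- koszul (p_of v x) (p_of v x)\<close> because the
  locale asks for \<open>[f x, e x]\<close>, while the defining relation gives
  \<open>[e x, f x]\<close>; super skew-symmetry relates the two. In the negative half the order is
  already right.\<close>

interpretation pos: half_realization v J "\<lambda>x. gen (E x)" "\<lambda>x. gen (F x)" "b_of v"
  "\<lambda>x. (- koszul (p_of v x) (p_of v x)) *\<^sub>C a_of v x"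
proof
  fix x y :: 'x and h
  show "fbrk (gen (F x)) (gen (E x)) - gen (H ((- koszul (p_of v x) (p_of v x)) *\<^sub>C a_of v x)) \<in> J"
  proof -
    let ?k = "koszul (p_of v x) (p_of v x)"
    have "fbrk (gen (F x)) (gen (E x)) - gen (H ((- ?k) *\<^sub>C a_of v x))
      = (fbrk (gen (F x)) (gen (E x)) + scal ?k (fbrk (gen (E x)) (gen (F x))))
        - scal ?k (fbrk (gen (E x)) (gen (F x)) - gen (H (a_of v x)))
        - (gen (H ((- ?k) *\<^sub>C a_of v x)) - scal (- ?k) (gen (H (a_of v x))))"
      by (simp add: scal.scale_right_diff_distrib)
    also have "\<dots> \<in> J"
      by (intro J_diff J_scal skew part_gen rel_EF_same rel_H_scal a_in_space)
    finally show ?thesis .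
  qed
  show "(- koszul (p_of v x) (p_of v x)) *\<^sub>C a_of v x \<in> space v"
    by (rule complex_vector.subspace_scale[OF subspace_space a_in_space])
  assume "x \<noteq> y"
  then have *: "fbrk (gen (E y)) (gen (F x)) \<in> J" by (intro rel_EF) auto
  have "fbrk (gen (F x)) (gen (E y)) + scal (koszul (p_of v x) (p_of v y)) (fbrk (gen (E y)) (gen (F x))) \<in> J"
    by (intro skew part_gen)
  from J_diff[OF this J_scal[OF *, of "koszul (p_of v x) (p_of v y)"]] show "fbrk (gen (F x)) (gen (E y)) \<in> J" by simp
qed (auto intro: part_gen rel_HE rel_HF)

interpretation neg: half_realization v J "\<lambda>x. gen (F x)" "\<lambda>x. gen (E x)" "\<lambda>x h. - b_of v x h"
  "a_of v"
  by unfold_locales (auto intro: part_gen rel_EF rel_EF_same a_in_space rel_HE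
      simp: rel_HF[unfolded scal.scale_minus_left])

inductive triangular :: "('b, 'x) hgen free_elem \<Rightarrow> bool" where
  pos: "pos.graded n t \<Longrightarrow> triangular t"
| neg: "neg.graded n t \<Longrightarrow> triangular t"
| add: "triangular s \<Longrightarrow> triangular t \<Longrightarrow> triangular (s + t)"

lemma triangular_J: "t \<in> J \<Longrightarrow> triangular t"
  by (rule triangular.pos[OF pos.graded.ideal])

lemma triangular_cong: "triangular s \<Longrightarrow> t - s \<in> J \<Longrightarrow> triangular t"
  using triangular.add[of s "t - s"] triangular_J[of "t - s"] by simp

lemma triangular_scal: "triangular t \<Longrightarrow> triangular (scal c t)"
  by (induction rule: triangular.induct)
    (auto simp: scal.scale_right_distrib intro: triangular.intros pos.graded.scal neg.graded.scal)

lemma triangular_L: "triangular t \<Longrightarrow> t \<in> L"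
  by (induction rule: triangular.induct) (auto simp: pos.graded_L neg.graded_L L_add)

lemma triangular_gen:
  "h \<in> space v \<Longrightarrow> triangular (gen (H h))" "triangular (gen (E x))" "triangular (gen (F x))"
  by (rule triangular.pos[OF pos.graded.Cartan] triangular.pos[OF pos.graded.base]
      triangular.neg[OF neg.graded.base]; assumption?)+

lemma triangular_brk_H:
  "triangular t \<Longrightarrow> h \<in> space v \<Longrightarrow> triangular (fbrk (gen (H h)) t)"
  by (induction rule: triangular.induct)
    (auto simp: fbrk_add_right intro: triangular.intros pos.graded_ad_H neg.graded_ad_H)

text \<open>\<open>gen (E x)\<close> raises in the positive half and lowers in the negative one. The
  lowering rule does not cover degree zero, where the bracket is a multiple of
  \<open>gen (E x)\<close> and so falls into the positive half.\<close>

lemma triangular_brk_E: "triangular t \<Longrightarrow> triangular (fbrk (gen (E x)) t)"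
proof (induction rule: triangular.induct)
  case (pos n t)
  show ?case using pos.graded.brk[OF pos] by (rule triangular.pos)
next
  case (neg n t)
  show ?case
  proof (cases "n = (\<lambda>_. 0)")
    case True
    then obtain c where "fbrk (gen (E x)) t - scal c (gen (E x)) \<in> J"
      using neg.brk_f_graded_zero neg by blast
    then show ?thesis by (rule triangular_cong[OF triangular_scal[OF triangular_gen(2)]])
  next
    case False
    then show ?thesis
      using neg.graded_ad_f[OF neg, of x] triangular.neg triangular_J by (cases "n x = 0") blast+
  qed
qed (auto simp: fbrk_add_right intro: triangular.add)

lemma triangular_brk_F: "triangular t \<Longrightarrow> triangular (fbrk (gen (F x)) t)"
proof (induction rule: triangular.induct)
  case (neg n t)
  show ?case using neg.graded.brk[OF neg] by (rule triangular.neg)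
next
  case (pos n t)
  show ?case
  proof (cases "n = (\<lambda>_. 0)")
    case True
    then obtain c where "fbrk (gen (F x)) t - scal c (gen (F x)) \<in> J"
      using pos.brk_f_graded_zero pos by blast
    then show ?thesis by (rule triangular_cong[OF triangular_scal[OF triangular_gen(3)]])
  next
    case False
    then show ?thesis
      using pos.graded_ad_f[OF pos, of x] triangular.pos triangular_J by (cases "n x = 0") blast+
  qed
qed (auto simp: fbrk_add_right intro: triangular.add)

text \<open>The Jacobi relation turns the bracket with \<open>Brk r s\<close> into iterated brackets
  with \<open>r\<close> and \<open>s\<close>, so stability under the generators is enough.
  \<open>t\<close> has to vary, since the induction hypothesis is applied to brackets of
  \<open>t\<close>.\<close>

lemma triangular_brk_word:
  "set_word w \<subseteq> hgens v \<Longrightarrow> triangular t \<Longrightarrow> triangular (fbrk (Poly_Mapping.single w 1) t)"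
proof (induction w arbitrary: t)
  case (Gen g)
  then consider h where "h \<in> space v" "g = H h" | x where "g = E x" | x where "g = F x"
    by (auto simp: hgens_def)
  then show ?case
    using Gen.prems triangular_brk_H triangular_brk_E triangular_brk_F
    by cases (auto simp: gen_def)
next
  case (Brk r s)
  let ?r = "Poly_Mapping.single r 1" and ?s = "Poly_Mapping.single s 1"
  have rs: "?r \<in> part (hb_free v) (word_parity (hparity v) r)"
    "?s \<in> part (hb_free v) (word_parity (hparity v) s)"
    using Brk.prems unfolding hb_free_def by (auto intro!: single_in_part_free)
  let ?u = "fbrk ?r (fbrk ?s t) +
     scal (- koszul (word_parity (hparity v) r) (word_parity (hparity v) s)) (fbrk ?s (fbrk ?r t))"
  have "triangular ?u"
    using Brk by (intro triangular.add triangular_scal) auto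
  moreover have "fbrk (Poly_Mapping.single (Brk r s) 1) t - ?u \<in> J"
    using J_uminus[OF jacobi[OF rs triangular_L[OF Brk.prems(2)]]] by (simp add: algebra_simps)
  ultimately show ?case by (rule triangular_cong)
qed

lemma triangular_word: "set_word w \<subseteq> hgens v \<Longrightarrow> triangular (Poly_Mapping.single w 1)"
proof (induction w)
  case (Gen g)
  then show ?case using triangular_gen by (auto simp: hgens_def gen_def)
next
  case (Brk r s)
  then show ?case
    using triangular_brk_word[of r "Poly_Mapping.single s 1"] by simp
qed

lemma triangular_all: "f \<in> L \<Longrightarrow> triangular f"
  unfolding hb_free_def
proof (induction rule: elems_free_induct)
  case zero
  show ?case by (rule triangular_J[OF J_zero])
next
  case (single w c)
  then show ?case using triangular_scal[OF triangular_word, of w c] by simp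
next
  case (add f g)
  then show ?case by (rule triangular.add)
qed

text \<open>Collects what is to be known about a weight vector: its weight has a sign unless the
  vector vanishes, and in the weights \<open>b_of v x\<close> and \<open>- b_of v x\<close> it lies
  on the line of a generator. The property is stable under sums and holds on \<open>J\<close>, so it
  can be verified on the pieces of the triangular decomposition.\<close>

definition root_component :: "('b \<Rightarrow> complex) \<Rightarrow> ('b, 'x) hgen free_elem \<Rightarrow> bool" where
  "root_component \<alpha> t \<longleftrightarrow> weight_vec \<alpha> t \<and>
     (t \<in> J \<or> nat_comb v \<alpha> \<or> nat_comb v (\<lambda>h. - \<alpha> h)) \<and>
     (\<forall>x. \<alpha> = b_of v x \<longrightarrow> (\<exists>c. t - scal c (gen (E x)) \<in> J)) \<and>
     (\<forall>x. \<alpha> = (\<lambda>h. - b_of v x h) \<longrightarrow> (\<exists>c. t - scal c (gen (F x)) \<in> J))"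

lemma root_component_J: "t \<in> J \<Longrightarrow> root_component \<alpha> t"
  by (auto simp: root_component_def weight_vec_J intro!: exI[of _ 0])

lemma root_component_add:
  assumes "root_component \<alpha> s" "root_component \<alpha> t" shows "root_component \<alpha> (s + t)"
proof -
  have *: "\<exists>c. s + t - scal c e \<in> J"
    if st: "\<exists>c. s - scal c e \<in> J" "\<exists>c. t - scal c e \<in> J" for e
  proof -
    obtain c d where "s - scal c e \<in> J" "t - scal d e \<in> J" using st by blast
    then show ?thesis
      using J_add[of "s - scal c e" "t - scal d e"]
      by (intro exI[of _ "c + d"]) (simp add: scal.scale_left_distrib add_diff_add)
  qed
  show ?thesis
    using assms unfolding root_component_def by (auto intro: weight_vec_add J_add *)
qed

lemma dual_weight:
  assumes "\<alpha> = (\<lambda>h. \<Sum>y\<in>UNIV. c y * b_of v y h)" shows "\<alpha> \<in> dual_space (space v)"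
proof -
  note l = b_linear[OF root_datum]
  show ?thesis
    unfolding assms dual_space_def
    by (simp add: l distrib_left sum.distrib sum_distrib_left mult.left_commute)
qed

text \<open>Independence of the \<open>b_of v y\<close> lets the weight determine the degree
  \<open>n\<close>: it equals \<open>b_of v x\<close> only for the unit degree, and never
  \<open>- b_of v x\<close>, as this would need \<open>n x + 1 = 0\<close>.\<close>

lemma pos_component:
  assumes "pos.graded n t"
  shows "root_component (\<lambda>h. \<Sum>y\<in>UNIV. of_nat (n y) * b_of v y h) t" (is "root_component ?\<alpha> t")
proof -
  have "\<exists>c. t - scal c (gen (E x)) \<in> J" if "?\<alpha> = b_of v x" for x
  proof -
    have "(\<lambda>y. of_nat (n y) :: complex) = (\<lambda>y. of_nat (((\<lambda>_. 0)(x := Suc 0)) y))"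
      using fun_cong[OF that] by (intro b_independent[OF root_datum]) (simp only: sum_unit_mult)
    then have "n = (\<lambda>_. 0)(x := Suc 0)" by (intro ext) (metis of_nat_eq_iff)
    then show ?thesis using pos.graded_one assms by blast
  qed
  moreover have False if "?\<alpha> = (\<lambda>h. - b_of v x h)" for x
  proof -
    have "(\<lambda>y. of_nat (n y) :: complex) = (\<lambda>y. - of_nat (((\<lambda>_. 0)(x := Suc 0)) y))"
      using fun_cong[OF that] by (intro b_independent[OF root_datum])
        (simp only: sum_unit_mult mult_minus_left sum_negf)
    from fun_cong[OF this, of x] have "of_nat (n x + 1) = (0 :: complex)" by simp
    then show False by (simp only: of_nat_eq_0_iff)
  qed
  ultimately show ?thesis
    using pos.graded_weight[OF assms] by (auto simp: root_component_def nat_comb_def)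
qed

lemma neg_component:
  assumes "neg.graded n t"
  shows "root_component (\<lambda>h. \<Sum>y\<in>UNIV. (- of_nat (n y)) * b_of v y h) t" (is "root_component ?\<alpha> t")
proof -
  have "\<exists>c. t - scal c (gen (F x)) \<in> J" if "?\<alpha> = (\<lambda>h. - b_of v x h)" for x
  proof -
    have "(\<lambda>y. - of_nat (n y) :: complex) = (\<lambda>y. - of_nat (((\<lambda>_. 0)(x := Suc 0)) y))"
      using fun_cong[OF that] by (intro b_independent[OF root_datum])
        (simp only: sum_unit_mult mult_minus_left sum_negf)
    then have "n = (\<lambda>_. 0)(x := Suc 0)"
      by (intro ext) (metis of_nat_eq_iff neg_equal_iff_equal)
    then show ?thesis using neg.graded_one assms by blast
  qed
  moreover have False if "?\<alpha> = b_of v x" for x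
  proof -
    have "(\<lambda>y. - of_nat (n y) :: complex) = (\<lambda>y. of_nat (((\<lambda>_. 0)(x := Suc 0)) y))"
      using fun_cong[OF that] by (intro b_independent[OF root_datum])
        (simp only: sum_unit_mult mult_minus_left sum_negf)
    from fun_cong[OF this, of x] have "of_nat (n x + 1) = (0 :: complex)"
      by (simp add: neg_eq_iff_add_eq_0 add.commute)
    then show False by (simp only: of_nat_eq_0_iff)
  qed
  moreover have "nat_comb v (\<lambda>h. - ?\<alpha> h)" by (auto simp: nat_comb_def sum_negf)
  moreover have "weight_vec ?\<alpha> t" using neg.graded_weight[OF assms] by simp
  ultimately show ?thesis by (auto simp: root_component_def)
qed

lemma triangular_decomposition:
  "triangular f \<Longrightarrow> \<exists>M t. finite M \<and> M \<subseteq> dual_space (space v) \<and>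
     (\<forall>\<alpha>\<in>M. root_component \<alpha> (t \<alpha>)) \<and> f - sum t M \<in> J"
proof (induction rule: triangular.induct)
  case (pos n t)
  let ?\<alpha> = "\<lambda>h. \<Sum>y\<in>UNIV. of_nat (n y) * b_of v y h"
  show ?case
    using pos_component[OF pos] J_zero dual_weight[OF refl, of "\<lambda>y. of_nat (n y)"]
    by (intro exI[of _ "{?\<alpha>}"] exI[of _ "\<lambda>_. t"]) simp
next
  case (neg n t)
  let ?\<alpha> = "\<lambda>h. \<Sum>y\<in>UNIV. (- of_nat (n y)) * b_of v y h"
  show ?case
    using neg_component[OF neg] J_zero dual_weight[OF refl, of "\<lambda>y. - of_nat (n y)"]
    by (intro exI[of _ "{?\<alpha>}"] exI[of _ "\<lambda>_. t"]) simp
next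
  case (add f g)
  then obtain M t N s where *: "finite M" "M \<subseteq> dual_space (space v)"
    "\<forall>\<alpha>\<in>M. root_component \<alpha> (t \<alpha>)" "f - sum t M \<in> J" "finite N" "N \<subseteq> dual_space (space v)"
    "\<forall>\<alpha>\<in>N. root_component \<alpha> (s \<alpha>)" "g - sum s N \<in> J" by blast
  \<comment> \<open>A weight may occur in only one of the two families; the default 0 lies in
    \<open>J\<close> and so counts as a component of every weight.\<close>
  let ?t = "\<lambda>\<alpha>. (if \<alpha> \<in> M then t \<alpha> else 0) + (if \<alpha> \<in> N then s \<alpha> else 0)"
  have "sum ?t (M \<union> N) = sum t M + sum s N"
  proof -
    have "(\<Sum>\<alpha>\<in>M \<union> N. if \<alpha> \<in> M then t \<alpha> else 0) = sum t M"
      using * by (intro sum.mono_neutral_cong_right) auto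
    moreover have "(\<Sum>\<alpha>\<in>M \<union> N. if \<alpha> \<in> N then s \<alpha> else 0) = sum s N"
      using * by (intro sum.mono_neutral_cong_right) auto
    ultimately show ?thesis by (simp only: sum.distrib)
  qed
  then have "f + g - sum ?t (M \<union> N) \<in> J"
    using J_add[OF *(4) *(8)] by (simp add: add_diff_add)
  moreover have "\<forall>\<alpha>\<in>M \<union> N. root_component \<alpha> (?t \<alpha>)"
    using * root_component_J[OF J_zero] by (auto intro!: root_component_add)
  ultimately show ?case using * by (intro exI[of _ "M \<union> N"] exI[of _ ?t]) auto
qed

text \<open>Subtracting \<open>f\<close> from its own \<alpha>-component yields weight vectors of
  distinct weights whose sum is in \<open>J\<close>. By independence each of them is in
  \<open>J\<close>, so \<open>f\<close> agrees modulo \<open>J\<close> with that component (with 0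
  if \<alpha> does not occur).\<close>

lemma weight_vec_component:
  assumes "weight_vec \<alpha> f" "\<alpha> \<in> dual_space (space v)"
  shows "root_component \<alpha> f"
proof -
  have "triangular f" using assms triangular_all by (simp add: weight_vec_def)
  from triangular_decomposition[OF this]
  obtain M t where *: "finite M" "M \<subseteq> dual_space (space v)"
    "\<forall>\<alpha>\<in>M. root_component \<alpha> (t \<alpha>)" "f - sum t M \<in> J" by (elim exE conjE)
  let ?t = "\<lambda>\<beta>. (if \<beta> \<in> M then t \<beta> else 0) - (if \<beta> = \<alpha> then f else 0)"
  have "sum ?t (insert \<alpha> M) = sum t M - f"
  proof -
    have "(\<Sum>\<beta>\<in>insert \<alpha> M. if \<beta> \<in> M then t \<beta> else 0) = sum t M"
      using * by (intro sum.mono_neutral_cong_right) auto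
    then show ?thesis using * by (simp add: sum_subtractf)
  qed
  then have "sum ?t (insert \<alpha> M) \<in> J" using J_uminus[OF *(4)] by simp
  moreover have "weight_vec \<beta> (?t \<beta>)" if "\<beta> \<in> insert \<alpha> M" for \<beta>
  proof -
    have "weight_vec \<beta> (if \<beta> \<in> M then t \<beta> else 0)"
      using * weight_vec_J[OF J_zero] by (auto simp: root_component_def)
    moreover have "weight_vec \<beta> (scal (-1) (if \<beta> = \<alpha> then f else 0))"
      using assms weight_vec_J[OF J_zero] weight_vec_scal[of \<alpha> f "-1"] by auto
    ultimately show ?thesis using weight_vec_add by fastforce
  qed
  ultimately have "?t \<alpha> \<in> J"
    using * assms by (intro weight_vec_independent[of "insert \<alpha> M" ?t]) auto
  then have "f - (if \<alpha> \<in> M then t \<alpha> else 0) \<in> J" using J_uminus by fastforce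
  then have "root_component \<alpha> (f - (if \<alpha> \<in> M then t \<alpha> else 0))" by (rule root_component_J)
  moreover have "root_component \<alpha> (if \<alpha> \<in> M then t \<alpha> else 0)"
    using * root_component_J[OF J_zero] by auto
  ultimately show ?thesis
    using root_component_add[of \<alpha> "f - (if \<alpha> \<in> M then t \<alpha> else 0)" "if \<alpha> \<in> M then t \<alpha> else 0"]
    by simp
qed

end

section \<open>Root-theoretic consequences of admissibility\<close>

lemma (in realization) J_brk_cong:
  assumes "f - f' \<in> J" "g - g' \<in> J" "f' \<in> L" "g \<in> L"
  shows "fbrk f g - fbrk f' g' \<in> J"
proof -
  have "fbrk f g - fbrk f' g' = fbrk (f - f') g + fbrk f' (g - g')"
    by (simp add: fbrk_diff_left fbrk_diff_right)
  then show ?thesis using J_add[OF J_brk_left[OF assms(1,4)] J_brk_right[OF assms(2,3)]] by simp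
qed

lemma (in realization) weight_vec_b:
  "weight_vec (b_of v x) f \<Longrightarrow> \<exists>c. f - scal c (gen (E x)) \<in> J"
  using weight_vec_component[of "b_of v x" f] b_dual[of x] unfolding root_component_def by blast

lemma (in realization) weight_vec_neg_b:
  assumes "weight_vec (\<lambda>h. - b_of v x h) f" shows "\<exists>c. f - scal c (gen (F x)) \<in> J"
proof -
  have "(\<lambda>h. - b_of v x h) \<in> dual_space (space v)"
    using b_dual[of x] by (auto simp: dual_space_def)
  then show ?thesis
    using weight_vec_component[OF assms] unfolding root_component_def by blast
qed

section \<open>Quotients of the half-baked algebra as realizations\<close>

lemma lie_relations_elems: "lie_relations G q \<subseteq> elems (free_superalg G q)"
proof -
  let ?A = "free_superalg G q"
  have p: "f \<in> elems ?A" if "f \<in> part ?A i" for f i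
    using that by (simp add: part_free_iff elems_free_iff)
  have d: "f - g \<in> elems ?A" if "f \<in> elems ?A" "g \<in> elems ?A" for f g
    using add_in_elems_free[OF that(1) scal_in_elems_free[OF that(2), of "-1"]] by simp
  show ?thesis
  proof
    fix r assume "r \<in> lie_relations G q"
    then consider f g i j where "r = fbrk f g + scal (koszul i j) (fbrk g f)" "f \<in> part ?A i"
        "g \<in> part ?A j"
      | f g k i j where "r = fbrk f (fbrk g k) - fbrk (fbrk f g) k - scal (koszul i j) (fbrk g (fbrk f k))"
        "f \<in> part ?A i" "g \<in> part ?A j" "k \<in> elems ?A"
      unfolding lie_relations_def by blast
    then show "r \<in> elems ?A"
      by cases (auto intro!: add_in_elems_free d scal_in_elems_free fbrk_in_elems_free dest: p)
  qed
qed

lemma hb_free_simps [simp]: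
  "add (hb_free v) = (+)" "null (hb_free v) = 0" "smul (hb_free v) = scal" "brk (hb_free v) = fbrk"
  by (simp_all add: hb_free_def)

lemma hb_relations_elems:
  assumes "root_datum v" shows "hb_relations v \<subseteq> elems (hb_free v)"
proof -
  note sub = root_datumD(1)[OF assms] and a = root_datumD(2)[OF assms]
  have d: "f - g \<in> elems (hb_free v)" if "f \<in> elems (hb_free v)" "g \<in> elems (hb_free v)" for f g
    using add_in_elems_free[OF that(1)[unfolded hb_free_def]
        scal_in_elems_free[OF that(2)[unfolded hb_free_def], of "-1"]] by (simp add: hb_free_def)
  have g: "h \<in> space v \<Longrightarrow> gen (H h) \<in> elems (hb_free v)" "gen (E x) \<in> elems (hb_free v)"
    "gen (F x) \<in> elems (hb_free v)" for h x
    by (auto simp: hb_free_def hgens_def intro!: gen_in_elems_free)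
  have c: "f + f' \<in> elems (hb_free v)" "fbrk f f' \<in> elems (hb_free v)"
    if "f \<in> elems (hb_free v)" "f' \<in> elems (hb_free v)" for f f'
    using that by (auto simp: hb_free_def add_in_elems_free fbrk_in_elems_free)
  have s: "scal c f \<in> elems (hb_free v)" if "f \<in> elems (hb_free v)" for f c
    using that by (auto simp: hb_free_def scal_in_elems_free)
  show ?thesis
    unfolding hb_relations_def
    by (intro Un_least subsetI; elim CollectE exE conjE; hypsubst;
        intro d c s g a complex_vector.subspace_add[OF sub] complex_vector.subspace_scale[OF sub];
        assumption)
qed

lemma nonassoc_ideal_hb:
  assumes "root_datum v" shows "nonassoc_ideal (hb_free v) (hb_ideal v)"
  unfolding hb_ideal_def using hb_relations_elems[OF assms] lie_relations_elems
  by (auto simp: hb_free_def intro!: nonassoc_ideal_generated)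

definition hb_class ::
    "('b::complex_vector, 'x) rdatum \<Rightarrow> ('b, 'x) hgen free_elem set set \<Rightarrow>
      ('b, 'x) hgen free_elem \<Rightarrow> ('b, 'x) hgen free_elem set set" where
  "hb_class v I f = coset (half_baked v) I (coset (hb_free v) (hb_ideal v) f)"

definition hb_preimage ::
    "('b::complex_vector, 'x) rdatum \<Rightarrow> ('b, 'x) hgen free_elem set set \<Rightarrow>
      ('b, 'x) hgen free_elem set" where
  "hb_preimage v I = {f \<in> elems (hb_free v). coset (hb_free v) (hb_ideal v) f \<in> I}"

locale half_baked_quotient =
  fixes v :: "('b::complex_vector, 'x::finite) rdatum" and I
  assumes rd: "root_datum v" and ideal: "superideal (half_baked v) I"
    and cartan_I: "\<forall>h\<in>space v. hb_cartan v h \<in> I \<longrightarrow> h = 0"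
begin

sublocale F: nonassoc_ideal "hb_free v" "hb_ideal v"
  by (rule nonassoc_ideal_hb[OF rd])

sublocale Q: nonassoc_ideal "half_baked v" I
  using F.nonassoc_alg_quotient ideal
  by (auto simp: half_baked_def intro!: nonassoc_ideal_superideal)

abbreviation "\<kappa> \<equiv> coset (hb_free v) (hb_ideal v)"

lemma \<kappa>_closed: "f \<in> elems (hb_free v) \<Longrightarrow> \<kappa> f \<in> elems (half_baked v)"
  by (simp add: half_baked_def F.quotient_elems)

lemma \<kappa>_hom:
  assumes "f \<in> elems (hb_free v)" "g \<in> elems (hb_free v)"
  shows "\<kappa> (f + g) = add (half_baked v) (\<kappa> f) (\<kappa> g)"
    and "\<kappa> (scal c f) = smul (half_baked v) c (\<kappa> f)"
    and "\<kappa> (fbrk f g) = brk (half_baked v) (\<kappa> f) (\<kappa> g)"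
  using F.quotient_add[OF assms] F.quotient_smul[OF assms(1)] F.quotient_brk[OF assms]
  by (simp_all add: half_baked_def)

lemma \<kappa>_zero: "\<kappa> 0 = null (half_baked v)"
  using F.quotient_null by (simp add: half_baked_def)

lemma relations_preimage:
  "lie_relations (hgens v) (hparity v) \<union> hb_relations v \<subseteq> hb_preimage v I"
proof
  fix f assume f: "f \<in> lie_relations (hgens v) (hparity v) \<union> hb_relations v"
  then have "f \<in> hb_ideal v"
    unfolding hb_ideal_def generated_superideal_def by blast
  moreover from this have fe: "f \<in> elems (hb_free v)" by (rule F.I_elems)
  ultimately have "\<kappa> f = \<kappa> 0"
    using F.coset_add_ideal[of 0 f] F.null_closed by simp
  then show "f \<in> hb_preimage v I"
    using fe \<kappa>_zero Q.I_null by (simp add: hb_preimage_def)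
qed

lemma realization: "realization v (hb_preimage v I)"
proof
  fix f g and c
  assume f: "f \<in> hb_preimage v I"
  then have f': "f \<in> elems (hb_free v)" "\<kappa> f \<in> I" by (auto simp: hb_preimage_def)
  show "scal c f \<in> hb_preimage v I"
    using f' \<kappa>_hom(2)[of f f c] F.smul_closed[of f c] by (simp add: hb_preimage_def Q.I_smul)
  {
    assume "g \<in> hb_preimage v I"
    then show "f + g \<in> hb_preimage v I"
      using f' \<kappa>_hom(1)[of f g] F.add_closed[of f g] by (auto simp: hb_preimage_def Q.I_add)
  }
  assume g: "g \<in> elems (hb_free v)"
  show "fbrk f g \<in> hb_preimage v I" "fbrk g f \<in> hb_preimage v I"
    using f' g \<kappa>_hom(3)[of f g] \<kappa>_hom(3)[of g f] F.brk_closed[of f g] F.brk_closed[of g f]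
      Q.I_brk[OF f'(2) \<kappa>_closed[OF g]]
    by (auto simp: hb_preimage_def)
next
  show "0 \<in> hb_preimage v I"
    using F.null_closed \<kappa>_zero Q.I_null by (simp add: hb_preimage_def)
next
  fix h assume "h \<in> space v" "gen (H h) \<in> hb_preimage v I"
  then show "h = 0" using cartan_I by (auto simp: hb_preimage_def hb_cartan_def)
qed (use rd relations_preimage in \<open>auto simp: hb_preimage_def\<close>)

sublocale realization v "hb_preimage v I"
  by (rule realization)

abbreviation "G \<equiv> quotient_superalg (half_baked v) I"

lemma class_closed: "f \<in> L \<Longrightarrow> hb_class v I f \<in> elems G"
  by (simp add: hb_class_def Q.quotient_elems \<kappa>_closed)

lemma class_surj: "C \<in> elems G \<Longrightarrow> \<exists>f\<in>L. C = hb_class v I f"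
proof -
  assume "C \<in> elems G"
  then obtain D where "D \<in> elems (half_baked v)" "C = coset (half_baked v) I D"
    by (auto simp: Q.quotient_elems)
  then show ?thesis by (auto simp: half_baked_def F.quotient_elems hb_class_def)
qed

lemma class_hom:
  assumes "f \<in> L" "g \<in> L"
  shows "hb_class v I (f + g) = add G (hb_class v I f) (hb_class v I g)"
    and "hb_class v I (scal c f) = smul G c (hb_class v I f)"
    and "hb_class v I (fbrk f g) = brk G (hb_class v I f) (hb_class v I g)"
  using assms by (simp_all add: hb_class_def \<kappa>_hom Q.quotient_add Q.quotient_smul Q.quotient_brk \<kappa>_closed)

lemma class_eq_iff:
  assumes "f \<in> L" "g \<in> L"
  shows "hb_class v I f = hb_class v I g \<longleftrightarrow> f - g \<in> hb_preimage v I"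
proof -
  have "\<kappa> (f - g) = add (half_baked v) (\<kappa> f) (smul (half_baked v) (-1) (\<kappa> g))"
    using assms \<kappa>_hom(1)[of f "scal (-1) g"] \<kappa>_hom(2)[of g g "-1"] by (simp add: L_uminus)
  then show ?thesis
    using assms by (simp add: hb_class_def Q.coset_eq_iff \<kappa>_closed hb_preimage_def L_diff)
qed

end

text \<open>An isomorphism of the quotients is handled as a relation between representatives in the free
  superalgebras.\<close>

locale realization_iso =
  src: realization v J + tgt: realization u J'
  for v :: "('b::complex_vector, 'x::finite) rdatum" and J
    and u :: "('b, 'x) rdatum" and J' +
  fixes rel :: "('b, 'x) hgen free_elem \<Rightarrow> ('b, 'x) hgen free_elem \<Rightarrow> bool"
  assumes space_eq: "space u = space v"
    and rel_dom: "rel f f' \<Longrightarrow> f \<in> elems (hb_free v) \<and> f' \<in> elems (hb_free u)"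
    and rel_total: "f \<in> elems (hb_free v) \<Longrightarrow> \<exists>f'. rel f f'"
    and rel_H: "h \<in> space v \<Longrightarrow> rel (gen (H h)) (gen (H h))"
    and rel_diff: "rel f f' \<Longrightarrow> rel g g' \<Longrightarrow> rel (f - g) (f' - g')"
    and rel_scal: "rel f f' \<Longrightarrow> rel (scal c f) (scal c f')"
    and rel_brk: "rel f f' \<Longrightarrow> rel g g' \<Longrightarrow> rel (fbrk f g) (fbrk f' g')"
    and rel_ideal: "rel f f' \<Longrightarrow> f \<in> J \<longleftrightarrow> f' \<in> J'"
begin

text \<open>The isomorphism is the identity on the Cartan subalgebra, hence preserves weights. This
  is the only control over the images of \<open>gen (E x)\<close> and
  \<open>gen (F x)\<close>.\<close>

lemma rel_weight_vec:
  assumes "src.weight_vec \<alpha> f" "rel f f'" shows "tgt.weight_vec \<alpha> f'"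
proof -
  have "fbrk (gen (H h)) f' - scal (\<alpha> h) f' \<in> J'" if "h \<in> space v" for h
  proof -
    have "rel (fbrk (gen (H h)) f - scal (\<alpha> h) f) (fbrk (gen (H h)) f' - scal (\<alpha> h) f')"
      using assms that by (intro rel_diff rel_brk rel_H rel_scal)
    from rel_ideal[OF this] show ?thesis using assms that by (simp add: src.weight_vec_def)
  qed
  then show ?thesis
    using assms rel_dom by (auto simp: tgt.weight_vec_def space_eq)
qed

lemma weight_vec_E: "src.weight_vec (b_of v x) (gen (E x))"
  and weight_vec_F: "src.weight_vec (\<lambda>h. - b_of v x h) (gen (F x))"
  by (auto simp: src.weight_vec_def src.L_gen src.rel_HE src.rel_HF)

lemma dual_b: "b_of v x \<in> dual_space (space u)"
  using src.b_dual[of x] by (simp add: space_eq)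

text \<open>The image of \<open>gen (E x)\<close> is a vector of weight \<open>b_of v x\<close>
  outside \<open>J'\<close>, and the triangular decomposition at \<open>u\<close> allows only
  positive and negative weights for such vectors.\<close>

lemma sign_coherent: "nat_comb u (b_of v x) \<or> nat_comb u (\<lambda>h. - b_of v x h)"
proof -
  obtain f where f: "rel (gen (E x)) f" using rel_total src.L_gen by blast
  then have "f \<notin> J'" using rel_ideal src.E_notin_J by blast
  then show ?thesis
    using tgt.weight_vec_component[OF rel_weight_vec[OF weight_vec_E f] dual_b]
    by (auto simp: tgt.root_component_def)
qed

text \<open>The images of \<open>gen (E x)\<close> and \<open>gen (F x)\<close> are multiples, by
  \<open>c\<close> and \<open>d\<close>, of \<open>gen (E y)\<close> and \<open>gen (F y)\<close>.
  Comparing brackets gives the factor \<open>c * d\<close> between the coroots; it is nonzero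
  because \<open>a_of v x\<close> is.\<close>

lemma coroot_line:
  assumes "b_of v x = b_of u y" shows "\<exists>c. c \<noteq> 0 \<and> a_of v x = c *\<^sub>C a_of u y"
proof -
  obtain e f where e: "rel (gen (E x)) e" and f: "rel (gen (F x)) f"
    using rel_total src.L_gen by blast
  obtain c where c: "e - scal c (gen (E y)) \<in> J'"
    using tgt.weight_vec_b[OF rel_weight_vec[OF weight_vec_E e, unfolded assms]] by blast
  obtain d where d: "f - scal d (gen (F y)) \<in> J'"
    using tgt.weight_vec_neg_b[OF rel_weight_vec[OF weight_vec_F f, unfolded assms]] by blast
  have "rel (fbrk (gen (E x)) (gen (F x)) - gen (H (a_of v x))) (fbrk e f - gen (H (a_of v x)))"
    using e f src.a_in_space by (intro rel_diff rel_brk rel_H)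
  from rel_ideal[OF this] have 1: "fbrk e f - gen (H (a_of v x)) \<in> J'"
    using src.rel_EF_same by simp
  have au: "a_of u y \<in> space u" "a_of v x \<in> space u"
    using tgt.a_in_space src.a_in_space space_eq by auto
  have p: "fbrk e f - scal (c * d) (fbrk (gen (E y)) (gen (F y))) \<in> J'"
    using tgt.J_brk_cong[OF c d tgt.L_scal[OF tgt.L_gen(2)]] f rel_dom
    by (simp add: mult.commute)
  have q: "scal (c * d) (fbrk (gen (E y)) (gen (F y)) - gen (H (a_of u y))) \<in> J'"
    by (intro tgt.J_scal tgt.rel_EF_same)
  have 2: "gen (H (a_of v x)) - gen (H ((c * d) *\<^sub>C a_of u y)) \<in> J'"
    using tgt.J_diff[OF tgt.J_diff[OF tgt.J_add[OF p q] 1] tgt.rel_H_scal[OF au(1), of "c * d"]]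
    by (simp add: scal.scale_right_diff_distrib)
  let ?k = "a_of v x + (- (c * d)) *\<^sub>C a_of u y"
  have sc: "k *\<^sub>C a_of u y \<in> space u" for k
    by (rule complex_vector.subspace_scale[OF tgt.subspace_space au(1)])
  have "gen (H ?k) \<in> J'"
    using tgt.J_add[OF tgt.J_add[OF tgt.J_add[OF tgt.rel_H_add[OF au(2) sc[of "- (c * d)"]] 2]
        tgt.rel_H_scal[OF au(1), of "- (c * d)"]] tgt.rel_H_scal[OF au(1), of "c * d"]]
    by simp
  then have "?k = 0"
    using sc au by (intro tgt.H_J complex_vector.subspace_add[OF tgt.subspace_space])
  then have eq: "a_of v x = (c * d) *\<^sub>C a_of u y" by simp
  then show ?thesis using a_nonzero[OF src.root_datum, of x] by (intro exI[of _ "c * d"]) auto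
qed

text \<open>The conditions on \<open>b\<close> hold when \<open>u\<close> arises from
  \<open>v\<close> by the reflexion at \<open>x\<close> and \<open>a_xy = 0\<close>. The images of
  \<open>gen (E x)\<close> and \<open>gen (E y)\<close> are multiples of \<open>gen (F x)\<close>
  and \<open>gen (E y)\<close>, whose bracket vanishes, so \<open>[e_x, e_y] = 0\<close> already at
  \<open>v\<close>. Bracketing with \<open>f_y\<close> leaves a nonzero multiple of
  \<open>a_yx e_x\<close>, and \<open>e_x\<close> is not zero.\<close>

lemma weakly_symmetric:
  assumes "b_of u x = (\<lambda>h. - b_of v x h)" "b_of u y = b_of v y" "x \<noteq> y"
  shows "cartan v y x = 0"
proof -
  obtain e f where e: "rel (gen (E x)) e" and f: "rel (gen (E y)) f"
    using rel_total[OF src.L_gen(2)[of x]] rel_total[OF src.L_gen(2)[of y]] by blast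
  have eq: "b_of v x = (\<lambda>h. - b_of u x h)" by (simp add: assms(1))
  obtain c where c: "e - scal c (gen (F x)) \<in> J'"
    using tgt.weight_vec_neg_b[OF rel_weight_vec[OF weight_vec_E e, unfolded eq]] by blast
  obtain d where d: "f - scal d (gen (E y)) \<in> J'"
    using tgt.weight_vec_b[OF rel_weight_vec[OF weight_vec_E f, folded assms(2)]] by blast
  have *: "fbrk (gen (E y)) (gen (F x)) \<in> J'" using assms(3) by (intro tgt.rel_EF) auto
  have "fbrk (gen (F x)) (gen (E y))
      + scal (koszul (p_of u x) (p_of u y)) (fbrk (gen (E y)) (gen (F x))) \<in> J'"
    by (intro tgt.skew tgt.part_gen)
  from tgt.J_diff[OF this tgt.J_scal[OF *, of "koszul (p_of u x) (p_of u y)"]]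
  have 1: "fbrk (gen (F x)) (gen (E y)) \<in> J'" by simp
  have "fbrk e f - scal (c * d) (fbrk (gen (F x)) (gen (E y))) \<in> J'"
    using tgt.J_brk_cong[OF c d tgt.L_scal[OF tgt.L_gen(3)]] f rel_dom
    by (simp add: mult.commute)
  from tgt.J_add[OF this tgt.J_scal[OF 1, of "c * d"]] have "fbrk e f \<in> J'" by simp
  then have ef: "fbrk (gen (E x)) (gen (E y)) \<in> J"
    using rel_ideal[OF rel_brk[OF e f]] by simp
  let ?k = "koszul (p_of v y) (p_of v x)" and ?l = "koszul (p_of v y) (p_of v y)"
  have k: "?k \<noteq> 0" "?l \<noteq> 0" by (auto simp: koszul_def)
  have yx: "fbrk (gen (F y)) (gen (E x)) \<in> J"
  proof -
    have *: "fbrk (gen (E x)) (gen (F y)) \<in> J" using assms(3) by (intro src.rel_EF)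
    have "fbrk (gen (F y)) (gen (E x)) + scal ?k (fbrk (gen (E x)) (gen (F y))) \<in> J"
      by (intro src.skew src.part_gen)
    from src.J_diff[OF this src.J_scal[OF *, of ?k]] show ?thesis by simp
  qed
  have yy: "fbrk (gen (F y)) (gen (E y)) + scal ?l (gen (H (a_of v y))) \<in> J"
  proof -
    have "fbrk (gen (F y)) (gen (E y)) + scal ?l (fbrk (gen (E y)) (gen (F y))) \<in> J"
      by (intro src.skew src.part_gen)
    from src.J_diff[OF this src.J_scal[OF src.rel_EF_same[of y], of ?l]]
    show ?thesis by (simp add: scal.scale_right_diff_distrib)
  qed
  have xH: "fbrk (gen (E x)) (gen (H (a_of v y))) + scal (cartan v y x) (gen (E x)) \<in> J"
  proof -
    have "fbrk (gen (E x)) (gen (H (a_of v y)))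
        + scal (koszul (p_of v x) 0) (fbrk (gen (H (a_of v y))) (gen (E x))) \<in> J"
      by (intro src.skew src.part_gen src.a_in_space)
    from src.J_diff[OF this src.rel_HE[OF src.a_in_space, of y x]]
    show ?thesis by (simp add: koszul_def cartan_def)
  qed
  have 3: "fbrk (gen (F y)) (fbrk (gen (E x)) (gen (E y))) - fbrk (fbrk (gen (F y)) (gen (E x))) (gen (E y))
      - scal ?k (fbrk (gen (E x)) (fbrk (gen (F y)) (gen (E y)))) \<in> J"
    by (intro src.jacobi src.part_gen src.L_gen)
  have 4: "fbrk (gen (F y)) (fbrk (gen (E x)) (gen (E y)))
      - fbrk (fbrk (gen (F y)) (gen (E x))) (gen (E y)) \<in> J"
    by (rule src.J_diff[OF src.J_brk_right[OF ef src.L_gen(3)] src.J_brk_left[OF yx src.L_gen(2)]])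
  from src.J_diff[OF 4 3] have "scal ?k (fbrk (gen (E x)) (fbrk (gen (F y)) (gen (E y)))) \<in> J"
    by simp
  then have 2: "fbrk (gen (E x)) (fbrk (gen (F y)) (gen (E y))) \<in> J"
    using k(1) by (rule src.J_scal_cancel)
  have "fbrk (gen (E x)) (fbrk (gen (F y)) (gen (E y)) + scal ?l (gen (H (a_of v y)))) \<in> J"
    by (intro src.J_brk_right yy src.L_gen)
  from src.J_diff[OF this 2] have "scal ?l (fbrk (gen (E x)) (gen (H (a_of v y)))) \<in> J"
    by (simp add: fbrk_add_right)
  then have "fbrk (gen (E x)) (gen (H (a_of v y))) \<in> J"
    using k(2) by (rule src.J_scal_cancel)
  from src.J_diff[OF xH this] have "scal (cartan v y x) (gen (E x)) \<in> J" by simp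
  then show ?thesis using src.J_scal_cancel src.E_notin_J by blast
qed

end

lemma realization_iso_quotient:
  assumes "half_baked_quotient v I" "half_baked_quotient u I'" "space u = space v"
    and \<phi>: "superalg_iso (quotient_superalg (half_baked v) I) (quotient_superalg (half_baked u) I') \<phi>"
    and \<phi>H: "\<And>h. h \<in> space v \<Longrightarrow> \<phi> (coset (half_baked v) I (hb_cartan v h)) =
      coset (half_baked u) I' (hb_cartan u h)"
  shows "realization_iso v (hb_preimage v I) u (hb_preimage u I')
    (\<lambda>f f'. f \<in> elems (hb_free v) \<and> f' \<in> elems (hb_free u) \<and> \<phi> (hb_class v I f) = hb_class u I' f')"
proof -
  interpret src: half_baked_quotient v I by fact
  interpret tgt: half_baked_quotient u I' by fact
  have \<phi>_hom: "\<phi> (add src.G C D) = add tgt.G (\<phi> C) (\<phi> D)" "\<phi> (smul src.G c C) = smul tgt.G c (\<phi> C)"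
    "\<phi> (brk src.G C D) = brk tgt.G (\<phi> C) (\<phi> D)" "\<phi> C \<in> elems tgt.G"
    if "C \<in> elems src.G" "D \<in> elems src.G" for C D c
    using \<phi> that by (auto simp: superalg_iso_def bij_betw_def)
  have \<phi>_inj: "C = D" if "\<phi> C = \<phi> D" "C \<in> elems src.G" "D \<in> elems src.G" for C D
    using \<phi> that by (auto simp: superalg_iso_def bij_betw_def dest: inj_onD)
  let ?rel = "\<lambda>f f'. f \<in> src.L \<and> f' \<in> tgt.L \<and> \<phi> (hb_class v I f) = hb_class u I' f'"
  have rel_add: "?rel (f + g) (f' + g')" if "?rel f f'" "?rel g g'" for f f' g g'
    using that by (simp add: src.L_add tgt.L_add src.class_hom tgt.class_hom \<phi>_hom src.class_closed)
  have rel_scal: "?rel (scal c f) (scal c f')" if "?rel f f'" for c f f'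
    using that
    by (simp add: src.L_scal tgt.L_scal src.class_hom(2)[of f f] tgt.class_hom(2)[of f' f'] \<phi>_hom(2)[of "hb_class v I f" "hb_class v I f"]
        src.class_closed)
  show ?thesis
  proof
    show "space u = space v" by fact
    fix h assume "h \<in> space v"
    then show "?rel (gen (H h)) (gen (H h))"
      using \<phi>H[of h] assms(3) src.L_gen(1)[of h] tgt.L_gen(1)[of h] by (simp add: hb_class_def hb_cartan_def)
  next
    fix f assume "f \<in> src.L"
    then show "\<exists>f'. ?rel f f'"
      using tgt.class_surj[OF \<phi>_hom(4)[OF src.class_closed src.class_closed, of f f]] by (simp add: Bex_def)
  next
    fix f f' g g' and c assume f: "?rel f f'"
    show "?rel (scal c f) (scal c f')" using f by (rule rel_scal)
    assume g: "?rel g g'"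
    show "?rel (f - g) (f' - g')"
      using rel_add[OF f rel_scal[OF g, of "-1"]] by simp
    show "?rel (fbrk f g) (fbrk f' g')"
      using f g by (simp add: src.L_brk tgt.L_brk src.class_hom tgt.class_hom \<phi>_hom src.class_closed)
  next
    fix f f' assume f: "?rel f f'"
    have zero: "\<phi> (hb_class v I 0) = hb_class u I' 0"
      using rel_scal[OF f, of 0] by simp
    have "f \<in> hb_preimage v I \<longleftrightarrow> hb_class v I f = hb_class v I 0"
      using src.class_eq_iff[of f 0] f src.L_zero by simp
    also have "\<dots> \<longleftrightarrow> \<phi> (hb_class v I f) = \<phi> (hb_class v I 0)"
      using \<phi>_inj[of "hb_class v I f" "hb_class v I 0"] f src.class_closed src.L_zero by auto
    also have "\<dots> \<longleftrightarrow> f' \<in> hb_preimage u I'"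
      using tgt.class_eq_iff[of f' 0] f tgt.L_zero zero by simp
    finally show "f \<in> hb_preimage v I \<longleftrightarrow> f' \<in> hb_preimage u I'" .
  qed auto
qed

lemma admissible_consequences:
  assumes "admissible R" "v \<in> R" "u \<in> R" "root_datum v" "root_datum u"
    "arrow v (\<lambda>h\<in>space v. h) u" "space u = space v"
  shows "nat_comb u (b_of v x) \<or> nat_comb u (\<lambda>h. - b_of v x h)"
    and "b_of v x = b_of u y \<Longrightarrow> \<exists>c. c \<noteq> 0 \<and> a_of v x = c *\<^sub>C a_of u y"
    and "b_of u x = (\<lambda>h. - b_of v x h) \<Longrightarrow> b_of u y = b_of v y \<Longrightarrow> x \<noteq> y \<Longrightarrow> cartan v y x = 0"
proof -
  from assms(1)[unfolded admissible_def] obtain I where I: "\<forall>v\<in>R. superideal (half_baked v) (I v) \<and>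
        (\<forall>h\<in>space v. hb_cartan v h \<in> I v \<longrightarrow> h = 0)"
    and iso: "\<forall>v\<in>R. \<forall>u\<in>R. \<forall>\<theta>. arrow v \<theta> u \<longrightarrow>
        (\<exists>\<phi>. superalg_iso (quotient_superalg (half_baked v) (I v))
                          (quotient_superalg (half_baked u) (I u)) \<phi> \<and>
             (\<forall>h\<in>space v. \<phi> (coset (half_baked v) (I v) (hb_cartan v h)) =
                          coset (half_baked u) (I u) (hb_cartan u (\<theta> h))))"
    by (elim exE conjE)
  from iso[rule_format, OF assms(2,3,6)] obtain \<phi> where \<phi>: "superalg_iso (quotient_superalg (half_baked v) (I v))
                          (quotient_superalg (half_baked u) (I u)) \<phi>"
    "\<forall>h\<in>space v. \<phi> (coset (half_baked v) (I v) (hb_cartan v h)) =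
                          coset (half_baked u) (I u) (hb_cartan u ((\<lambda>h\<in>space v. h) h))"
    by auto
  have hq: "half_baked_quotient v (I v)" "half_baked_quotient u (I u)"
    using I assms by (auto simp: half_baked_quotient_def)
  interpret realization_iso v "hb_preimage v (I v)" u "hb_preimage u (I u)"
    "\<lambda>f f'. f \<in> elems (hb_free v) \<and> f' \<in> elems (hb_free u) \<and>
      \<phi> (hb_class v (I v) f) = hb_class u (I u) f'"
    using hq assms(7) \<phi> by (intro realization_iso_quotient) auto
  show "nat_comb u (b_of v x) \<or> nat_comb u (\<lambda>h. - b_of v x h)"
    by (rule sign_coherent)
  show "b_of v x = b_of u y \<Longrightarrow> \<exists>c. c \<noteq> 0 \<and> a_of v x = c *\<^sub>C a_of u y"
    by (rule coroot_line)
  show "b_of u x = (\<lambda>h. - b_of v x h) \<Longrightarrow> b_of u y = b_of v y \<Longrightarrow> x \<noteq> y \<Longrightarrow> cartan v y x = 0"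
    by (rule weakly_symmetric)
qed

section \<open>Reflexions and similarities of root data\<close>

text \<open>The multiple of the entry at \<open>x\<close> that a reflexion adds to the entry at
  \<open>y\<close>, in both cases at once. At \<open>y = x\<close> both kinds of reflexion negate;
  the anisotropic formula agrees with this because \<open>1 - 2 = -1\<close>.\<close>

definition a_coef :: "('b, 'x) rdatum \<Rightarrow> 'x \<Rightarrow> 'x \<Rightarrow> complex" where
  "a_coef v x y = (if cartan v x x \<noteq> 0 then - (2 * cartan v y x / cartan v x x)
     else if cartan v x y = 0 then 0 else cartan v y x / cartan v x y)"

definition b_coef :: "('b, 'x) rdatum \<Rightarrow> 'x \<Rightarrow> 'x \<Rightarrow> complex" where
  "b_coef v x y = (if cartan v x x \<noteq> 0 then - (2 * cartan v x y / cartan v x x)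
     else if cartan v x y = 0 then 0 else 1)"

lemma space_reflexion [simp]: "space (reflexion x v) = space v"
  by (simp add: reflexion_def)

lemma a_reflexion:
  "a_of (reflexion x v) y = (if y = x then - a_of v x else a_of v y + a_coef v x y *\<^sub>C a_of v x)"
proof -
  have "2 *\<^sub>C a_of v x = a_of v x + a_of v x"
    using complex_vector.scale_left_distrib[of 1 1 "a_of v x"] by simp
  then show ?thesis by (auto simp: reflexion_def a_coef_def)
qed

lemma b_reflexion:
  "b_of (reflexion x v) y h = (if y = x then - b_of v x h else b_of v y h + b_coef v x y * b_of v x h)"
  by (auto simp: reflexion_def b_coef_def)

lemma p_reflexion:
  "p_of (reflexion x v) y =
    (if y = x \<or> cartan v x x \<noteq> 0 \<or> cartan v x y = 0 then p_of v y else 1 + p_of v y)"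
  by (auto simp: reflexion_def)

text \<open>A reflexion changes bases by a triangular matrix with diagonal entries 1 and -1, so only
  the coordinate at \<open>x\<close> changes. The scalar multiplication is a parameter because the
  identity is applied to the vectors \<open>a\<close> as well as to the values of the functionals
  \<open>b\<close>.\<close>

lemma sum_triangular_change:
  fixes c k :: "'x::finite \<Rightarrow> 'a::comm_ring_1" and f :: "'x \<Rightarrow> 'm::ab_group_add"
  assumes "module s"
  shows "(\<Sum>y\<in>UNIV. s (c y) (if y = x then - f x else f y + s (k y) (f x)))
    = (\<Sum>y\<in>UNIV. s (if y = x then (\<Sum>z\<in>UNIV - {x}. c z * k z) - c x else c y) (f y))"
proof -
  interpret module s by fact
  have "(\<Sum>y\<in>UNIV. s (c y) (if y = x then - f x else f y + s (k y) (f x)))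
     = - s (c x) (f x) + (\<Sum>y\<in>UNIV - {x}. s (c y) (f y) + s (c y * k y) (f x))"
    by (subst sum.remove[of _ x]) (auto simp: scale_right_distrib)
  also have "\<dots> = s ((\<Sum>z\<in>UNIV - {x}. c z * k z) - c x) (f x) + (\<Sum>y\<in>UNIV - {x}. s (c y) (f y))"
    by (simp add: sum.distrib scale_left_diff_distrib scale_sum_left)
  also have "\<dots> = (\<Sum>y\<in>UNIV. s (if y = x then (\<Sum>z\<in>UNIV - {x}. c z * k z) - c x else c y) (f y))"
    by (subst (2) sum.remove[of _ x]) auto
  finally show ?thesis .
qed

lemma triangular_change_zero:
  fixes c k :: "'x::finite \<Rightarrow> complex"
  assumes "\<forall>y. (if y = x then (\<Sum>z\<in>UNIV - {x}. c z * k z) - c x else c y) = 0"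
  shows "c y = 0"
proof -
  have 1: "c z = 0" if "z \<noteq> x" for z using assms[rule_format, of z] that by simp
  then have "(\<Sum>z\<in>UNIV - {x}. c z * k z) = 0" by (intro sum.neutral) auto
  then have "c x = 0" using assms[rule_format, of x] by simp
  with 1 show ?thesis by (cases "y = x") auto
qed

lemma root_datum_reflexion:
  assumes "root_datum v" shows "root_datum (reflexion x v)"
proof -
  have a: "a_of (reflexion x v) y \<in> space v" for y
    using root_datumD[OF assms]
    by (simp add: a_reflexion complex_vector.subspace_add complex_vector.subspace_scale
        complex_vector.subspace_neg)
  have b: "b_of (reflexion x v) y \<in> dual_space (space v)" for y
    using b_linear[OF assms] by (auto simp: dual_space_def b_reflexion algebra_simps)
  have "c y = 0" if "(\<Sum>y\<in>UNIV. c y *\<^sub>C a_of (reflexion x v) y) = 0" for c y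
  proof (rule triangular_change_zero)
    have "(\<Sum>y\<in>UNIV. (if y = x then (\<Sum>z\<in>UNIV - {x}. c z * a_coef v x z) - c x else c y) *\<^sub>C a_of v y) = 0"
      using that by (simp only: a_reflexion sum_triangular_change[OF complex_vector.module_axioms])
    then show "\<forall>y. (if y = x then (\<Sum>z\<in>UNIV - {x}. c z * a_coef v x z) - c x else c y) = 0"
      using a_independent[OF assms, of "\<lambda>y. if y = x then (\<Sum>z\<in>UNIV - {x}. c z * a_coef v x z) - c x else c y" "\<lambda>_. 0"]
      by (simp add: fun_eq_iff)
  qed
  moreover have "c y = 0" if "\<forall>h. (\<Sum>y\<in>UNIV. c y * b_of (reflexion x v) y h) = 0" for c y
  proof (rule triangular_change_zero)
    have m: "module ((*) :: complex \<Rightarrow> complex \<Rightarrow> complex)"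
      by unfold_locales (auto simp: algebra_simps)
    have "(\<Sum>y\<in>UNIV. (if y = x then (\<Sum>z\<in>UNIV - {x}. c z * b_coef v x z) - c x else c y) * b_of v y h) = 0" for h
      using that[rule_format, of h] sum_triangular_change[OF m, of c x "\<lambda>y. b_of v y h" "b_coef v x"]
      by (simp only: b_reflexion)
    then show "\<forall>y. (if y = x then (\<Sum>z\<in>UNIV - {x}. c z * b_coef v x z) - c x else c y) = 0"
      using b_independent[OF assms, of "\<lambda>y. if y = x then (\<Sum>z\<in>UNIV - {x}. c z * b_coef v x z) - c x else c y" "\<lambda>_. 0"]
      by (simp add: fun_eq_iff)
  qed
  ultimately show ?thesis
    using assms a b unfolding root_datum_def by (simp only: space_reflexion) blast
qed

lemma cartan_reflexion:
  assumes "root_datum v"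
  shows "cartan (reflexion x v) y z =
    (if y = x then if z = x then cartan v x x else - cartan v x z - b_coef v x z * cartan v x x
     else if z = x then - cartan v y x - a_coef v x y * cartan v x x
     else cartan v y z + b_coef v x z * cartan v y x + a_coef v x y * cartan v x z
       + a_coef v x y * b_coef v x z * cartan v x x)"
proof -
  note s = root_datumD[OF assms] b_linear[OF assms]
  have n: "b_of v w (- a_of v x) = - cartan v x w" for w
    using s(5)[OF s(2), of w "-1" x] by (simp add: cartan_def)
  have "b_of v w (a_of v y + c *\<^sub>C a_of v x) = cartan v y w + c * cartan v x w" for w c
    using s by (simp add: cartan_def complex_vector.subspace_scale)
  with n show ?thesis
    unfolding cartan_def[of "reflexion x v"] by (simp add: a_reflexion b_reflexion algebra_simps)
qed

lemma cartan_reflexion_aniso: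
  assumes "root_datum v" "cartan v x x \<noteq> 0"
  shows "cartan (reflexion x v) y z = cartan v y z"
  using assms by (auto simp: cartan_reflexion a_coef_def b_coef_def field_simps)

lemma cartan_reflexion_iso:
  assumes "root_datum v" "cartan v x x = 0"
  shows "cartan (reflexion x v) x z = - cartan v x z" "cartan (reflexion x v) z x = - cartan v z x"
  using assms by (auto simp: cartan_reflexion)

text \<open>In the isotropic case the row and the column of \<open>x\<close> both change sign, which
  cancels in the quotient in \<open>a_coef\<close>. Equal coefficients before and after are the
  reason why a reflexion is an involution.\<close>

lemma coef_reflexion:
  assumes "root_datum v"
  shows "a_coef (reflexion x v) x y = a_coef v x y" "b_coef (reflexion x v) x y = b_coef v x y"
  using assms cartan_reflexion_aniso[OF assms, of x] cartan_reflexion_iso[OF assms, of x]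
  by (cases "cartan v x x = 0"; simp add: a_coef_def b_coef_def)+

lemma reflectable_reflexion:
  assumes "root_datum v" "reflectable v x" shows "reflectable (reflexion x v) x"
  using assms cartan_reflexion_aniso[OF assms(1), of x] cartan_reflexion_iso[OF assms(1), of x]
  by (cases "cartan v x x = 0") (auto simp: reflectable_def p_reflexion)

lemma rdatum_eqI:
  "space u = space v \<Longrightarrow> (\<And>x. a_of u x = a_of v x) \<Longrightarrow> (\<And>x h. b_of u x h = b_of v x h) \<Longrightarrow>
    (\<And>x. p_of u x = p_of v x) \<Longrightarrow> u = (v :: ('b, 'x) rdatum)"
  by (intro rdatum.equality ext) auto

lemma reflexion_reflexion:
  assumes "root_datum v" shows "reflexion x (reflexion x v) = v"
proof (rule rdatum_eqI)
  show "p_of (reflexion x (reflexion x v)) y = p_of v y" for y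
    using cartan_reflexion_aniso[OF assms, of x] cartan_reflexion_iso[OF assms, of x]
    by (cases "cartan v x x = 0") (auto simp: p_reflexion add.assoc[symmetric])
qed (auto simp: a_reflexion b_reflexion coef_reflexion[OF assms])

text \<open>Composites of a tautological arrow and a homothety; \<open>d\<close> is the inverse of
  the homothety factor. For \<open>d = 1\<close> it is transport of structure on the nose.\<close>

definition sim ::
    "('b \<Rightarrow> 'b) \<Rightarrow> ('x \<Rightarrow> complex) \<Rightarrow> ('b::complex_vector, 'x::finite) rdatum \<Rightarrow> ('b, 'x) rdatum \<Rightarrow> bool"
  where "sim \<gamma> d u w \<longleftrightarrow> root_datum u \<and> root_datum w \<and> \<gamma> \<in> lin_isos (space u) (space w) \<and>
    (\<forall>x. d x \<noteq> 0 \<and> \<gamma> (a_of u x) = d x *\<^sub>C a_of w x) \<and>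
    (\<forall>x. \<forall>h\<in>space u. b_of w x (\<gamma> h) = b_of u x h) \<and> p_of u = p_of w"

lemma lin_isosD:
  assumes "\<gamma> \<in> lin_isos S T"
  shows "\<gamma> \<in> extensional S" "bij_betw \<gamma> S T" "h \<in> S \<Longrightarrow> \<gamma> h \<in> T"
    "h \<in> S \<Longrightarrow> k \<in> S \<Longrightarrow> \<gamma> (h + k) = \<gamma> h + \<gamma> k" "h \<in> S \<Longrightarrow> \<gamma> (c *\<^sub>C h) = c *\<^sub>C \<gamma> h"
  using assms by (auto simp: lin_isos_def bij_betw_def)

lemma lin_isos_id: "(\<lambda>h\<in>S. h) \<in> lin_isos S S" if "complex_vector.subspace S"
  using that
  by (auto simp: lin_isos_def bij_betw_def inj_on_def complex_vector.subspace_add complex_vector.subspace_scale)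

lemma lin_isos_compose:
  assumes "complex_vector.subspace S" "\<gamma> \<in> lin_isos S T" "\<delta> \<in> lin_isos T U"
  shows "compose S \<delta> \<gamma> \<in> lin_isos S U"
proof -
  have "bij_betw (compose S \<delta> \<gamma>) S U"
    using bij_betw_compose lin_isosD(2) assms by blast
  then show ?thesis
    using assms lin_isosD[OF assms(2)] lin_isosD[OF assms(3)]
    by (auto simp: lin_isos_def compose_def complex_vector.subspace_add complex_vector.subspace_scale)
qed

lemma lin_isos_inverse:
  assumes "complex_vector.subspace S" "complex_vector.subspace T" "\<gamma> \<in> lin_isos S T"
  shows "restrict (inv_into S \<gamma>) T \<in> lin_isos T S"
proof -
  note g = lin_isosD[OF assms(3)]
  have inj: "inj_on \<gamma> S" and im: "\<gamma> ` S = T" using g(2) by (auto simp: bij_betw_def)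
  have i: "inv_into S \<gamma> k \<in> S" "\<gamma> (inv_into S \<gamma> k) = k" if "k \<in> T" for k
    using that im by (auto simp: inv_into_into f_inv_into_f)
  have "inv_into S \<gamma> (h + k) = inv_into S \<gamma> h + inv_into S \<gamma> k" if "h \<in> T" "k \<in> T" for h k
    using i that g(4) assms by (intro inv_into_f_eq[OF inj]) (auto simp: complex_vector.subspace_add)
  moreover have "inv_into S \<gamma> (c *\<^sub>C h) = c *\<^sub>C inv_into S \<gamma> h" if "h \<in> T" for h c
    using i that g(5) assms by (intro inv_into_f_eq[OF inj]) (auto simp: complex_vector.subspace_scale)
  moreover have "bij_betw (restrict (inv_into S \<gamma>) T) T S"
    using bij_betw_inv_into[OF g(2)] bij_betw_cong[of T "restrict (inv_into S \<gamma>) T" "inv_into S \<gamma>"]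
    by simp
  ultimately show ?thesis
    using assms by (auto simp: lin_isos_def complex_vector.subspace_add complex_vector.subspace_scale)
qed

lemma simD:
  assumes "sim \<gamma> d u w"
  shows "root_datum u" "root_datum w" "\<gamma> \<in> lin_isos (space u) (space w)" "d x \<noteq> 0"
    "\<gamma> (a_of u x) = d x *\<^sub>C a_of w x" "h \<in> space u \<Longrightarrow> b_of w x (\<gamma> h) = b_of u x h" "p_of u = p_of w"
  using assms by (auto simp: sim_def)

lemma sim_cartan:
  assumes "sim \<gamma> d u w" shows "cartan u x y = d x * cartan w x y"
  using simD(5,6)[OF assms] root_datumD(2)[OF simD(1)[OF assms]]
    b_linear(2)[OF simD(2)[OF assms]] root_datumD(2)[OF simD(2)[OF assms]]
  unfolding cartan_def by metis

text \<open>A similarity scales each row of the Cartan matrix by one factor, and the conditions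
  involve only ratios within a row and the vanishing of entries.\<close>

lemma sim_reflectable:
  assumes "sim \<gamma> d u w" shows "reflectable u x = reflectable w x"
  unfolding reflectable_def using simD(4,7)[OF assms] by (simp add: sim_cartan[OF assms])

text \<open>\<open>b_coef\<close> is a ratio within the row of \<open>x\<close>, hence invariant,
  while \<open>a_coef\<close> compares the rows of \<open>y\<close> and \<open>x\<close> and scales
  by \<open>d y / d x\<close>. This is what keeps the factors \<open>d\<close> the same after the
  reflexion.\<close>

lemma sim_reflexion:
  assumes "sim \<gamma> d u w" shows "sim \<gamma> d (reflexion x u) (reflexion x w)"
proof -
  note s = simD[OF assms]
  note g = lin_isosD[OF s(3)]
  have c: "a_coef u x y * d x = d y * a_coef w x y" "b_coef u x y = b_coef w x y" for y
    using s(4) by (auto simp: a_coef_def b_coef_def sim_cartan[OF assms] field_simps)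
  have "\<gamma> (- a_of u x) = d x *\<^sub>C (- a_of w x)"
    using g(5)[OF root_datumD(2)[OF s(1)], of "-1" x] s(5) by simp
  moreover have "\<gamma> (a_of u y + a_coef u x y *\<^sub>C a_of u x) = d y *\<^sub>C (a_of w y + a_coef w x y *\<^sub>C a_of w x)" for y
    using g(4,5) root_datumD[OF s(1)] c(1)[of y]
    by (simp add: s(5) complex_vector.subspace_scale complex_vector.scale_right_distrib)
  moreover have "p_of (reflexion x u) = p_of (reflexion x w)"
    using s(4,7) by (auto simp: p_reflexion sim_cartan[OF assms])
  ultimately show ?thesis
    using s c(2) unfolding sim_def
    by (simp add: a_reflexion b_reflexion root_datum_reflexion)
qed

lemma sim_id: "root_datum u \<Longrightarrow> sim (\<lambda>h\<in>space u. h) (\<lambda>_. 1) u u"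
  using root_datumD[of u] by (auto simp: sim_def lin_isos_id)

lemma sim_compose:
  assumes "sim \<gamma> d u w" "sim \<delta> e w z"
  shows "sim (compose (space u) \<delta> \<gamma>) (\<lambda>x. d x * e x) u z"
  using simD[OF assms(1)] simD[OF assms(2)] root_datumD[OF simD(1)[OF assms(1)]]
    root_datumD[OF simD(2)[OF assms(1)]] lin_isosD[OF simD(3)[OF assms(1)]]
    lin_isosD[OF simD(3)[OF assms(2)]]
  unfolding sim_def by (auto simp: lin_isos_compose compose_eq)

lemma sim_inverse:
  assumes "sim \<gamma> d u w"
  shows "sim (restrict (inv_into (space u) \<gamma>) (space w)) (\<lambda>x. inverse (d x)) w u"
proof -
  note s = simD[OF assms]
  note g = lin_isosD[OF s(3)]
  note r = root_datumD[OF s(1)] note r' = root_datumD[OF s(2)]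
  have inj: "inj_on \<gamma> (space u)" and im: "\<gamma> ` space u = space w" using g(2) by (auto simp: bij_betw_def)
  have "inv_into (space u) \<gamma> (a_of w x) = inverse (d x) *\<^sub>C a_of u x" for x
    using s(4,5) g(5) r by (intro inv_into_f_eq[OF inj]) (auto simp: complex_vector.subspace_scale)
  moreover have "b_of u x (inv_into (space u) \<gamma> h) = b_of w x h" if "h \<in> space w" for h x
    using s(6)[of "inv_into (space u) \<gamma> h" x] that im by (simp add: inv_into_into f_inv_into_f)
  ultimately show ?thesis
    using s r r' by (auto simp: sim_def lin_isos_inverse)
qed

text \<open>With all factors 1 the family \<open>a\<close> of the target is prescribed as well as
  \<open>b\<close> and \<open>p\<close>. For unspecified factors only the latter two are, and a
  vertex is recovered by the exchange arguments.\<close>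

lemma sim_exact_unique:
  assumes "sim \<gamma> (\<lambda>_. 1) u w" "sim \<gamma> (\<lambda>_. 1) u w'" "space w = space w'"
  shows "w = w'"
proof (rule rdatum_eqI)
  show "b_of w x h = b_of w' x h" for x h
  proof (cases "h \<in> space w")
    case True
    then obtain k where "k \<in> space u" "h = \<gamma> k"
      using lin_isosD(2)[OF simD(3)[OF assms(1)]] by (auto simp: bij_betw_def)
    then show ?thesis using simD(6)[OF assms(1)] simD(6)[OF assms(2)] by simp
  next
    case False
    then show ?thesis using assms b_linear(3)[OF simD(2)] by metis
  qed
qed (use assms simD(5,7)[OF assms(1)] simD(5,7)[OF assms(2)] in auto)

lemma sim_exact_unique_source:
  assumes "sim \<gamma> (\<lambda>_. 1) u w" "sim \<gamma> (\<lambda>_. 1) u' w" "space u = space u'"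
  shows "u = u'"
proof (rule sim_exact_unique)
  show "sim (restrict (inv_into (space u) \<gamma>) (space w)) (\<lambda>_. 1) w u"
    using sim_inverse[OF assms(1)] by simp
  show "sim (restrict (inv_into (space u) \<gamma>) (space w)) (\<lambda>_. 1) w u'"
    using sim_inverse[OF assms(2)] assms(3) by simp
qed fact

lemma b_sum:
  assumes "root_datum v" "\<And>i. i \<in> M \<Longrightarrow> f i \<in> space v"
  shows "b_of v x (\<Sum>i\<in>M. f i) = (\<Sum>i\<in>M. b_of v x (f i))"
proof -
  have z: "b_of v x 0 = 0" using b_linear(2)[OF assms(1), of 0 x 0] root_datumD(1)[OF assms(1)]
    by (simp add: complex_vector.subspace_0)
  show ?thesis using assms(2)
    by (induction M rule: infinite_finite_induct)
      (auto simp: z b_linear(1)[OF assms(1)] complex_vector.subspace_sum[OF root_datumD(1)[OF assms(1)]])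
qed

lemma lin_isos_sum:
  assumes "complex_vector.subspace S" "\<gamma> \<in> lin_isos S T" "\<And>i. i \<in> M \<Longrightarrow> f i \<in> S"
  shows "\<gamma> (\<Sum>i\<in>M. f i) = (\<Sum>i\<in>M. \<gamma> (f i))"
proof -
  have z: "\<gamma> 0 = 0" using lin_isosD(5)[OF assms(2), of 0 0] assms(1)
    by (simp add: complex_vector.subspace_0)
  show ?thesis using assms(3)
    by (induction M rule: infinite_finite_induct)
      (auto simp: z lin_isosD(4)[OF assms(2)] complex_vector.subspace_sum[OF assms(1)])
qed

lemma sim_transport:
  assumes v: "root_datum v" and T: "fin_dim_subspace T" and \<theta>: "\<theta> \<in> lin_isos (space v) T"
  shows "sim \<theta> (\<lambda>_. 1) v (transport T \<theta> v)"
proof -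
  let ?w = "transport T \<theta> v" and ?S = "space v"
  note r = root_datumD[OF v] and g = lin_isosD[OF \<theta>]
  have T': "complex_vector.subspace T" using T by (simp add: fin_dim_subspace_def)
  have inj: "inj_on \<theta> ?S" and im: "\<theta> ` ?S = T" using g(2) by (auto simp: bij_betw_def)
  have b: "b_of ?w x (\<theta> h) = b_of v x h" if "h \<in> ?S" for x h
    using that inj g(3) by (simp add: transport_def contragredient_def)
  have b0: "b_of ?w x h = 0" if "h \<notin> T" for x h
    using that by (simp add: transport_def contragredient_def)
  have dual: "b_of ?w x \<in> dual_space T" for x
  proof -
    have "b_of ?w x (\<theta> h + \<theta> k) = b_of ?w x (\<theta> h) + b_of ?w x (\<theta> k)" if "h \<in> ?S" "k \<in> ?S" for h k
      using that b[of "h + k" x] b b_linear[OF v] g(4) r(1) by (simp add: complex_vector.subspace_add)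
    moreover have "b_of ?w x (c *\<^sub>C \<theta> h) = c * b_of ?w x (\<theta> h)" if "h \<in> ?S" for h c
      using that b[of "c *\<^sub>C h" x] b b_linear[OF v] g(5) r(1) by (simp add: complex_vector.subspace_scale)
    ultimately show ?thesis
      unfolding dual_space_def using b0 im by blast
  qed
  have "c x = 0" if "(\<Sum>x\<in>UNIV. c x *\<^sub>C a_of ?w x) = 0" for c x
  proof -
    have "(\<Sum>x\<in>UNIV. c x *\<^sub>C a_of ?w x) = (\<Sum>x\<in>UNIV. \<theta> (c x *\<^sub>C a_of v x))"
      using g(5) r by (simp add: transport_def)
    also have "\<dots> = \<theta> (\<Sum>x\<in>UNIV. c x *\<^sub>C a_of v x)"
      using r by (intro lin_isos_sum[OF _ \<theta>, symmetric]) (auto simp: complex_vector.subspace_scale)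
    finally have "\<theta> (\<Sum>x\<in>UNIV. c x *\<^sub>C a_of v x) = \<theta> 0"
      using that g(5)[of 0 0] r(1) by (simp add: complex_vector.subspace_0)
    then have "(\<Sum>x\<in>UNIV. c x *\<^sub>C a_of v x) = 0"
      by (rule inj_onD[OF inj]) (use r in \<open>auto simp: complex_vector.subspace_0 complex_vector.subspace_sum complex_vector.subspace_scale\<close>)
    then show ?thesis using fun_cong[OF a_independent[OF v, of c "\<lambda>_. 0"], of x] by simp
  qed
  moreover have "c x = 0" if "\<forall>h. (\<Sum>x\<in>UNIV. c x * b_of ?w x h) = 0" for c x
  proof -
    have "(\<Sum>x\<in>UNIV. c x * b_of v x h) = 0" for h
    proof (cases "h \<in> ?S")
      case True
      then show ?thesis using that[rule_format, of "\<theta> h"] b by simp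
    qed (simp add: b_linear(3)[OF v])
    then show ?thesis using fun_cong[OF b_independent[OF v, of c "\<lambda>_. 0"], of x] by simp
  qed
  ultimately have "root_datum ?w"
    unfolding root_datum_def using T dual r(2) g(3) by (auto simp: transport_def)
  then show ?thesis
    using v b \<theta> by (auto simp: sim_def transport_def)
qed

lemma sim_homothety:
  assumes v: "root_datum v" and l: "\<forall>x. l x \<noteq> 0"
  shows "sim (\<lambda>h\<in>space v. h) (\<lambda>x. inverse (l x)) v (homothety l v)"
proof -
  note r = root_datumD[OF v]
  have "c x = 0" if "(\<Sum>x\<in>UNIV. c x *\<^sub>C a_of (homothety l v) x) = 0" for c x
    using that fun_cong[OF a_independent[OF v, of "\<lambda>x. c x * l x" "\<lambda>_. 0"], of x] l
    by (simp add: homothety_def)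
  then have "root_datum (homothety l v)"
    using v unfolding root_datum_def by (auto simp: homothety_def complex_vector.subspace_scale r(1))
  then show ?thesis
    using v l r by (auto simp: sim_def homothety_def lin_isos_id)
qed

section \<open>Chains, skeletons and the factorization of arrows\<close>

lemma chain_append: "chain v (xs @ ys) w \<longleftrightarrow> (\<exists>u. chain v xs u \<and> chain u ys w)"
  by (induction xs arbitrary: v) auto

lemma chain_root_datum: "chain v xs u \<Longrightarrow> root_datum v \<Longrightarrow> root_datum u"
  by (induction xs arbitrary: v) (auto simp: root_datum_reflexion)

lemma chain_space: "chain v xs u \<Longrightarrow> space u = space v"
  by (induction xs arbitrary: v) auto

lemma chain_rev: "chain v xs u \<Longrightarrow> root_datum v \<Longrightarrow> chain u (rev xs) v"
proof (induction xs arbitrary: v)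
  case (Cons x xs)
  then have "chain u (rev xs) (reflexion x v)" by (auto simp: root_datum_reflexion)
  moreover have "chain (reflexion x v) [x] v"
    using Cons.prems by (auto simp: reflectable_reflexion reflexion_reflexion)
  ultimately show ?case by (auto simp: chain_append)
qed simp

lemma chain_unique: "chain v xs u \<Longrightarrow> chain v xs w \<Longrightarrow> u = w"
  by (induction xs arbitrary: v) auto

lemma chain_sim: "chain u xs u' \<Longrightarrow> sim \<gamma> d u w \<Longrightarrow> \<exists>w'. chain w xs w' \<and> sim \<gamma> d u' w'"
  by (induction xs arbitrary: u w) (auto simp: sim_reflectable dest: sim_reflexion)

lemma chain_sim_back: "chain w xs w' \<Longrightarrow> sim \<gamma> d u w \<Longrightarrow> \<exists>u'. chain u xs u' \<and> sim \<gamma> d u' w'"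
  by (induction xs arbitrary: u w) (auto simp: sim_reflectable dest: sim_reflexion)

lemma Sk_self: "v \<in> Sk v"
  unfolding Sk_def by (auto intro!: exI[of _ "[]"])

lemma Sk_trans: "u \<in> Sk v \<Longrightarrow> w \<in> Sk u \<Longrightarrow> w \<in> Sk v"
  unfolding Sk_def using chain_append by blast

lemma Sk_sym: "root_datum v \<Longrightarrow> u \<in> Sk v \<Longrightarrow> v \<in> Sk u"
  unfolding Sk_def using chain_rev by blast

lemma Sk_root_datum: "root_datum v \<Longrightarrow> u \<in> Sk v \<Longrightarrow> root_datum u"
  unfolding Sk_def using chain_root_datum by blast

lemma Sk_space: "u \<in> Sk v \<Longrightarrow> space u = space v"
  unfolding Sk_def using chain_space by blast

lemma Sk_reflexion: "u \<in> Sk v \<Longrightarrow> reflectable u x \<Longrightarrow> reflexion x u \<in> Sk v"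
  by (rule Sk_trans[of u]) (auto simp: Sk_def intro!: exI[of _ "[x]"])

lemma Sk_sim: "u' \<in> Sk u \<Longrightarrow> sim \<gamma> d u w \<Longrightarrow> \<exists>w'\<in>Sk w. sim \<gamma> d u' w'"
  unfolding Sk_def using chain_sim by blast

lemma Sk_sim_back: "w' \<in> Sk w \<Longrightarrow> sim \<gamma> d u w \<Longrightarrow> \<exists>u'\<in>Sk u. sim \<gamma> d u' w'"
  unfolding Sk_def using chain_sim_back by blast

lemma sim_id_compose:
  assumes "sim \<gamma> d u w"
  shows "compose (space u) \<gamma> (\<lambda>h\<in>space u. h) = \<gamma>" "compose (space u) (\<lambda>h\<in>space w. h) \<gamma> = \<gamma>"
proof -
  have "\<gamma> h = undefined" if "h \<notin> space u" for h
    using lin_isosD(1)[OF simD(3)[OF assms]] that by (auto simp: extensional_def)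
  then show "compose (space u) \<gamma> (\<lambda>h\<in>space u. h) = \<gamma>" "compose (space u) (\<lambda>h\<in>space w. h) \<gamma> = \<gamma>"
    using lin_isosD(3)[OF simD(3)[OF assms]] by (auto simp: compose_def restrict_def fun_eq_iff)
qed

text \<open>Similarities commute with reflexions of the same name, so all reflexions in a
  composition can be moved to the front.\<close>

lemma arrow_factorization:
  "arrow v \<theta> w \<Longrightarrow> root_datum v \<and> root_datum w \<and> (\<exists>u\<in>Sk v. \<exists>d. sim \<theta> d u w)"
proof (induction rule: arrow.induct)
  case (reflexion v x)
  then have "sim (\<lambda>h\<in>space v. h) (\<lambda>_. 1) (reflexion x v) (reflexion x v)"
    using sim_id[OF root_datum_reflexion] by simp
  then show ?case
    using Sk_reflexion[OF Sk_self reflexion(2)] root_datum_reflexion[OF reflexion(1)] reflexion(1)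
    by blast
next
  case (tautological v T \<theta>)
  then have "sim \<theta> (\<lambda>_. 1) v (transport T \<theta> v)" by (intro sim_transport)
  then show ?case using Sk_self[of v] simD(1,2) by blast
next
  case (homothety v l)
  then have "sim (\<lambda>h\<in>space v. h) (\<lambda>x. inverse (l x)) v (homothety l v)" by (intro sim_homothety)
  then show ?case using Sk_self[of v] simD(1,2) by blast
next
  case (composition u \<theta> v \<eta> w)
  then obtain u' d v' e where u: "u' \<in> Sk u" "sim \<theta> d u' v" and v: "v' \<in> Sk v" "sim \<eta> e v' w"
    by blast
  \<comment> \<open>The second chain of reflexions is pulled back along the first similarity; it
    then continues the chain from \<open>u\<close> to \<open>u'\<close>.\<close>
  obtain u'' where u'': "u'' \<in> Sk u'" "sim \<theta> d u'' v'" using Sk_sim_back[OF v(1) u(2)] by blast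
  have "sim (compose (space u'') \<eta> \<theta>) (\<lambda>x. d x * e x) u'' w"
    by (rule sim_compose[OF u''(2) v(2)])
  moreover have "u'' \<in> Sk u" by (rule Sk_trans[OF u(1) u''(1)])
  moreover from this have "space u'' = space u" by (rule Sk_space)
  ultimately show ?case using composition.IH by auto
qed

lemma arrow_sim:
  assumes "sim \<gamma> d u w" shows "arrow u \<gamma> w"
proof -
  note s = simD[OF assms]
  let ?w = "transport (space w) \<gamma> u"
  have f: "fin_dim_subspace (space w)" using s(2) by (simp add: root_datum_def)
  have 1: "arrow u \<gamma> ?w" by (rule arrow.tautological[OF s(1) f s(3)])
  note t = sim_transport[OF s(1) f s(3)]
  have eq: "homothety (\<lambda>x. inverse (d x)) ?w = w"
  proof (rule sim_exact_unique)
    have h: "sim (\<lambda>h\<in>space ?w. h) (\<lambda>x. inverse (inverse (d x))) ?w (homothety (\<lambda>x. inverse (d x)) ?w)"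
      using s(4) by (intro sim_homothety[OF simD(2)[OF t]]) auto
    show "sim (\<lambda>h\<in>space w. h) (\<lambda>_. 1) w w" by (rule sim_id[OF s(2)])
    show "sim (\<lambda>h\<in>space w. h) (\<lambda>_. 1) w (homothety (\<lambda>x. inverse (d x)) ?w)"
      unfolding sim_def
    proof (intro conjI allI ballI)
      show "root_datum (homothety (\<lambda>x. inverse (d x)) ?w)" by (rule simD(2)[OF h])
      show "(\<lambda>h\<in>space w. h) (a_of w x) = 1 *\<^sub>C a_of (homothety (\<lambda>x. inverse (d x)) ?w) x" for x
        using root_datumD(2)[OF s(2), of x] s(4,5)[of x] by (simp add: homothety_def transport_def)
      show "b_of (homothety (\<lambda>x. inverse (d x)) ?w) x ((\<lambda>h\<in>space w. h) h) = b_of w x h"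
        if "h \<in> space w" for x h
      proof -
        have "h \<in> \<gamma> ` space u"
          using that lin_isosD(2)[OF s(3)] by (simp add: bij_betw_def)
        then obtain k where "k \<in> space u" "h = \<gamma> k" by blast
        then show ?thesis using simD(6)[OF t] s(6) that by (simp add: homothety_def)
      qed
    qed (use s root_datumD(1)[OF s(2)] in \<open>auto simp: homothety_def transport_def lin_isos_id\<close>)
  qed (simp add: homothety_def transport_def)
  have "arrow ?w (\<lambda>h\<in>space ?w. h) (homothety (\<lambda>x. inverse (d x)) ?w)"
    using s(4) by (intro arrow.homothety[OF simD(2)[OF t]]) auto
  then have "arrow u (compose (space u) (\<lambda>h\<in>space ?w. h) \<gamma>) w"
    unfolding eq by (rule arrow.composition[OF 1])
  then show ?thesis using sim_id_compose(2)[OF t] by simp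
qed

lemma arrow_Sk:
  assumes "root_datum v" "u \<in> Sk v" shows "arrow v (\<lambda>h\<in>space v. h) u"
proof -
  have "\<And>v. root_datum v \<Longrightarrow> chain v xs u \<Longrightarrow> arrow v (\<lambda>h\<in>space v. h) u" for xs
  proof (induction xs)
    case Nil
    then show ?case using arrow_sim[OF sim_id[OF Nil.prems(1)]] by (simp only: chain.simps)
  next
    case (Cons x xs)
    then have "arrow v (\<lambda>h\<in>space v. h) (reflexion x v)"
      "arrow (reflexion x v) (\<lambda>h\<in>space v. h) u"
      using arrow.reflexion[of v x] root_datum_reflexion[of v x] by fastforce+
    from arrow.composition[OF this] show ?case by (simp add: compose_def restrict_def cong: if_cong)
  qed
  then show ?thesis using assms unfolding Sk_def by blast
qed

text \<open>Factorization gives a similarity into \<open>v\<close>; carrying the reversed chain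
  along it gives one out of \<open>v\<close>. The latter form exhibits the vertex \<open>u\<close>
  as the image of \<open>v\<close>.\<close>

lemma Aut_iff:
  assumes "root_datum v" shows "\<gamma> \<in> Aut v \<longleftrightarrow> (\<exists>u\<in>Sk v. \<exists>d. sim \<gamma> d v u)"
proof
  assume "\<gamma> \<in> Aut v"
  then obtain u d where u: "u \<in> Sk v" "sim \<gamma> d u v"
    using arrow_factorization unfolding Aut_def by blast
  then obtain w where "w \<in> Sk v" "sim \<gamma> d v w"
    using Sk_sim[OF Sk_sym[OF assms u(1)] u(2)] by blast
  then show "\<exists>u\<in>Sk v. \<exists>d. sim \<gamma> d v u" by blast
next
  assume "\<exists>u\<in>Sk v. \<exists>d. sim \<gamma> d v u"
  then obtain u d where u: "u \<in> Sk v" "sim \<gamma> d v u" by blast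
  have "arrow u (\<lambda>h\<in>space u. h) v"
    using arrow_Sk[OF Sk_root_datum Sk_sym] assms u(1) by blast
  from arrow.composition[OF arrow_sim[OF u(2)] this] show "\<gamma> \<in> Aut v"
    using sim_id_compose(2)[OF u(2)] by (simp add: Aut_def)
qed

section \<open>Automorphisms from D-equivalences\<close>

text \<open>Independent functionals attain all tuples of values. The induction adds one functional
  at a time and needs a vector on which the new one is nonzero and all earlier ones vanish.\<close>

lemma b_surjective:
  fixes u :: "('b::complex_vector, 'x::finite) rdatum"
  assumes u: "root_datum u"
  shows "\<exists>h\<in>space u. \<forall>x. b_of u x h = t x"
proof -
  note r = root_datumD[OF u]
  have "\<exists>h\<in>space u. \<forall>x\<in>Y. b_of u x h = t x" if "finite Y" for Y t
    using that
  proof (induction Y arbitrary: t rule: finite_induct)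
    case empty
    then show ?case using r(1) by (auto intro: complex_vector.subspace_0)
  next
    case (insert x Y)
    have "\<exists>k\<in>space u. (\<forall>y\<in>Y. b_of u y k = 0) \<and> b_of u x k \<noteq> 0"
    proof (rule ccontr)
      assume "\<not> ?thesis"
      then have no: "b_of u x k = 0" if "k \<in> space u" "\<forall>y\<in>Y. b_of u y k = 0" for k
        using that by blast
      \<comment> \<open>If no such vector existed, vectors \<open>g y\<close> dual to the earlier
        functionals would project any \<open>h\<close> to their common kernel, and the new
        functional would be a combination of the earlier ones.\<close>
      have "\<forall>y. \<exists>h\<in>space u. \<forall>z\<in>Y. b_of u z h = (if z = y then 1 else 0)"
        using insert.IH[of "\<lambda>z. if z = _ then 1 else 0"] by auto
      then obtain g where g: "\<And>y. g y \<in> space u" "\<And>y z. z \<in> Y \<Longrightarrow> b_of u z (g y) = (if z = y then 1 else 0)"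
        by metis
      have "b_of u x h = (\<Sum>y\<in>Y. b_of u x (g y) * b_of u y h)" if h: "h \<in> space u" for h
      proof -
        let ?s = "\<Sum>y\<in>Y. (- b_of u y h) *\<^sub>C g y"
        have s: "?s \<in> space u"
          using g(1) by (intro complex_vector.subspace_sum[OF r(1)] complex_vector.subspace_scale[OF r(1)])
        have bs: "b_of u z (h + ?s) = b_of u z h - (\<Sum>y\<in>Y. b_of u y h * b_of u z (g y))" for z
        proof -
          have "b_of u z ?s = (\<Sum>y\<in>Y. b_of u z ((- b_of u y h) *\<^sub>C g y))"
            using g r(1) by (intro b_sum[OF u] complex_vector.subspace_scale) auto
          also have "\<dots> = (\<Sum>y\<in>Y. - (b_of u y h * b_of u z (g y)))"
            using b_linear(2)[OF u g(1)] by (intro sum.cong) (simp_all only: mult_minus_left)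
          finally show ?thesis using b_linear(1)[OF u h s, of z] by (simp add: sum_negf)
        qed
        have "b_of u z (h + ?s) = 0" if "z \<in> Y" for z
          using that insert.hyps(1) unfolding bs by (simp add: g(2) if_distrib cong: if_cong)
        then have "b_of u x (h + ?s) = 0"
          using h s r(1) by (intro no) (auto simp: complex_vector.subspace_add)
        then show ?thesis unfolding bs by (simp add: mult.commute)
      qed
      moreover have "b_of u x h = (\<Sum>y\<in>Y. b_of u x (g y) * b_of u y h)" if h: "h \<notin> space u" for h
        using b_linear(3)[OF u h] by simp
      ultimately have *: "b_of u x h = (\<Sum>y\<in>Y. b_of u x (g y) * b_of u y h)" for h by blast
      have "(\<Sum>y\<in>UNIV. (if y = x then 1 else 0) * b_of u y h)
          = (\<Sum>y\<in>UNIV. (if y \<in> Y then b_of u x (g y) else 0) * b_of u y h)" for h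
      proof -
        have "(\<Sum>y\<in>UNIV. (if y \<in> Y then b_of u x (g y) else 0) * b_of u y h)
            = (\<Sum>y\<in>Y. b_of u x (g y) * b_of u y h)"
          by (intro sum.mono_neutral_cong_right) auto
        then show ?thesis using *[of h] by (simp only: sum_delta_mult)
      qed
      from fun_cong[OF b_independent[OF u this], of x] show False using insert.hyps(2) by simp
    qed
    then obtain k where k: "k \<in> space u" "\<And>y. y \<in> Y \<Longrightarrow> b_of u y k = 0" "b_of u x k \<noteq> 0" by blast
    obtain h where h: "h \<in> space u" "\<And>y. y \<in> Y \<Longrightarrow> b_of u y h = t y" using insert.IH[of t] by blast
    let ?c = "(t x - b_of u x h) / b_of u x k"
    have "b_of u y (h + ?c *\<^sub>C k) = b_of u y h + ?c * b_of u y k" for y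
      using k h r(1) by (simp add: b_linear[OF u] complex_vector.subspace_scale)
    then show ?case
      using k h r(1)
      by (intro bexI[of _ "h + ?c *\<^sub>C k"])
        (auto simp: complex_vector.subspace_scale complex_vector.subspace_add)
  qed
  from this[of UNIV t] show ?thesis by auto
qed

interpretation complex_vector_pair: vector_space_pair
  "scaleC :: complex \<Rightarrow> 'b \<Rightarrow> 'b::complex_vector" "scaleC :: complex \<Rightarrow> 'b \<Rightarrow> 'b::complex_vector" ..

text \<open>A linear map that fixes \<open>C\<close> and kills \<open>D\<close> sends
  \<open>h\<close> both to itself and to 0.\<close>

lemma independent_span_disjoint:
  assumes "complex_vector.independent (C \<union> D)" "C \<inter> D = {}"
    "h \<in> complex_vector.span C" "h \<in> complex_vector.span D"
  shows "h = 0"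
proof -
  obtain g where g: "Vector_Spaces.linear scaleC scaleC g"
    "\<forall>x\<in>C \<union> D. g x = (if x \<in> C then x else 0)"
    using complex_vector_pair.linear_independent_extend[OF assms(1), of "\<lambda>x. if x \<in> C then x else 0"]
    by blast
  interpret g: Vector_Spaces.linear scaleC scaleC g by fact
  have "g h = h" using assms(3)
  proof (induction rule: complex_vector.span_induct_alt)
    case (step c x y)
    then show ?case using g(2) by (simp add: g.add g.scale)
  qed (simp add: g.zero)
  moreover have "g h = 0" using assms(4)
  proof (induction rule: complex_vector.span_induct_alt)
    case (step c x y)
    then show ?case using g(2) assms(2) by (auto simp: g.add g.scale)
  qed (simp add: g.zero)
  ultimately show ?thesis by simp
qed

lemma linear_inj_on_surj:
  assumes "Vector_Spaces.linear scaleC scaleC g" "fin_dim_subspace S" "inj_on g S" "g ` S \<subseteq> S"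
  shows "g ` S = S"
proof
  have S: "complex_vector.subspace S" using assms(2) by (simp add: fin_dim_subspace_def)
  obtain T where T: "finite T" "complex_vector.span T = S" using assms(2) by (auto simp: fin_dim_subspace_def)
  obtain B where B: "B \<subseteq> S" "complex_vector.independent B" "S \<subseteq> complex_vector.span B"
    using complex_vector.maximal_independent_subset by blast
  have spanB: "complex_vector.span B = S"
    using B S complex_vector.span_minimal by blast
  have finB: "finite B" using complex_vector.independent_span_bound[OF T(1) B(2)] B(1) T(2) by blast
  interpret g: Vector_Spaces.linear scaleC scaleC g by fact
  have ind: "complex_vector.independent (g ` B)"
    using g.independent_injective_image[OF B(2)] assms(3) spanB by simp
  have card: "card (g ` B) = card B"
    using assms(3) B(1) by (intro card_image) (rule inj_on_subset)
  show "S \<subseteq> g ` S"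
  proof
    fix h assume h: "h \<in> S"
    have "h \<in> complex_vector.span (g ` B)"
    proof (rule ccontr)
      assume n: "h \<notin> complex_vector.span (g ` B)"
      then have "complex_vector.independent (insert h (g ` B))"
        using ind by (rule complex_vector.independent_insertI)
      moreover have "insert h (g ` B) \<subseteq> complex_vector.span B"
        using h assms(4) B(1) spanB by blast
      ultimately have "card (insert h (g ` B)) \<le> card B"
        using complex_vector.independent_span_bound[OF finB] by blast
      moreover have "h \<notin> g ` B" using n complex_vector.span_base by blast
      ultimately show False using finB card by simp
    qed
    then show "h \<in> g ` S" using spanB by (simp add: g.span_image)
  qed
qed fact

text \<open>Reflexions replace the \<open>a\<close> by combinations of themselves, so their span is
  an invariant of the skeleton, as is the common kernel of the \<open>b\<close>
  (\<open>Sk_annihilator\<close>). Both invariants enter the lifting of D-equivalences.\<close>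

lemma Sk_span: "u \<in> Sk v \<Longrightarrow> a_of u x \<in> complex_vector.span (range (a_of v))"
proof -
  have "\<forall>x. a_of u x \<in> complex_vector.span (range (a_of v))"
    if "chain w xs u" "\<forall>x. a_of w x \<in> complex_vector.span (range (a_of v))" for xs w
    using that
    by (induction xs arbitrary: w)
      (auto simp: a_reflexion complex_vector.span_neg complex_vector.span_add complex_vector.span_scale)
  then show "a_of u x \<in> complex_vector.span (range (a_of v))" if "u \<in> Sk v"
    using that unfolding Sk_def by (auto simp: complex_vector.span_base)
qed

lemma Sk_annihilator: "u \<in> Sk v \<Longrightarrow> \<forall>x. b_of v x h = 0 \<Longrightarrow> b_of u x h = 0"
proof -
  have "\<forall>x. b_of u x h = 0" if "chain w xs u" "\<forall>x. b_of w x h = 0" for xs w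
    using that by (induction xs arbitrary: w) (auto simp: b_reflexion)
  then show "u \<in> Sk v \<Longrightarrow> \<forall>x. b_of v x h = 0 \<Longrightarrow> b_of u x h = 0"
    unfolding Sk_def by blast
qed

text \<open>The factors \<open>d\<close> fix the map on the span of the \<open>a_of v x\<close>,
  where D-equivalence makes it compatible with \<open>b\<close>. Elsewhere only the values of the
  \<open>b_of u x\<close> are prescribed, which determines images up to the common kernel
  \<open>?N\<close>; the difficulty is to choose them injectively.\<close>

lemma D_equivalent_sim:
  fixes v u :: "('b::complex_vector, 'x::finite) rdatum"
  assumes v: "root_datum v" and u: "u \<in> Sk v" and D: "D_equivalent v u"
  shows "\<exists>\<gamma> d. sim \<gamma> d v u"
proof -
  note ru = Sk_root_datum[OF v u]
  note rv = root_datumD[OF v]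
  note ru' = root_datumD[OF ru]
  let ?S = "space v" and ?I = "range (a_of v)"
  let ?N = "{h \<in> space v. \<forall>x. b_of v x h = 0}"
  have S: "space u = ?S" by (rule Sk_space[OF u])
  have N: "b_of u x h = 0 \<and> b_of v x h = 0" if "h \<in> ?N" for x h
    using that Sk_annihilator[OF u] by blast
  have N': "h \<in> ?N" if "h \<in> ?S" "\<forall>x. b_of u x h = 0" for h
    using that Sk_annihilator[OF Sk_sym[OF v u]] by blast
  obtain d where d: "\<And>x. d x \<noteq> 0" "\<And>x y. cartan u x y = d x * cartan v x y" and p: "p_of v = p_of u"
    using D unfolding D_equivalent_def by blast
  have inj_a: "inj (a_of v)"
  proof (rule injI)
    fix x y assume "a_of v x = a_of v y"
    then have "(\<Sum>z\<in>UNIV. (if z = x then 1 else 0) *\<^sub>C a_of v z)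
        = (\<Sum>z\<in>UNIV. (if z = y then 1 else 0) *\<^sub>C a_of v z)"
      by (subst (1) sum.remove[of _ x], simp, simp, subst (2) sum.remove[of _ y]) auto
    from fun_cong[OF a_independent[OF v this], of x] show "x = y" by (auto split: if_splits)
  qed
  have indI: "complex_vector.independent ?I"
  proof
    assume "complex_vector.dependent ?I"
    then obtain c where c: "\<exists>h\<in>?I. c h \<noteq> 0" "(\<Sum>h\<in>?I. c h *\<^sub>C h) = 0"
      using complex_vector.dependent_finite[of ?I] by auto
    have "(\<Sum>x\<in>UNIV. c (a_of v x) *\<^sub>C a_of v x) = (\<Sum>x\<in>UNIV. 0 *\<^sub>C a_of v x)"
      using c(2) by (simp add: sum.reindex[OF inj_a])
    from fun_cong[OF a_independent[OF v this]] show False using c(1) by auto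
  qed
  \<comment> \<open>\<open>?N\<close> may meet the span of the \<open>a\<close>, so the basis is
    built in stages: the \<open>a_of v x\<close>, then elements of \<open>?N\<close>, then the rest
    of the space.\<close>
  obtain C where C: "?I \<subseteq> C" "C \<subseteq> ?I \<union> ?N" "complex_vector.independent C"
      "?I \<union> ?N \<subseteq> complex_vector.span C"
    using complex_vector.maximal_independent_subset_extend[of ?I "?I \<union> ?N"] indI by auto
  have CS: "C \<subseteq> ?S" using C(2) rv(2) by auto
  obtain B where B: "C \<subseteq> B" "B \<subseteq> ?S" "complex_vector.independent B" "?S \<subseteq> complex_vector.span B"
    using complex_vector.maximal_independent_subset_extend[of C ?S] C(3) CS by auto
  have "\<forall>h. \<exists>k. h \<in> ?S \<longrightarrow> k \<in> ?S \<and> (\<forall>x. b_of u x k = b_of v x h)"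
  proof
    fix h
    show "\<exists>k. h \<in> ?S \<longrightarrow> k \<in> ?S \<and> (\<forall>x. b_of u x k = b_of v x h)"
      using b_surjective[OF ru, of "\<lambda>x. b_of v x h"] S by blast
  qed
  then obtain q where q: "\<And>h. h \<in> ?S \<Longrightarrow> q h \<in> ?S" "\<And>h x. h \<in> ?S \<Longrightarrow> b_of u x (q h) = b_of v x h"
    by metis
  \<comment> \<open>The factor \<open>inverse (d x)\<close> turns the row of \<open>x\<close> at
    \<open>u\<close> back into that at \<open>v\<close>. On the remaining elements of
    \<open>?N\<close> the identity is allowed because \<open>?N\<close> is also the common kernel at
    \<open>u\<close>.\<close>
  let ?f = "\<lambda>h. if h \<in> ?I then (let x = inv_into UNIV (a_of v) h in inverse (d x) *\<^sub>C a_of u x)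
      else if h \<in> C then h else q h"
  obtain g where g: "Vector_Spaces.linear scaleC scaleC g" "\<forall>h\<in>B. g h = ?f h"
    using complex_vector_pair.linear_independent_extend[OF B(3), of ?f] by blast
  interpret g: Vector_Spaces.linear scaleC scaleC g by fact
  have ga: "g (a_of v x) = inverse (d x) *\<^sub>C a_of u x" for x
  proof -
    have "a_of v x \<in> B" using C(1) B(1) by auto
    from g(2)[rule_format, OF this] show ?thesis by (simp add: inv_f_f[OF inj_a])
  qed
  have gC: "g h = h" if "h \<in> C - ?I" for h
    using g(2) B(1) that by auto
  have gB: "g h \<in> ?S \<and> (\<forall>x. b_of u x (g h) = b_of v x h)" if "h \<in> B" for h
  proof -
    consider x where "h = a_of v x" | "h \<in> C - ?I" | "h \<notin> C" using C(1) by blast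
    then show ?thesis
    proof cases
      case 1
      have au: "a_of u x \<in> ?S" using ru'(2) S by simp
      have "b_of u y (g h) = b_of v y h" for y
        using b_linear(2)[OF ru ru'(2), of y "inverse (d x)" x] d(2)[of x y] d(1)[of x]
        unfolding 1 ga cartan_def by simp
      moreover have "g h \<in> ?S"
        unfolding 1 ga by (rule complex_vector.subspace_scale[OF rv(1) au])
      ultimately show ?thesis by blast
    next
      case 2
      then have "h \<in> ?N" using C(2) by blast
      with N[OF this] show ?thesis by (simp add: gC[OF 2])
    next
      case 3
      then have "g h = q h" using g(2) that C(1) by auto
      then show ?thesis using q B(2) that by auto
    qed
  qed
  have gS: "g h \<in> ?S \<and> (\<forall>x. b_of u x (g h) = b_of v x h)" if "h \<in> ?S" for h
  proof -
    have "h \<in> complex_vector.span B" using that B(4) by blast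
    then have "h \<in> ?S \<and> g h \<in> ?S \<and> (\<forall>x. b_of u x (g h) = b_of v x h)"
    proof (induction rule: complex_vector.span_induct_alt)
      case base
      have "b_of w x 0 = 0" if "root_datum w" for w :: "('b, 'x) rdatum" and x
        using b_sum[OF that, of "{}" id x] by simp
      then show ?case using rv(1) v ru by (simp add: g.zero complex_vector.subspace_0)
    next
      case (step c x y)
      have "x \<in> ?S" using step(1) B(2) by blast
      with step gB[OF step(1)] show ?case
        using rv(1) S
        by (simp add: g.add g.scale b_linear[OF v] b_linear[OF ru] complex_vector.subspace_add
            complex_vector.subspace_scale)
    qed
    then show ?thesis by blast
  qed
  have inj: "inj_on g ?S"
  proof -
    have "h = 0" if h: "h \<in> ?S" "g h = 0" for h
    proof -
      \<comment> \<open>A vector killed by \<open>g\<close> lies in \<open>?N\<close>, hence in the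
        span of \<open>C\<close>. Its part outside the \<open>a\<close> is fixed by
        \<open>g\<close>, while the image of the other part stays in their span by
        \<open>Sk_span\<close>; so both parts vanish separately.\<close>
      have "h \<in> ?N" using gS[OF h(1)] h b_sum[OF ru, of "{}" id] by simp
      then have "h \<in> complex_vector.span (?I \<union> (C - ?I))" using C(1,4) by (auto simp: Un_absorb1)
      then obtain i n where hin: "h = i + n" "i \<in> complex_vector.span ?I" "n \<in> complex_vector.span (C - ?I)"
        unfolding complex_vector.span_Un by blast
      have gn: "g n = n" using hin(3)
        by (induction rule: complex_vector.span_induct_alt) (use gC in \<open>auto simp: g.zero g.add g.scale\<close>)
      have gi: "g i \<in> complex_vector.span ?I" using hin(2)
        by (induction rule: complex_vector.span_induct_alt)
          (auto simp: g.zero g.add g.scale ga complex_vector.span_zero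
            intro!: complex_vector.span_add complex_vector.span_scale Sk_span[OF u])
      have "n = - g i" using h(2) hin(1) gn by (simp add: g.add eq_neg_iff_add_eq_0 add.commute)
      then have "n \<in> complex_vector.span ?I" using gi complex_vector.span_neg by blast
      moreover have "complex_vector.independent (?I \<union> (C - ?I))" using C(1,3) by (simp add: Un_absorb1)
      ultimately have n0: "n = 0"
        using independent_span_disjoint[of ?I "C - ?I" n] hin(3) by blast
      then have gi0: "g i = 0" using \<open>n = - g i\<close> by simp
      obtain c where "i = (\<Sum>h\<in>?I. c h *\<^sub>C h)"
        using hin(2) complex_vector.span_finite[of ?I] by auto
      then have ic: "i = (\<Sum>x\<in>UNIV. c (a_of v x) *\<^sub>C a_of v x)"
        by (simp add: sum.reindex[OF inj_a])
      then have "g i = (\<Sum>x\<in>UNIV. (c (a_of v x) * inverse (d x)) *\<^sub>C a_of u x)"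
        by (simp add: g.sum g.scale ga)
      then have sz: "(\<Sum>x\<in>UNIV. (c (a_of v x) * inverse (d x)) *\<^sub>C a_of u x) = (\<Sum>x\<in>UNIV. 0 *\<^sub>C a_of u x)"
        using gi0 by simp
      have "c (a_of v x) = 0" for x
        using fun_cong[OF a_independent[OF ru sz], of x] d(1)[of x] by simp
      then show ?thesis using ic n0 hin(1) by simp
    qed
    then show ?thesis using g.inj_on_iff_eq_0[OF rv(1)] by blast
  qed
  have surj: "g ` ?S = ?S"
    using g(1) inj gS v unfolding root_datum_def by (intro linear_inj_on_surj) auto
  have "restrict g ?S \<in> lin_isos ?S ?S"
    using inj surj rv(1)
    by (auto simp: lin_isos_def bij_betw_def inj_on_def g.add g.scale complex_vector.subspace_add
        complex_vector.subspace_scale)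
  then have "sim (restrict g ?S) (\<lambda>x. inverse (d x)) v u"
    using v ru S rv(2) ga d(1) gS p by (auto simp: sim_def)
  then show ?thesis by blast
qed

section \<open>Reflections, signs of roots and exchange\<close>

lemma Bij_lin_isos: "lin_isos S S \<subseteq> Bij S"
  by (auto simp: lin_isos_def Bij_def)

lemma GL_simps:
  "carrier (GL S) = lin_isos S S" "\<one>\<^bsub>GL S\<^esub> = (\<lambda>h\<in>S. h)"
  "\<gamma> \<in> lin_isos S S \<Longrightarrow> \<delta> \<in> lin_isos S S \<Longrightarrow> \<gamma> \<otimes>\<^bsub>GL S\<^esub> \<delta> = compose S \<gamma> \<delta>"
  using Bij_lin_isos[of S] by (auto simp: GL_def BijGroup_def)

lemma subgroup_lin_isos:
  assumes "complex_vector.subspace S" shows "subgroup (lin_isos S S) (BijGroup S)"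
proof (rule group.subgroupI[OF group_BijGroup])
  show "lin_isos S S \<subseteq> carrier (BijGroup S)" using Bij_lin_isos by (auto simp: BijGroup_def)
  show "lin_isos S S \<noteq> {}" using lin_isos_id[OF assms] by blast
next
  fix \<gamma> assume g: "\<gamma> \<in> lin_isos S S"
  then have "inv\<^bsub>BijGroup S\<^esub> \<gamma> = (\<lambda>h\<in>S. inv_into S \<gamma> h)"
    using Bij_lin_isos by (intro inv_BijGroup) blast
  then show "inv\<^bsub>BijGroup S\<^esub> \<gamma> \<in> lin_isos S S"
    using lin_isos_inverse[OF assms assms g] by simp
next
  fix \<gamma> \<delta> assume *: "\<gamma> \<in> lin_isos S S" "\<delta> \<in> lin_isos S S"
  then have "\<gamma> \<otimes>\<^bsub>BijGroup S\<^esub> \<delta> = compose S \<gamma> \<delta>"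
    using Bij_lin_isos[of S] by (auto simp: BijGroup_def)
  then show "\<gamma> \<otimes>\<^bsub>BijGroup S\<^esub> \<delta> \<in> lin_isos S S"
    using lin_isos_compose[OF assms *(2,1)] by simp
qed

lemma group_GL: "complex_vector.subspace S \<Longrightarrow> group (GL S)"
  unfolding GL_def using subgroup_lin_isos group_BijGroup by (rule subgroup.subgroup_is_group)

lemma root_reflection_in_space:
  assumes "root_datum u" "h \<in> space u"
  shows "h - b_of u x h *\<^sub>C ((2 / cartan u x x) *\<^sub>C a_of u x) \<in> space u"
  using root_datumD[OF assms(1)] assms(2)
  by (intro complex_vector.subspace_diff complex_vector.subspace_scale) auto

lemma b_minus_scale:
  assumes "root_datum u" "h \<in> space u"
  shows "b_of u y (h - c *\<^sub>C a_of u x) = b_of u y h - c * cartan u x y"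
proof -
  note r = root_datumD[OF assms(1)]
  have "b_of u y (h + (- c) *\<^sub>C a_of u x) = b_of u y h + (- c) * cartan u x y"
    using b_linear(1)[OF assms(1,2), of "(- c) *\<^sub>C a_of u x" y] b_linear(2)[OF assms(1) r(2), of y "- c" x] r
    unfolding cartan_def by (metis complex_vector.subspace_scale)
  then show ?thesis by simp
qed

text \<open>An anisotropic reflexion is transport of structure along the reflection of the root,
  with no factors on \<open>a\<close>. This converts steps of a chain into elements of the Weyl
  group.\<close>

lemma sim_root_reflection:
  assumes u: "root_datum u" and n: "cartan u x x \<noteq> 0"
  shows "sim (root_reflection u x) (\<lambda>_. 1) u (reflexion x u)"
proof -
  let ?s = "root_reflection u x" and ?S = "space u"
  note r = root_datumD[OF u]
  have s: "?s h = h - (b_of u x h * (2 / cartan u x x)) *\<^sub>C a_of u x" if "h \<in> ?S" for h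
    using that by (simp add: root_reflection_def)
  have sS: "?s h \<in> ?S" if "h \<in> ?S" for h
    using that root_reflection_in_space[OF u that] by (simp add: root_reflection_def)
  have bs: "b_of u y (?s h) = b_of u y h - b_of u x h * (2 / cartan u x x) * cartan u x y" if "h \<in> ?S" for y h
    using that by (simp only: s b_minus_scale[OF u])
  have ss: "?s (?s h) = h" if "h \<in> ?S" for h
  proof -
    have "b_of u x (?s h) = - b_of u x h" using bs[OF that, of x] n by simp
    then show ?thesis using s[OF sS[OF that]] s[OF that] by simp
  qed
  have "bij_betw ?s ?S ?S"
    by (rule bij_betw_byWitness[where f' = ?s]) (use ss sS in auto)
  moreover have "?s (h + k) = ?s h + ?s k" if "h \<in> ?S" "k \<in> ?S" for h k
  proof -
    have "?s (h + k) = h + k - ((b_of u x h + b_of u x k) * (2 / cartan u x x)) *\<^sub>C a_of u x"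
      using that s[OF complex_vector.subspace_add[OF r(1) that]] by (simp add: b_linear[OF u])
    also have "\<dots> = ?s h + ?s k"
      using that by (simp only: s distrib_right complex_vector.scale_left_distrib add_diff_add)
    finally show ?thesis .
  qed
  moreover have "?s (c *\<^sub>C h) = c *\<^sub>C ?s h" if "h \<in> ?S" for h c
    using that s[OF complex_vector.subspace_scale[OF r(1) that]]
    by (simp add: s b_linear[OF u] complex_vector.scale_right_diff_distrib mult.assoc)
  ultimately have lin: "?s \<in> lin_isos ?S ?S"
    by (simp add: lin_isos_def root_reflection_def)
  have "?s (a_of u y) = a_of (reflexion x u) y" for y
    using s[OF r(2)] n by (simp add: reflexion_def cartan_def)
  moreover have "b_of (reflexion x u) y (?s h) = b_of u y h" if "h \<in> ?S" for y h
  proof -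
    have "b_of (reflexion x u) y (?s h)
        = b_of u y (?s h) - (2 * cartan u x y / cartan u x x) * b_of u x (?s h)"
      using n by (simp add: reflexion_def)
    then show ?thesis using n by (simp add: bs[OF that] field_simps)
  qed
  moreover have "p_of u = p_of (reflexion x u)" using n by (simp add: reflexion_def)
  ultimately show ?thesis
    using u lin root_datum_reflexion[OF u] by (simp add: sim_def)
qed

lemma root_reflection_involution:
  assumes u: "root_datum u" and n: "cartan u x x \<noteq> 0"
  shows "root_reflection u x \<otimes>\<^bsub>GL (space u)\<^esub> root_reflection u x = \<one>\<^bsub>GL (space u)\<^esub>"
proof -
  note s = sim_root_reflection[OF u n]
  note lin = simD(3)[OF s, unfolded space_reflexion]
  have "compose (space u) (root_reflection u x) (root_reflection u x) = (\<lambda>h\<in>space u. h)"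
  proof
    fix h
    show "compose (space u) (root_reflection u x) (root_reflection u x) h = (\<lambda>h\<in>space u. h) h"
    proof (cases "h \<in> space u")
      case True
      let ?c = "b_of u x h * (2 / cartan u x x)"
      have "root_reflection u x h = h - ?c *\<^sub>C a_of u x"
        using True by (simp add: root_reflection_def)
      moreover have "b_of u x (h - ?c *\<^sub>C a_of u x) = - b_of u x h"
        using b_minus_scale[OF u True, of x ?c x] n by simp
      moreover have "h - ?c *\<^sub>C a_of u x \<in> space u"
        using root_reflection_in_space[OF u True, of x] by simp
      ultimately show ?thesis using True by (simp add: compose_def root_reflection_def)
    qed (simp add: compose_def)
  qed
  then show ?thesis using lin by (simp add: GL_simps)
qed

text \<open>The usual conjugation formula for reflections, written without an inverse. The factor
  \<open>d x\<close> scales \<open>a\<close> and the diagonal Cartan entry alike, so it cancels in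
  the coroot.\<close>

lemma sim_conjugates_root_reflection:
  assumes g: "sim \<gamma> d u w" and S: "space w = space u" and n: "cartan u x x \<noteq> 0"
  shows "\<gamma> \<otimes>\<^bsub>GL (space u)\<^esub> root_reflection u x = root_reflection w x \<otimes>\<^bsub>GL (space u)\<^esub> \<gamma>"
proof -
  note s = simD[OF g]
  have n': "cartan w x x \<noteq> 0" using n sim_cartan[OF g, of x x] by auto
  note lin = lin_isosD[OF s(3)]
  have "compose (space u) \<gamma> (root_reflection u x) h = compose (space u) (root_reflection w x) \<gamma> h" for h
  proof (cases "h \<in> space u")
    case True
    let ?c = "- (b_of u x h * (2 / cartan u x x))"
    have "\<gamma> (h + ?c *\<^sub>C a_of u x) = \<gamma> h + ?c *\<^sub>C d x *\<^sub>C a_of w x"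
      using lin(4)[OF True complex_vector.subspace_scale[OF root_datumD(1,2)[OF s(1)]], of ?c x]
        lin(5)[OF root_datumD(2)[OF s(1)], of ?c x]
      by (simp only: s(5))
    moreover have "?c * d x = - (b_of w x (\<gamma> h) * (2 / cartan w x x))"
      using s(4,6) True n n' by (simp add: sim_cartan[OF g])
    ultimately have "\<gamma> (h + ?c *\<^sub>C a_of u x) = \<gamma> h + (- (b_of w x (\<gamma> h) * (2 / cartan w x x))) *\<^sub>C a_of w x"
      by simp
    then show ?thesis
      using True lin(3)[OF True] S by (simp add: compose_eq root_reflection_def)
  qed (simp add: compose_def)
  moreover have "root_reflection u x \<in> lin_isos (space u) (space u)"
    "root_reflection w x \<in> lin_isos (space u) (space u)"
    using simD(3)[OF sim_root_reflection[OF s(1) n]] simD(3)[OF sim_root_reflection[OF s(2) n']] S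
    by simp_all
  ultimately show ?thesis using s(3) S by (auto simp: GL_simps)
qed

section \<open>Positivity of roots\<close>

lemma nat_comb_self: "nat_comb u (b_of u x)"
proof -
  have "b_of u x = (\<lambda>h. \<Sum>y\<in>UNIV. of_nat (((\<lambda>_. 0)(x := Suc 0)) y) * b_of u y h)"
    by (simp only: sum_unit_mult)
  then show ?thesis unfolding nat_comb_def by blast
qed

lemma nat_comb_add:
  assumes "nat_comb u f" "nat_comb u g" shows "nat_comb u (\<lambda>h. f h + g h)"
proof -
  obtain n m where "f = (\<lambda>h. \<Sum>y\<in>UNIV. of_nat (n y) * b_of u y h)"
    "g = (\<lambda>h. \<Sum>y\<in>UNIV. of_nat (m y) * b_of u y h)" using assms unfolding nat_comb_def by blast
  then have "(\<lambda>h. f h + g h) = (\<lambda>h. \<Sum>y\<in>UNIV. of_nat (n y + m y) * b_of u y h)"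
    by (simp add: distrib_right sum.distrib)
  then show ?thesis unfolding nat_comb_def by (intro exI[of _ "\<lambda>y. n y + m y"])
qed

lemma nat_comb_not_neg:
  assumes u: "root_datum u" and w: "root_datum w"
    and "nat_comb u (b_of w x)" "nat_comb u (\<lambda>h. - b_of w x h)"
  shows False
proof -
  obtain n m where n: "b_of w x = (\<lambda>h. \<Sum>y\<in>UNIV. of_nat (n y) * b_of u y h)"
    and m: "(\<lambda>h. - b_of w x h) = (\<lambda>h. \<Sum>y\<in>UNIV. of_nat (m y) * b_of u y h)"
    using assms(3,4) unfolding nat_comb_def by blast
  have "(\<Sum>y\<in>UNIV. of_nat (n y + m y) * b_of u y h) = (\<Sum>y\<in>UNIV. 0 * b_of u y h)" for h
    by (simp only: of_nat_add distrib_right sum.distrib fun_cong[OF n, symmetric]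
        fun_cong[OF m, symmetric]) simp
  from b_independent[OF u this] have "(\<lambda>y. of_nat (n y + m y) :: complex) = (\<lambda>y. 0)" .
  then have "n y = 0" for y by (auto simp: fun_eq_iff simp flip: of_nat_add)
  then have z: "b_of w x h = 0" for h using fun_cong[OF n, of h] by simp
  have "(\<Sum>y\<in>UNIV. (if y = x then 1 else 0) * b_of w y h) = (\<Sum>y\<in>UNIV. 0 * b_of w y h)" for h
    by (simp only: sum_delta_mult z) simp
  from fun_cong[OF b_independent[OF w this], of x] show False by simp
qed

lemma nat_comb_transport:
  assumes p: "sim \<gamma> d p p'" and u: "sim \<gamma> e u u'" and S: "space p = space u"
    and c: "nat_comb p' (b_of u' x)"
  shows "nat_comb p (b_of u x)"
proof -
  obtain n where n: "b_of u' x = (\<lambda>h. \<Sum>y\<in>UNIV. of_nat (n y) * b_of p' y h)"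
    using c unfolding nat_comb_def by blast
  have "b_of u x h = (\<Sum>y\<in>UNIV. of_nat (n y) * b_of p y h)" for h
  proof (cases "h \<in> space u")
    case True
    then show ?thesis
      using fun_cong[OF n, of "\<gamma> h"] simD(6)[OF p, of h] simD(6)[OF u, of h] S by simp
  next
    case False
    then show ?thesis using b_linear(3)[OF simD(1)[OF u]] b_linear(3)[OF simD(1)[OF p]] S by simp
  qed
  then show ?thesis unfolding nat_comb_def by blast
qed

text \<open>The conditions range over all pairs of vertices of the skeleton, so they pass to every
  vertex; uniqueness proved relative to the base point \<open>v\<close> then holds for any two
  vertices.\<close>

locale admissible_datum =
  fixes v :: "('b::complex_vector, 'x::finite) rdatum"
  assumes rd: "root_datum v"
    and sign: "u \<in> Sk v \<Longrightarrow> w \<in> Sk v \<Longrightarrow>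
      nat_comb w (b_of u x) \<or> nat_comb w (\<lambda>h. - b_of u x h)"
    and coroot: "u \<in> Sk v \<Longrightarrow> w \<in> Sk v \<Longrightarrow> b_of u x = b_of w y \<Longrightarrow>
      \<exists>c. c \<noteq> 0 \<and> a_of u x = c *\<^sub>C a_of w y"
    and wsym: "u \<in> Sk v \<Longrightarrow> reflectable u x \<Longrightarrow> cartan u x y = 0 \<Longrightarrow> cartan u y x = 0"
begin

abbreviation "S \<equiv> space v"
abbreviation "G \<equiv> GL S"

lemma subspace_S: "complex_vector.subspace S"
  by (rule root_datumD(1)[OF rd])

sublocale G: group "GL S"
  by (rule group_GL[OF subspace_S])

lemma Sk_rd: "u \<in> Sk v \<Longrightarrow> root_datum u"
  by (rule Sk_root_datum[OF rd])

definition aniso :: "('b, 'x) rdatum \<Rightarrow> 'x \<Rightarrow> bool" where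
  "aniso u x \<longleftrightarrow> reflectable u x \<and> cartan u x x \<noteq> 0"

definition iso :: "('b, 'x) rdatum \<Rightarrow> 'x \<Rightarrow> bool" where
  "iso u x \<longleftrightarrow> reflectable u x \<and> cartan u x x = 0"

lemma sim_aniso: "sim \<gamma> d u w \<Longrightarrow> aniso u x \<longleftrightarrow> aniso w x"
  using simD(4) by (fastforce simp: aniso_def sim_reflectable sim_cartan)

lemma sign_iff:
  assumes "u \<in> Sk v" "w \<in> Sk v"
  shows "nat_comb w (\<lambda>h. - b_of u x h) \<longleftrightarrow> \<not> nat_comb w (b_of u x)"
  using sign[OF assms, of x] nat_comb_not_neg[OF Sk_rd[OF assms(2)] Sk_rd[OF assms(1)], of x] by blast

text \<open>Passing from \<open>u\<close> to its reflexion changes only the coordinate at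
  \<open>x\<close>. A root positive before and negative after has all other coordinates both
  nonnegative and nonpositive, so it is a multiple of \<open>b_of u x\<close>.\<close>

lemma sign_reflexion:
  assumes u: "u \<in> Sk v" and q: "q \<in> Sk v" and x: "reflectable u x"
    and pos: "nat_comb u (b_of q z)" and neg: "\<not> nat_comb (reflexion x u) (b_of q z)"
  shows "b_of q z = b_of u x"
proof -
  note ru = Sk_rd[OF u] and rq = Sk_rd[OF q]
  obtain n where n: "b_of q z = (\<lambda>h. \<Sum>y\<in>UNIV. of_nat (n y) * b_of u y h)"
    using pos unfolding nat_comb_def by blast
  have "nat_comb (reflexion x u) (\<lambda>h. - b_of q z h)"
    using neg sign_iff[OF q Sk_reflexion[OF u x]] by blast
  then obtain m where "(\<lambda>h. - b_of q z h) = (\<lambda>h. \<Sum>y\<in>UNIV. of_nat (m y) * b_of (reflexion x u) y h)"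
    unfolding nat_comb_def by blast
  from fun_cong[OF this] have m: "- b_of q z h = (\<Sum>y\<in>UNIV. of_nat (m y) * b_of (reflexion x u) y h)" for h .
  let ?m = "\<lambda>y. if y = x then (\<Sum>z\<in>UNIV - {x}. of_nat (m z) * b_coef u x z) - of_nat (m x) else of_nat (m y)"
  have "module ((*) :: complex \<Rightarrow> complex \<Rightarrow> complex)"
    by unfold_locales (auto simp: algebra_simps)
  from sum_triangular_change[OF this, of "\<lambda>y. of_nat (m y)" x "\<lambda>y. b_of u y _" "b_coef u x"]
  have m': "- b_of q z h = (\<Sum>y\<in>UNIV. ?m y * b_of u y h)" for h
    using m[of h] by (simp only: b_reflexion)
  have "(\<Sum>y\<in>UNIV. of_nat (n y) * b_of u y h) = (\<Sum>y\<in>UNIV. (- ?m y) * b_of u y h)" for h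
  proof -
    have "(\<Sum>y\<in>UNIV. (- ?m y) * b_of u y h) = b_of q z h"
      by (simp only: mult_minus_left sum_negf m'[symmetric] minus_minus)
    then show ?thesis using fun_cong[OF n, of h] by (simp only:)
  qed
  from b_independent[OF ru this] have nm: "of_nat (n y) = - ?m y" for y by (rule fun_cong)
  have "n y = 0" if "y \<noteq> x" for y
  proof -
    have "of_nat (n y + m y) = (0 :: complex)" using nm[of y] that by simp
    then show ?thesis by (simp only: of_nat_eq_0_iff)
  qed
  then have bq: "b_of q z h = of_nat (n x) * b_of u x h" for h
    unfolding n by (subst sum.remove[of _ x]) auto
  have unit: "b_of q z h = (\<Sum>y\<in>UNIV. (if y = z then 1 else 0) * b_of q y h)" for h
    by (simp only: sum_delta_mult)
  consider k where "b_of u x = (\<lambda>h. \<Sum>y\<in>UNIV. of_nat (k y) * b_of q y h)"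
    | k where "(\<lambda>h. - b_of u x h) = (\<lambda>h. \<Sum>y\<in>UNIV. of_nat (k y) * b_of q y h)"
    using sign[OF u q, of x] unfolding nat_comb_def by blast
  \<comment> \<open>The multiple is 1 since \<open>b_of u x\<close> is in turn an integral
    combination at \<open>q\<close>: comparing coordinates at \<open>z\<close> gives
    \<open>n x * k z = 1\<close>, or the impossible \<open>n x * k z + 1 = 0\<close>.\<close>
  then have "n x = 1"
  proof cases
    case 1
    have "(\<Sum>y\<in>UNIV. of_nat (n x * k y) * b_of q y h) = (\<Sum>y\<in>UNIV. (if y = z then 1 else 0) * b_of q y h)" for h
      unfolding unit[symmetric] bq fun_cong[OF 1] by (simp add: sum_distrib_left mult.assoc)
    from fun_cong[OF b_independent[OF rq this], of z] have "of_nat (n x * k z) = (of_nat 1 :: complex)"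
      by simp
    then show ?thesis by (simp only: of_nat_eq_iff) simp
  next
    case 2
    have "(\<Sum>y\<in>UNIV. of_nat (n x * k y) * b_of q y h) = (\<Sum>y\<in>UNIV. (- (if y = z then 1 else 0)) * b_of q y h)" for h
    proof -
      have "(\<Sum>y\<in>UNIV. of_nat (n x * k y) * b_of q y h) = of_nat (n x) * (- b_of u x h)"
        unfolding fun_cong[OF 2] by (simp add: sum_distrib_left mult.assoc)
      then show ?thesis using bq[of h] by (simp only: mult_minus_left sum_negf sum_delta_mult) simp
    qed
    from fun_cong[OF b_independent[OF rq this], of z] have "of_nat (n x * k z + 1) = (0 :: complex)"
      by simp
    then show ?thesis by (simp only: of_nat_eq_0_iff)
  qed
  then show ?thesis using bq by auto
qed

text \<open>Only \<open>b_of u x\<close> could lose its positivity. By proportionality of coroots,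
  vanishing of the diagonal Cartan entry depends on the root alone, so \<open>b_of q z\<close> is a
  different root.\<close>

lemma sign_iso_reflexion_imp:
  assumes u: "u \<in> Sk v" and q: "q \<in> Sk v" and x: "iso u x" and z: "cartan q z z \<noteq> 0"
    and pos: "nat_comb u (b_of q z)"
  shows "nat_comb (reflexion x u) (b_of q z)"
proof (rule ccontr)
  assume neg: "\<not> ?thesis"
  have eq: "b_of q z = b_of u x"
    using sign_reflexion[OF u q _ pos neg] x by (simp add: iso_def)
  obtain c where "a_of q z = c *\<^sub>C a_of u x" using coroot[OF q u eq] by blast
  then have "cartan q z z = c * cartan u x x"
    using b_linear(2)[OF Sk_rd[OF u] root_datumD(2)[OF Sk_rd[OF u]]] eq by (simp add: cartan_def)
  then show False using z x by (simp add: iso_def)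
qed

lemma iso_reflexion: "u \<in> Sk v \<Longrightarrow> iso u x \<Longrightarrow> iso (reflexion x u) x"
  using reflectable_reflexion[OF Sk_rd] cartan_reflexion_iso(1)[OF Sk_rd] by (simp add: iso_def)

lemma sign_iso_reflexion:
  assumes u: "u \<in> Sk v" and q: "q \<in> Sk v" and x: "iso u x" and z: "cartan q z z \<noteq> 0"
  shows "nat_comb (reflexion x u) (b_of q z) \<longleftrightarrow> nat_comb u (b_of q z)"
proof
  assume "nat_comb (reflexion x u) (b_of q z)"
  then show "nat_comb u (b_of q z)"
    using sign_iso_reflexion_imp[OF Sk_reflexion[OF u, of x] q iso_reflexion[OF u x] z] x
    by (simp add: reflexion_reflexion[OF Sk_rd[OF u]] iso_def)
qed (rule sign_iso_reflexion_imp[OF assms])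

lemma Sp_Sk: "u \<in> Sp v \<Longrightarrow> u \<in> Sk v"
  by (induction rule: Sp.induct) (auto intro: Sk_self Sk_reflexion)

lemma sign_Sp:
  assumes "u \<in> Sp v" "q \<in> Sk v" "cartan q z z \<noteq> 0"
  shows "nat_comb u (b_of q z) \<longleftrightarrow> nat_comb v (b_of q z)"
  using assms(1)
proof (induction rule: Sp.induct)
  case (step u x)
  then show ?case using sign_iso_reflexion[OF Sp_Sk assms(2) _ assms(3), of u x] by (simp add: iso_def)
qed simp

section \<open>Words in reflections and their action on the skeleton\<close>

lemma sim_refl:
  assumes "u \<in> Sk v" "aniso u x"
  shows "sim (root_reflection u x) (\<lambda>_. 1) u (reflexion x u)"
    "sim (root_reflection u x) (\<lambda>_. 1) (reflexion x u) u"
    "root_reflection u x \<in> lin_isos S S"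
    "root_reflection u x \<otimes>\<^bsub>G\<^esub> root_reflection u x = \<one>\<^bsub>G\<^esub>"
proof -
  have n: "cartan u x x \<noteq> 0" using assms(2) by (simp add: aniso_def)
  note r = Sk_rd[OF assms(1)]
  show s: "sim (root_reflection u x) (\<lambda>_. 1) u (reflexion x u)"
    by (rule sim_root_reflection[OF r n])
  from sim_reflexion[OF s, of x] show "sim (root_reflection u x) (\<lambda>_. 1) (reflexion x u) u"
    by (simp add: reflexion_reflexion[OF r])
  show "root_reflection u x \<in> lin_isos S S"
    using simD(3)[OF s] Sk_space[OF assms(1)] by simp
  show "root_reflection u x \<otimes>\<^bsub>G\<^esub> root_reflection u x = \<one>\<^bsub>G\<^esub>"
    using root_reflection_involution[OF r n] Sk_space[OF assms(1)] by simp
qed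

lemma sim_mult:
  assumes "sim \<gamma> d u w" "sim \<delta> e w z" "space u = S" "space w = S" "space z = S"
  shows "sim (\<delta> \<otimes>\<^bsub>G\<^esub> \<gamma>) (\<lambda>x. d x * e x) u z"
  using sim_compose[OF assms(1,2)] simD(3)[OF assms(1)] simD(3)[OF assms(2)] assms(3-5)
  by (simp add: GL_simps)

lemma sim_mult_exact:
  assumes "sim \<gamma> (\<lambda>_. 1) u w" "sim \<delta> (\<lambda>_. 1) w z" "space u = S" "space w = S" "space z = S"
  shows "sim (\<delta> \<otimes>\<^bsub>G\<^esub> \<gamma>) (\<lambda>_. 1) u z"
  using sim_mult[OF assms] by simp

lemma root_reflection_eq:
  assumes u: "u \<in> Sk v" and w: "w \<in> Sk v" and n: "aniso u x" "aniso w y" and eq: "b_of u x = b_of w y"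
  shows "root_reflection u x = root_reflection w y"
proof -
  obtain c where c: "c \<noteq> 0" "a_of u x = c *\<^sub>C a_of w y" using coroot[OF u w eq] by blast
  have "cartan u x x = c * cartan w y y"
    using b_linear(2)[OF Sk_rd[OF w] root_datumD(2)[OF Sk_rd[OF w]]] eq c by (simp add: cartan_def)
  then have "(2 / cartan u x x) *\<^sub>C a_of u x = (2 / cartan w y y) *\<^sub>C a_of w y"
    using c n by (simp add: aniso_def)
  then show ?thesis
    using eq Sk_space[OF u] Sk_space[OF w] by (simp add: root_reflection_def)
qed

text \<open>Products of \<open>k\<close> reflections in principal anisotropic roots, i.e. in those of the form
  \<open>b_of u x\<close> with \<open>u \<in> Sp v\<close>; they play the role of the simple reflections of a Coxeter group.\<close>

inductive word :: "nat \<Rightarrow> ('b \<Rightarrow> 'b) \<Rightarrow> bool" where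
  Nil: "word 0 \<one>\<^bsub>G\<^esub>"
| Snoc: "word k w \<Longrightarrow> u \<in> Sp v \<Longrightarrow> aniso u x \<Longrightarrow> word (Suc k) (w \<otimes>\<^bsub>G\<^esub> root_reflection u x)"

lemma word_carrier: "word k w \<Longrightarrow> w \<in> carrier G"
proof (induction rule: word.induct)
  case (Snoc k w u x)
  then have "root_reflection u x \<in> carrier G"
    using sim_refl(3)[OF Sp_Sk] by (simp add: GL_simps)
  with Snoc show ?case by simp
qed simp

lemma refl_carrier: "u \<in> Sk v \<Longrightarrow> aniso u x \<Longrightarrow> root_reflection u x \<in> carrier G"
  using sim_refl(3) by (simp add: GL_simps)

lemma word_left:
  assumes "u \<in> Sp v" "aniso u x"
  shows "word k w \<Longrightarrow> word (Suc k) (root_reflection u x \<otimes>\<^bsub>G\<^esub> w)"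
proof (induction rule: word.induct)
  case Nil
  show ?case using word.Snoc[OF word.Nil assms] refl_carrier[OF Sp_Sk[OF assms(1)] assms(2)] by simp
next
  case (Snoc k w u' x')
  then show ?case
    using word.Snoc[OF Snoc.IH Snoc.hyps(2,3)] word_carrier refl_carrier Sp_Sk assms
    by (simp add: G.m_assoc)
qed

lemma word_left_decomp:
  "word (Suc k) w \<Longrightarrow> \<exists>u x w'. u \<in> Sp v \<and> aniso u x \<and> word k w' \<and> w = root_reflection u x \<otimes>\<^bsub>G\<^esub> w'"
proof (induction k arbitrary: w)
  case 0
  then obtain u x where "u \<in> Sp v" "aniso u x" "w = \<one>\<^bsub>G\<^esub> \<otimes>\<^bsub>G\<^esub> root_reflection u x"
    by (auto elim!: word.cases)
  moreover from this have "root_reflection u x \<in> carrier G"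
    by (intro refl_carrier Sp_Sk)
  ultimately show ?case using word.Nil by (intro exI[of _ u] exI[of _ x] exI[of _ "\<one>\<^bsub>G\<^esub>"]) simp
next
  case (Suc k)
  from Suc.prems obtain w0 q y where w0: "word (Suc k) w0" "q \<in> Sp v" "aniso q y"
    "w = w0 \<otimes>\<^bsub>G\<^esub> root_reflection q y"
    by (cases rule: word.cases) auto
  from Suc.IH[OF w0(1)] obtain u x w' where u: "u \<in> Sp v" "aniso u x" "word k w'"
    "w0 = root_reflection u x \<otimes>\<^bsub>G\<^esub> w'" by blast
  have "w = root_reflection u x \<otimes>\<^bsub>G\<^esub> (w' \<otimes>\<^bsub>G\<^esub> root_reflection q y)"
    using w0 u word_carrier refl_carrier Sp_Sk by (simp add: G.m_assoc)
  then show ?case using u word.Snoc[OF u(3) w0(2,3)] by blast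
qed

text \<open>\<open>u\<close> and \<open>reflexion x u\<close> both lie in the skeleton, so the chain
  from either of them to \<open>q\<close> can be carried along the reflection. Producing a source as
  well as a target replaces the use of inverses.\<close>

lemma refl_moves:
  assumes u: "u \<in> Sk v" "aniso u x" and q: "q \<in> Sk v"
  shows "\<exists>q'\<in>Sk v. sim (root_reflection u x) (\<lambda>_. 1) q q'"
    and "\<exists>q'\<in>Sk v. sim (root_reflection u x) (\<lambda>_. 1) q' q"
proof -
  have r: "reflexion x u \<in> Sk v" using u by (intro Sk_reflexion) (auto simp: aniso_def)
  have qu: "q \<in> Sk u" "q \<in> Sk (reflexion x u)"
    using Sk_trans[OF Sk_sym[OF rd u(1)] q] Sk_trans[OF Sk_sym[OF rd r] q] by auto
  show "\<exists>q'\<in>Sk v. sim (root_reflection u x) (\<lambda>_. 1) q q'"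
    using Sk_sim[OF qu(1) sim_refl(1)[OF u]] Sk_trans[OF r] by blast
  show "\<exists>q'\<in>Sk v. sim (root_reflection u x) (\<lambda>_. 1) q' q"
    using Sk_sim_back[OF qu(2) sim_refl(1)[OF u]] Sk_trans[OF u(1)] by blast
qed

lemma word_moves:
  assumes "word k w"
  shows "q \<in> Sk v \<Longrightarrow> \<exists>q'\<in>Sk v. sim w (\<lambda>_. 1) q q'"
    and "q \<in> Sk v \<Longrightarrow> \<exists>q'\<in>Sk v. sim w (\<lambda>_. 1) q' q"
  using assms
proof (induction arbitrary: q rule: word.induct)
  case Nil
  have "sim \<one>\<^bsub>G\<^esub> (\<lambda>_. 1) q q" if "q \<in> Sk v" for q
    using sim_id[OF Sk_rd[OF that]] Sk_space[OF that] by (simp add: GL_simps)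
  {
    case 1 then show ?case using \<open>\<And>q. q \<in> Sk v \<Longrightarrow> sim \<one>\<^bsub>G\<^esub> (\<lambda>_. 1) q q\<close> by blast
  next
    case 2 then show ?case using \<open>\<And>q. q \<in> Sk v \<Longrightarrow> sim \<one>\<^bsub>G\<^esub> (\<lambda>_. 1) q q\<close> by blast
  }
next
  case (Snoc k w u x)
  note u = Sp_Sk[OF Snoc.hyps(2)] Snoc.hyps(3)
  {
    case 1
    then obtain q1 where q1: "q1 \<in> Sk v" "sim (root_reflection u x) (\<lambda>_. 1) q q1"
      using refl_moves(1)[OF u] by blast
    then obtain q2 where "q2 \<in> Sk v" "sim w (\<lambda>_. 1) q1 q2" using Snoc.IH(1) by blast
    then show ?case using sim_mult_exact[OF q1(2)] q1(1) 1 Sk_space by blast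
  next
    case 2
    then obtain q1 where q1: "q1 \<in> Sk v" "sim w (\<lambda>_. 1) q1 q" using Snoc.IH(2) by blast
    then obtain q2 where "q2 \<in> Sk v" "sim (root_reflection u x) (\<lambda>_. 1) q2 q1"
      using refl_moves(2)[OF u] by blast
    then show ?case using sim_mult_exact[OF _ q1(2)] q1(1) 2 Sk_space by blast
  }
qed

text \<open>As \<open>w\<close> carries \<open>u1\<close> to \<open>u\<close>, the root
  \<open>b_of u1 x\<close> is the image of \<open>b_of u x\<close> under the inverse of
  \<open>w\<close>; vertices serve to name such roots. If it is negative, stripping reflections off
  the right end of \<open>w\<close> reaches one that changes the sign, and that one is cancelled by
  the reflection of \<open>b_of u x\<close>.\<close>

lemma word_exchange:
  assumes u: "u \<in> Sp v" "aniso u x"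
  shows "word k w \<Longrightarrow> u1 \<in> Sk v \<Longrightarrow> sim w (\<lambda>_. 1) u1 u \<Longrightarrow> \<not> nat_comb v (b_of u1 x) \<Longrightarrow>
    \<exists>j. Suc j = k \<and> word j (root_reflection u x \<otimes>\<^bsub>G\<^esub> w)"
proof (induction arbitrary: u1 rule: word.induct)
  case Nil
  note uS = Sp_Sk[OF u(1)]
  have "sim \<one>\<^bsub>G\<^esub> (\<lambda>_. 1) u u"
    using sim_id[OF Sk_rd[OF uS]] Sk_space[OF uS] by (simp add: GL_simps)
  then have "u1 = u"
    using sim_exact_unique_source Nil.prems Sk_space[OF uS] Sk_space[OF Nil.prems(1)] by metis
  moreover have "nat_comb v (b_of u x)"
    using sign_Sp[OF u(1) uS] nat_comb_self[of u x] u(2) by (auto simp: aniso_def)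
  ultimately show ?case using Nil.prems by blast
next
  case (Snoc k w q y)
  note uS = Sp_Sk[OF u(1)] and qS = Sp_Sk[OF Snoc.hyps(2)]
  let ?s = "root_reflection u x" and ?t = "root_reflection q y"
  note car = refl_carrier[OF uS u(2)] refl_carrier[OF qS Snoc.hyps(3)] word_carrier[OF Snoc.hyps(1)]
  obtain u2 where u2: "u2 \<in> Sk v" "sim w (\<lambda>_. 1) u2 u"
    using word_moves(2)[OF Snoc.hyps(1) uS] by blast
  obtain u1' where u1': "u1' \<in> Sk v" "sim ?t (\<lambda>_. 1) u1' u2"
    using refl_moves(2)[OF qS Snoc.hyps(3) u2(1)] by blast
  have "sim (w \<otimes>\<^bsub>G\<^esub> ?t) (\<lambda>_. 1) u1' u"
    by (rule sim_mult_exact[OF u1'(2) u2(2) Sk_space[OF u1'(1)] Sk_space[OF u2(1)] Sk_space[OF uS]])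
  then have eq: "u1' = u1"
    using sim_exact_unique_source Snoc.prems(2) Sk_space[OF u1'(1)] Sk_space[OF Snoc.prems(1)] by metis
  note t = u1'(2)[unfolded eq]
  have an2: "aniso u2 x" using sim_aniso[OF u2(2)] u(2) by blast
  then have n2: "cartan u2 x x \<noteq> 0" by (simp add: aniso_def)
  show ?case
  proof (cases "nat_comb v (b_of u2 x)")
    case False
    then obtain j where j: "Suc j = k" "word j (?s \<otimes>\<^bsub>G\<^esub> w)" using Snoc.IH[OF u2] by blast
    have "word (Suc j) ((?s \<otimes>\<^bsub>G\<^esub> w) \<otimes>\<^bsub>G\<^esub> ?t)" by (rule word.Snoc[OF j(2) Snoc.hyps(2,3)])
    then show ?thesis using car j(1) by (simp add: G.m_assoc)
  next
    case True
    \<comment> \<open>The sign is moved from \<open>v\<close> to \<open>q\<close>, where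
      \<open>b_of q y\<close> is simple; both vertices lie in \<open>Sp v\<close> and the root is
      anisotropic.\<close>
    have "nat_comb q (b_of u2 x)" using True sign_Sp[OF Snoc.hyps(2) u2(1) n2] by blast
    moreover have "\<not> nat_comb (reflexion y q) (b_of u2 x)"
    proof
      assume "nat_comb (reflexion y q) (b_of u2 x)"
      \<comment> \<open>The reflection \<open>?t\<close> carries \<open>q\<close> to
        \<open>reflexion y q\<close> and \<open>u1\<close> to \<open>u2\<close>, so positivity is
        pulled back along it.\<close>
      then have "nat_comb q (b_of u1 x)"
        using nat_comb_transport[OF sim_refl(1)[OF qS Snoc.hyps(3)] t] Sk_space[OF qS]
          Sk_space[OF Snoc.prems(1)] by simp
      moreover have "cartan u1 x x \<noteq> 0" using n2 sim_cartan[OF t] by simp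
      ultimately show False
        using sign_Sp[OF Snoc.hyps(2) Snoc.prems(1)] Snoc.prems(3) by blast
    qed
    ultimately have "b_of u2 x = b_of q y"
      using sign_reflexion[OF qS u2(1)] Snoc.hyps(3) by (auto simp: aniso_def)
    then have st: "root_reflection u2 x = ?t"
      by (rule root_reflection_eq[OF u2(1) qS an2 Snoc.hyps(3)])
    have "w \<otimes>\<^bsub>G\<^esub> ?t = ?s \<otimes>\<^bsub>G\<^esub> w"
      using sim_conjugates_root_reflection[OF u2(2) _ n2] Sk_space[OF uS] Sk_space[OF u2(1)] st by simp
    then have "(?s \<otimes>\<^bsub>G\<^esub> w) \<otimes>\<^bsub>G\<^esub> ?t = (w \<otimes>\<^bsub>G\<^esub> ?t) \<otimes>\<^bsub>G\<^esub> ?t" by (simp only:)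
    then have "?s \<otimes>\<^bsub>G\<^esub> (w \<otimes>\<^bsub>G\<^esub> ?t) = w \<otimes>\<^bsub>G\<^esub> (?t \<otimes>\<^bsub>G\<^esub> ?t)"
      using car by (simp only: G.m_assoc G.m_closed)
    also have "\<dots> = w" using car sim_refl(4)[OF qS Snoc.hyps(3)] by simp
    finally show ?thesis using Snoc.hyps(1) by simp
  qed
qed

text \<open>Take a shortest word and write \<open>w = s w'\<close>. The inverses of \<open>w\<close>
  and \<open>w'\<close> send the simple root of \<open>s\<close> to opposite roots. If the first is
  positive then the second is negative, and exchange writes \<open>s w'\<close> with fewer
  reflections than \<open>w'\<close>.\<close>

lemma word_trivial:
  assumes "word k w"
    and pos: "\<And>u x u1. u \<in> Sk v \<Longrightarrow> u1 \<in> Sk v \<Longrightarrow> aniso u x \<Longrightarrow> nat_comb v (b_of u x) \<Longrightarrow>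
      sim w (\<lambda>_. 1) u1 u \<Longrightarrow> nat_comb v (b_of u1 x)"
  shows "w = \<one>\<^bsub>G\<^esub>"
proof -
  define n where "n = (LEAST n. word n w)"
  have n: "word n w" unfolding n_def using assms(1) by (rule LeastI)
  have least: "n \<le> j" if "word j w" for j unfolding n_def using that by (rule Least_le)
  show ?thesis
  proof (cases n)
    case 0
    then show ?thesis using n by (auto elim: word.cases)
  next
    case (Suc m)
    then obtain u x w' where u: "u \<in> Sp v" "aniso u x" "word m w'" "w = root_reflection u x \<otimes>\<^bsub>G\<^esub> w'"
      using word_left_decomp n by blast
    note uS = Sp_Sk[OF u(1)]
    have rS: "reflexion x u \<in> Sk v" using uS u(2) by (intro Sk_reflexion) (auto simp: aniso_def)
    \<comment> \<open>\<open>u1\<close> and \<open>u2\<close> name the images of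
      \<open>b_of u x\<close> under the inverses of \<open>w\<close> and \<open>w'\<close>: the map
      \<open>w'\<close> carries them to \<open>reflexion x u\<close> and \<open>u\<close>, whose
      entries at \<open>x\<close> are opposite.\<close>
    obtain u1 where u1: "u1 \<in> Sk v" "sim w' (\<lambda>_. 1) u1 (reflexion x u)"
      using word_moves(2)[OF u(3) rS] by blast
    obtain u2 where u2: "u2 \<in> Sk v" "sim w' (\<lambda>_. 1) u2 u"
      using word_moves(2)[OF u(3) uS] by blast
    have "sim w (\<lambda>_. 1) u1 u"
      unfolding u(4)
      by (rule sim_mult_exact[OF u1(2) sim_refl(2)[OF uS u(2)] Sk_space[OF u1(1)] Sk_space[OF rS] Sk_space[OF uS]])
    moreover have "nat_comb v (b_of u x)"
      using sign_Sp[OF u(1) uS] nat_comb_self[of u x] u(2) by (auto simp: aniso_def)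
    ultimately have "nat_comb v (b_of u1 x)" using pos[OF uS u1(1) u(2)] by blast
    moreover have "b_of u1 x = (\<lambda>h. - b_of u2 x h)"
    proof
      fix h show "b_of u1 x h = - b_of u2 x h"
      proof (cases "h \<in> S")
        case True
        then show ?thesis
          using simD(6)[OF u1(2), of h x] simD(6)[OF u2(2), of h x] Sk_space[OF u1(1)] Sk_space[OF u2(1)]
          by (simp add: b_reflexion)
      next
        case False
        then show ?thesis
          using b_linear(3)[OF Sk_rd[OF u1(1)]] b_linear(3)[OF Sk_rd[OF u2(1)]]
            Sk_space[OF u1(1)] Sk_space[OF u2(1)] by simp
      qed
    qed
    ultimately have "\<not> nat_comb v (b_of u2 x)" using sign_iff[OF u2(1) Sk_self] by simp
    then obtain j where "Suc j = m" "word j w"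
      using word_exchange[OF u(1,2,3) u2] u(4) by blast
    then show ?thesis using least[of j] Suc by simp
  qed
qed

text \<open>A reflexion at \<open>w(u')\<close> is the image under \<open>w\<close> of the one at
  \<open>u'\<close> with the same name. If that is isotropic, \<open>u'\<close> moves within
  \<open>Sp v\<close>; if not, it is a reflection applied to \<open>u'\<close>, which is appended to
  the word on the right.\<close>

lemma Sk_decomp: "u \<in> Sk v \<Longrightarrow> \<exists>k w u'. word k w \<and> u' \<in> Sp v \<and> sim w (\<lambda>_. 1) u' u"
proof -
  have "\<exists>k w u'. word k w \<and> u' \<in> Sp v \<and> sim w (\<lambda>_. 1) u' u" if "chain v xs u" for xs
    using that
  proof (induction xs arbitrary: u rule: rev_induct)
    case Nil
    then show ?case using word.Nil Sp.base sim_id[OF rd] by (auto simp: GL_simps)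
  next
    case (snoc x xs)
    then obtain u0 where u0: "chain v xs u0" "reflectable u0 x" "u = reflexion x u0"
      by (auto simp: chain_append)
    from snoc.IH[OF u0(1)] obtain k w u' where w: "word k w" "u' \<in> Sp v" "sim w (\<lambda>_. 1) u' u0" by blast
    have ref: "reflectable u' x" using sim_reflectable[OF w(3)] u0(2) by simp
    have s: "sim w (\<lambda>_. 1) (reflexion x u') u" unfolding u0(3) by (rule sim_reflexion[OF w(3)])
    show ?case
    proof (cases "cartan u' x x = 0")
      case True
      then show ?thesis using w(1) Sp.step[OF w(2) ref] s by blast
    next
      case False
      then have an: "aniso u' x" using ref by (simp add: aniso_def)
      note u'S = Sp_Sk[OF w(2)]
      have "space u = S" using chain_space[OF snoc.prems] .
      then have "sim (w \<otimes>\<^bsub>G\<^esub> root_reflection u' x) (\<lambda>_. 1) u' u"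
        using sim_mult_exact[OF sim_refl(1)[OF u'S an] s] Sk_space[OF u'S] by simp
      then show ?thesis using word.Snoc[OF w(1,2) an] w(2) by blast
    qed
  qed
  then show "u \<in> Sk v \<Longrightarrow> ?thesis" unfolding Sk_def by blast
qed

end

section \<open>Exchange for isotropic reflexions\<close>

lemma reflexion_commute:
  assumes v: "root_datum v" and xy: "x \<noteq> y" "cartan v x x = 0" "cartan v y y = 0"
    "cartan v x y = 0" "cartan v y x = 0"
  shows "reflexion x (reflexion y v) = reflexion y (reflexion x v)"
proof -
  have b: "b_coef v x y = 0" "b_coef v y x = 0" "a_coef v x y = 0" "a_coef v y x = 0"
    using xy by (auto simp: b_coef_def a_coef_def)
  have c: "cartan (reflexion y v) x z = cartan v x z" "cartan (reflexion y v) z x = cartan v z x"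
    "cartan (reflexion x v) y z = cartan v y z" "cartan (reflexion x v) z y = cartan v z y"
    if "z \<noteq> x" "z \<noteq> y" for z
    using xy that b by (auto simp: cartan_reflexion[OF v])
  have c0: "cartan (reflexion y v) x x = 0" "cartan (reflexion x v) y y = 0"
    "cartan (reflexion y v) x y = 0" "cartan (reflexion x v) y x = 0"
    "cartan (reflexion y v) y x = 0" "cartan (reflexion x v) x y = 0"
    using xy b by (auto simp: cartan_reflexion[OF v])
  have co: "a_coef (reflexion y v) x z = (if z = y then 0 else if z = x then a_coef v x x else a_coef v x z)"
    "b_coef (reflexion y v) x z = (if z = y then 0 else if z = x then b_coef v x x else b_coef v x z)"
    "a_coef (reflexion x v) y z = (if z = x then 0 else if z = y then a_coef v y y else a_coef v y z)"
    "b_coef (reflexion x v) y z = (if z = x then 0 else if z = y then b_coef v y y else b_coef v y z)" for z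
    using xy c[of z] c0 by (auto simp: a_coef_def b_coef_def)
  show ?thesis
  proof (rule rdatum_eqI)
    show "p_of (reflexion x (reflexion y v)) z = p_of (reflexion y (reflexion x v)) z" for z
      using xy c0 c[of z] by (auto simp: p_reflexion)
  qed (use xy in \<open>auto simp: a_reflexion b_reflexion co b\<close>)
qed

context admissible_datum
begin

inductive iso_path :: "nat \<Rightarrow> ('b, 'x) rdatum \<Rightarrow> bool" where
  start: "iso_path 0 v"
| step: "iso_path n u \<Longrightarrow> iso u x \<Longrightarrow> iso_path (Suc n) (reflexion x u)"

lemma iso_path_Sp: "iso_path n u \<Longrightarrow> u \<in> Sp v"
  by (induction rule: iso_path.induct) (auto simp: iso_def intro: Sp.intros)

lemma Sp_iso_path: "u \<in> Sp v \<Longrightarrow> \<exists>n. iso_path n u"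
proof (induction rule: Sp.induct)
  case (step u x)
  then show ?case using iso_path.step by (auto simp: iso_def)
qed (use iso_path.start in blast)

text \<open>If \<open>a_xy \<noteq> 0\<close>, then \<open>b_u x + b_u y\<close> is a root \<open>b_w y\<close> with \<open>a_yy \<noteq> 0\<close>, whose sign does not
  change under isotropic reflexions.\<close>

lemma iso_negative_orthogonal:
  assumes u: "u \<in> Sp v" "iso u x" "iso u y" "x \<noteq> y"
    and neg: "\<not> nat_comb v (b_of u x)" "\<not> nat_comb v (b_of u y)"
  shows "cartan u x y = 0"
proof (rule ccontr)
  assume n: "cartan u x y \<noteq> 0"
  note uS = Sp_Sk[OF u(1)]
  have n': "cartan u y x \<noteq> 0" using wsym[OF uS, of y x] u(3) n by (auto simp: iso_def)
  let ?w = "reflexion x u"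
  have wS: "?w \<in> Sk v" using uS u(2) by (intro Sk_reflexion) (auto simp: iso_def)
  have "cartan ?w y y = 2 * cartan u y x"
    using u(2-4) n by (simp add: cartan_reflexion[OF Sk_rd[OF uS]] iso_def a_coef_def b_coef_def)
  then have an: "cartan ?w y y \<noteq> 0" using n' by simp
  have bw: "b_of ?w y = (\<lambda>h. b_of u y h + b_of u x h)"
    using u(2,4) n by (auto simp: b_reflexion b_coef_def iso_def)
  have "nat_comb u (b_of ?w y)"
    unfolding bw by (intro nat_comb_add nat_comb_self)
  then have "nat_comb v (b_of ?w y)"
    using sign_Sp[OF u(1) wS an] by blast
  moreover have "nat_comb v (\<lambda>h. - b_of ?w y h)"
    using nat_comb_add[of v "\<lambda>h. - b_of u y h" "\<lambda>h. - b_of u x h"] neg sign_iff[OF uS Sk_self]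
    by (simp add: bw)
  ultimately show False using sign_iff[OF wS Sk_self] by blast
qed

text \<open>Let \<open>y\<close> be the last step of the path, from \<open>u\<close> to
  \<open>?w\<close>, and \<open>x \<noteq> y\<close>. If \<open>b_of ?w y\<close> is positive, then
  \<open>b_of u y\<close> was negative, and the induction hypothesis gives \<open>?w\<close> a path
  shorter by two. If it is negative, \<open>x\<close> and \<open>y\<close> are orthogonal at
  \<open>?w\<close> and the exchange is made one step earlier.\<close>

lemma iso_exchange:
  "iso_path n u \<Longrightarrow> iso u x \<Longrightarrow> \<not> nat_comb v (b_of u x) \<Longrightarrow>
    \<exists>m. Suc m = n \<and> iso_path m (reflexion x u)"
proof (induction arbitrary: x rule: iso_path.induct)
  case start
  then show ?case using nat_comb_self by blast
next
  case (step n u y)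
  note uS = Sp_Sk[OF iso_path_Sp[OF step.hyps(1)]]
  let ?w = "reflexion y u"
  have wp: "iso_path (Suc n) ?w" by (rule iso_path.step[OF step.hyps])
  note wS = Sp_Sk[OF iso_path_Sp[OF wp]]
  have wy: "iso ?w y" by (rule iso_reflexion[OF uS step.hyps(2)])
  have ww: "reflexion y ?w = u" by (rule reflexion_reflexion[OF Sk_rd[OF uS]])
  show ?case
  proof (cases "x = y")
    case True
    then show ?thesis using ww step.hyps(1) by simp
  next
    case xy: False
    show ?thesis
    proof (cases "nat_comb v (b_of ?w y)")
      case True
      have "b_of ?w y = (\<lambda>h. - b_of u y h)" by (auto simp: b_reflexion)
      then have "\<not> nat_comb v (b_of u y)" using True sign_iff[OF uS Sk_self, of y] by simp
      then obtain m where "Suc m = n" "iso_path m ?w" using step.IH[OF step.hyps(2)] by blast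
      then show ?thesis using iso_path.step[OF _ step.prems(1)] by blast
    next
      case False
      have z1: "cartan ?w x y = 0"
        by (rule iso_negative_orthogonal[OF iso_path_Sp[OF wp] step.prems(1) wy xy step.prems(2) False])
      then have z2: "cartan ?w y x = 0"
        using wsym[OF wS] step.prems(1) by (auto simp: iso_def)
      have cx: "cartan ?w x x = 0" and cy: "cartan ?w y y = 0" and p: "p_of ?w x = 1" "p_of ?w y = 1"
        using step.prems(1) wy by (auto simp: iso_def reflectable_def)
      have bx: "b_of u x = b_of ?w x"
      proof
        have "b_coef ?w y x = 0" using z2 cy by (simp add: b_coef_def)
        then show "b_of u x h = b_of ?w x h" for h
          using b_reflexion[of y ?w x h] ww xy by simp
      qed
      have "cartan u x x = 0"
        using cartan_reflexion[OF Sk_rd[OF wS], of y x x] ww xy z1 z2 cx cy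
        by (simp add: a_coef_def b_coef_def)
      moreover have "p_of u x = 1"
        using p_reflexion[of y ?w x] ww z2 p by simp
      ultimately have iu: "iso u x" by (simp add: iso_def reflectable_def)
      obtain m where m: "Suc m = n" "iso_path m (reflexion x u)"
        using step.IH[OF iu] step.prems(2) bx by auto
      \<comment> \<open>The orthogonal reflexions form a commuting square, so the shorter path to
        \<open>reflexion x u\<close> is continued by \<open>y\<close> and ends at
        \<open>reflexion x ?w\<close>.\<close>
      have comm: "reflexion y (reflexion x ?w) = reflexion x u"
        using reflexion_commute[OF Sk_rd[OF wS] xy cx cy z1 z2] ww by simp
      have xwS: "reflexion x ?w \<in> Sk v"
        using step.prems(1) by (intro Sk_reflexion[OF wS]) (simp add: iso_def)
      have "cartan (reflexion x ?w) y y = 0"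
        using xy z1 z2 cx cy by (simp add: cartan_reflexion[OF Sk_rd[OF wS]] a_coef_def b_coef_def)
      moreover have "p_of (reflexion x ?w) y = 1"
        using z1 p by (simp add: p_reflexion)
      ultimately have "iso (reflexion x ?w) y" by (simp add: iso_def reflectable_def)
      from iso_reflexion[OF xwS this] have "iso (reflexion x u) y" by (simp only: comm)
      from iso_path.step[OF m(2) this] have "iso_path (Suc m) (reflexion y (reflexion x u))" .
      moreover have "reflexion y (reflexion x u) = reflexion x ?w"
        using comm reflexion_reflexion[OF Sk_rd[OF xwS], of y] by simp
      ultimately show ?thesis using m(1) by auto
    qed
  qed
qed

text \<open>On a shortest path to \<open>u\<close> with last step \<open>y\<close> from
  \<open>w\<close>, the root \<open>b_of u y = b_of v y\<close> is positive at \<open>v\<close>, so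
  \<open>b_of w y\<close> is negative; exchange then yields a shorter path to
  \<open>u\<close>.\<close>

lemma Sp_unique:
  assumes "u \<in> Sp v" "b_of u = b_of v" shows "u = v"
proof -
  define n where "n = (LEAST n. iso_path n u)"
  have n: "iso_path n u" unfolding n_def using Sp_iso_path[OF assms(1)] by (rule LeastI_ex)
  have least: "n \<le> j" if "iso_path j u" for j unfolding n_def using that by (rule Least_le)
  show ?thesis
  proof (cases n)
    case 0
    then show ?thesis using n by (auto elim: iso_path.cases)
  next
    case (Suc m)
    then obtain w y where w: "iso_path m w" "iso w y" "u = reflexion y w"
      using n by (auto elim: iso_path.cases)
    note wS = Sp_Sk[OF iso_path_Sp[OF w(1)]]
    have "(\<lambda>h. - b_of w y h) = b_of v y"
      using fun_cong[OF assms(2), of y] unfolding w(3) by (auto simp: fun_eq_iff b_reflexion)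
    then have "nat_comb v (\<lambda>h. - b_of w y h)" using nat_comb_self by simp
    then have "\<not> nat_comb v (b_of w y)" using sign_iff[OF wS Sk_self] by blast
    then obtain j where "Suc j = m" "iso_path j u" using iso_exchange[OF w(1,2)] w(3) by blast
    then show ?thesis using least[of j] Suc by simp
  qed
qed

text \<open>Write \<open>u = w(u')\<close> with \<open>u'\<close> in \<open>Sp v\<close>. Positivity
  of anisotropic roots is the same at \<open>u\<close> and \<open>v\<close>, which have equal
  \<open>b\<close>, and at \<open>u'\<close> and \<open>v\<close>; so the inverse of
  \<open>w\<close> preserves positivity and \<open>w\<close> is trivial. Exactness of
  \<open>w\<close> gives \<open>u = u'\<close>, which reduces the claim to
  \<open>Sp v\<close>.\<close>

lemma Sk_unique_base:
  assumes u: "u \<in> Sk v" and b: "b_of u = b_of v" shows "u = v"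
proof -
  obtain k w u' where w: "word k w" "u' \<in> Sp v" "sim w (\<lambda>_. 1) u' u"
    using Sk_decomp[OF u] by blast
  note u'S = Sp_Sk[OF w(2)]
  have "w = \<one>\<^bsub>G\<^esub>"
  proof (rule word_trivial[OF w(1)])
    fix q x q1 assume q: "q \<in> Sk v" "q1 \<in> Sk v" "aniso q x" "nat_comb v (b_of q x)"
      "sim w (\<lambda>_. 1) q1 q"
    have "nat_comb u (b_of q x)" using q(4) b by (simp add: nat_comb_def)
    then have "nat_comb u' (b_of q1 x)"
      using nat_comb_transport[OF w(3) q(5)] Sk_space[OF u'S] Sk_space[OF q(2)] by simp
    moreover have "cartan q1 x x \<noteq> 0" using q(3) sim_aniso[OF q(5)] by (auto simp: aniso_def)
    ultimately show "nat_comb v (b_of q1 x)" using sign_Sp[OF w(2) q(2)] by blast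
  qed
  moreover have "sim \<one>\<^bsub>G\<^esub> (\<lambda>_. 1) u' u'"
    using sim_id[OF Sk_rd[OF u'S]] Sk_space[OF u'S] by (simp add: GL_simps)
  ultimately have "u = u'"
    using sim_exact_unique[OF w(3)] Sk_space[OF u] Sk_space[OF u'S] by simp
  then show ?thesis using Sp_unique w(2) b by simp
qed

lemma word_Sp_trivial:
  assumes w: "word k w" "sim w (\<lambda>_. 1) v u" "u \<in> Sp v" shows "w = \<one>\<^bsub>G\<^esub>"
proof (rule word_trivial[OF w(1)])
  fix q x q1 assume q: "q \<in> Sk v" "q1 \<in> Sk v" "aniso q x" "nat_comb v (b_of q x)"
    "sim w (\<lambda>_. 1) q1 q"
  have "nat_comb u (b_of q x)"
    using sign_Sp[OF w(3) q(1)] q(3,4) by (auto simp: aniso_def)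
  then show "nat_comb v (b_of q1 x)"
    using nat_comb_transport[OF w(2) q(5)] Sk_space[OF q(2)] by simp
qed

lemma admissible_datum_Sk:
  assumes u: "u \<in> Sk v" shows "admissible_datum u"
proof -
  note t = Sk_trans[OF u]
  show ?thesis
  proof (rule admissible_datum.intro)
    show "root_datum u" by (rule Sk_rd[OF u])
  next
    fix p w x assume "p \<in> Sk u" "w \<in> Sk u"
    then show "nat_comb w (b_of p x) \<or> nat_comb w (\<lambda>h. - b_of p x h)" by (intro sign t)
  next
    fix p w x y assume "p \<in> Sk u" "w \<in> Sk u" "b_of p x = b_of w y"
    then show "\<exists>c. c \<noteq> 0 \<and> a_of p x = c *\<^sub>C a_of w y" by (intro coroot t)
  next
    fix p x y assume "p \<in> Sk u" "reflectable p x" "cartan p x y = 0"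
    then show "cartan p y x = 0" using wsym[OF t] by simp
  qed
qed

end

lemma (in admissible_datum) Sk_unique:
  assumes "u \<in> Sk v" "w \<in> Sk v" "b_of u = b_of w" shows "u = w"
proof -
  interpret w: admissible_datum w by (rule admissible_datum_Sk[OF assms(2)])
  show ?thesis using w.Sk_unique_base Sk_trans[OF Sk_sym[OF rd assms(2)] assms(1)] assms(3) by blast
qed

lemma admissible_datumI:
  assumes R: "component R" "admissible R" "v \<in> R"
  shows "admissible_datum v"
proof -
  obtain v0 where v0: "root_datum v0" "R = {u. \<exists>\<theta>. arrow v0 \<theta> u}"
    using R(1) unfolding component_def by blast
  obtain \<theta> where \<theta>: "arrow v0 \<theta> v" using R(3) v0(2) by blast
  have rd: "root_datum v" using arrow_factorization[OF \<theta>] by blast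
  have Sk_R: "u \<in> R" if "u \<in> Sk v" for u
    using arrow.composition[OF \<theta> arrow_Sk[OF rd that]] v0(2) by blast
  have r: "root_datum u" if "u \<in> Sk v" for u by (rule Sk_root_datum[OF rd that])
  have ar: "arrow u (\<lambda>h\<in>space u. h) w" "space w = space u" if "u \<in> Sk v" "w \<in> Sk v" for u w
  proof -
    have "w \<in> Sk u" by (rule Sk_trans[OF Sk_sym[OF rd that(1)] that(2)])
    then show "arrow u (\<lambda>h\<in>space u. h) w" "space w = space u"
      using arrow_Sk[OF r[OF that(1)]] Sk_space by blast+
  qed
  note cons = admissible_consequences[OF R(2) Sk_R Sk_R r r ar]
  show ?thesis
  proof
    show "root_datum v" by (rule rd)
  next
    fix u w x assume "u \<in> Sk v" "w \<in> Sk v"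
    then show "nat_comb w (b_of u x) \<or> nat_comb w (\<lambda>h. - b_of u x h)" by (intro cons(1))
  next
    fix u w x y assume "u \<in> Sk v" "w \<in> Sk v" "b_of u x = b_of w y"
    then show "\<exists>c. c \<noteq> 0 \<and> a_of u x = c *\<^sub>C a_of w y" by (intro cons(2))
  next
    fix u x y assume u: "u \<in> Sk v" "reflectable u x" "cartan u x y = 0"
    show "cartan u y x = 0"
    proof (cases "x = y")
      case False
      \<comment> \<open>Since \<open>a_xy = 0\<close>, the reflexion at \<open>x\<close> negates
        \<open>b_of u x\<close> and leaves \<open>b_of u y\<close> unchanged, which is the situation
        of \<open>weakly_symmetric\<close>.\<close>
      have w: "reflexion x u \<in> Sk v" by (rule Sk_reflexion[OF u(1,2)])
      show ?thesis
      proof (rule cons(3)[OF u(1) w u(1) w u(1) w u(1) w])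
        show "b_of (reflexion x u) x = (\<lambda>h. - b_of u x h)" by (auto simp: b_reflexion)
        show "b_of (reflexion x u) y = b_of u y"
          using False u(3) by (auto simp: b_reflexion b_coef_def)
        show "x \<noteq> y" by fact
      qed
    qed (use u in simp)
  qed
qed

section \<open>The groups attached to a root datum\<close>

lemma contragredient_sim:
  assumes "sim \<gamma> d u w" "space w = space u"
  shows "contragredient (space u) (space u) \<gamma> (b_of u x) = b_of w x"
proof
  fix k
  show "contragredient (space u) (space u) \<gamma> (b_of u x) k = b_of w x k"
  proof (cases "k \<in> space u")
    case True
    then have "k \<in> \<gamma> ` space u"
      using lin_isosD(2)[OF simD(3)[OF assms(1)]] assms(2) by (simp add: bij_betw_def)
    then have "inv_into (space u) \<gamma> k \<in> space u" "\<gamma> (inv_into (space u) \<gamma> k) = k"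
      by (auto intro: inv_into_into f_inv_into_f)
    then show ?thesis
      using True simD(6)[OF assms(1), of "inv_into (space u) \<gamma> k" x] by (simp add: contragredient_def)
  next
    case False
    then show ?thesis
      using b_linear(3)[OF simD(2)[OF assms(1)]] assms(2) by (simp add: contragredient_def)
  qed
qed

lemma K_iff:
  assumes "root_datum v" shows "\<gamma> \<in> K v \<longleftrightarrow> (\<exists>d. sim \<gamma> d v v)"
proof
  assume k: "\<gamma> \<in> K v"
  then have "\<forall>x. \<exists>c. c \<noteq> 0 \<and> \<gamma> (a_of v x) = c *\<^sub>C a_of v x" by (auto simp: K_def)
  then obtain d where "\<And>x. d x \<noteq> 0 \<and> \<gamma> (a_of v x) = d x *\<^sub>C a_of v x" by metis
  then have "sim \<gamma> d v v" using k assms by (simp add: sim_def K_def)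
  then show "\<exists>d. sim \<gamma> d v v" by blast
qed (auto simp: sim_def K_def)

lemma D_equivalent_of_sim:
  assumes "sim \<gamma> d v u" shows "D_equivalent v u"
  unfolding D_equivalent_def
  using simD(4,7)[OF assms]
  by (intro conjI exI[of _ "\<lambda>x. inverse (d x)"]) (auto simp: sim_cartan[OF assms])

section \<open>The action on the skeleton and the quotient by K\<close>

context admissible_datum
begin

text \<open>The two families of factors may differ: \<gamma> fixes only \<open>b\<close> and
  \<open>p\<close> of the target, and inside the skeleton \<open>b\<close> determines the
  vertex.\<close>

lemma sim_target_unique:
  assumes "sim \<gamma> d u w" "sim \<gamma> e u w'" "u \<in> Sk v" "w \<in> Sk v" "w' \<in> Sk v" shows "w = w'"
proof (rule Sk_unique[OF assms(4,5)])
  show "b_of w = b_of w'"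
    using contragredient_sim[OF assms(1)] contragredient_sim[OF assms(2)] Sk_space[OF assms(3)]
      Sk_space[OF assms(4)] Sk_space[OF assms(5)] by (auto simp: fun_eq_iff)
qed

lemma act_eq:
  assumes "sim \<gamma> d v u" "u \<in> Sk v" shows "act v \<gamma> v = u"
  unfolding act_def
proof (rule the_equality)
  show "u \<in> Sk v \<and> (\<forall>x. b_of u x = contragredient S S \<gamma> (b_of v x))"
    using assms contragredient_sim[OF assms(1) Sk_space[OF assms(2)]] by simp
next
  fix w assume w: "w \<in> Sk v \<and> (\<forall>x. b_of w x = contragredient S S \<gamma> (b_of v x))"
  then have "b_of w = b_of u"
    using contragredient_sim[OF assms(1) Sk_space[OF assms(2)]] by auto
  then show "w = u" using Sk_unique w assms(2) by blast
qed

lemma act_sim: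
  assumes "\<gamma> \<in> Aut v" obtains d where "sim \<gamma> d v (act v \<gamma> v)" "act v \<gamma> v \<in> Sk v"
proof -
  obtain u d where "u \<in> Sk v" "sim \<gamma> d v u" using assms Aut_iff[OF rd] by blast
  then show ?thesis using act_eq that by metis
qed

lemma AutI: "sim \<gamma> d v u \<Longrightarrow> u \<in> Sk v \<Longrightarrow> \<gamma> \<in> Aut v"
  using Aut_iff[OF rd] by blast

lemma Aut_carrier: "Aut v \<subseteq> carrier G"
proof
  fix \<gamma> assume "\<gamma> \<in> Aut v"
  then obtain d where "sim \<gamma> d v (act v \<gamma> v)" "act v \<gamma> v \<in> Sk v" by (rule act_sim)
  then show "\<gamma> \<in> carrier G" using simD(3) Sk_space by (fastforce simp: GL_simps)
qed

lemma sim_one: "u \<in> Sk v \<Longrightarrow> sim \<one>\<^bsub>G\<^esub> (\<lambda>_. 1) u u"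
  using sim_id[OF Sk_rd] Sk_space by (fastforce simp: GL_simps)

lemma sim_inv:
  assumes "sim \<gamma> d u w" "u \<in> Sk v" "w \<in> Sk v"
  shows "sim (inv\<^bsub>G\<^esub> \<gamma>) (\<lambda>x. inverse (d x)) w u"
proof -
  note s = sim_inverse[OF assms(1)]
  have g: "\<gamma> \<in> lin_isos S S" and i: "restrict (inv_into S \<gamma>) S \<in> lin_isos S S"
    using simD(3)[OF assms(1)] simD(3)[OF s] Sk_space[OF assms(2)] Sk_space[OF assms(3)] by auto
  have "restrict (inv_into S \<gamma>) S \<otimes>\<^bsub>G\<^esub> \<gamma> = \<one>\<^bsub>G\<^esub>"
    using g i compose_inv_into_id[OF lin_isosD(2)[OF g]] by (simp add: GL_simps)
  then have "inv\<^bsub>G\<^esub> \<gamma> = restrict (inv_into S \<gamma>) S"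
    using g i by (intro G.inv_equality) (auto simp: GL_simps)
  then show ?thesis using s Sk_space[OF assms(2)] Sk_space[OF assms(3)] by simp
qed

lemma Aut_moves:
  assumes "\<gamma> \<in> Aut v" "u \<in> Sk v"
  obtains d w where "w \<in> Sk v" "sim \<gamma> d u w" "sim \<gamma> d v (act v \<gamma> v)"
proof -
  from assms(1) obtain d where d: "sim \<gamma> d v (act v \<gamma> v)" "act v \<gamma> v \<in> Sk v" by (rule act_sim)
  obtain w where "w \<in> Sk (act v \<gamma> v)" "sim \<gamma> d u w" using Sk_sim[OF assms(2) d(1)] by blast
  then show ?thesis using that Sk_trans[OF d(2)] d(1) by blast
qed

text \<open>Moving along a chain from \<open>v\<close> to \<open>act v \<delta> v\<close> does not
  change the factors of \<gamma>, so the same \<open>d\<close> serves at both ends. This matches the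
  product of vertices by names of reflexions.\<close>

lemma act_mult_sim:
  assumes "\<gamma> \<in> Aut v" "\<delta> \<in> Aut v"
  obtains d e w where "w \<in> Sk v" "sim \<gamma> d v (act v \<gamma> v)" "sim \<gamma> d (act v \<delta> v) w"
    "sim (\<gamma> \<otimes>\<^bsub>G\<^esub> \<delta>) e v w"
proof -
  from assms(2) obtain e where e: "sim \<delta> e v (act v \<delta> v)" "act v \<delta> v \<in> Sk v" by (rule act_sim)
  from assms(1) e(2) obtain d w where d: "w \<in> Sk v" "sim \<gamma> d (act v \<delta> v) w" "sim \<gamma> d v (act v \<gamma> v)"
    by (rule Aut_moves)
  show ?thesis
    using that[OF d(1,3,2)] sim_mult[OF e(1) d(2)] Sk_space[OF e(2)] Sk_space[OF d(1)] by simp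
qed

lemma subgroup_Aut: "subgroup (Aut v) G"
proof (rule G.subgroupI[OF Aut_carrier])
  show "Aut v \<noteq> {}" using AutI[OF sim_one Sk_self] Sk_self by blast
next
  fix \<gamma> assume "\<gamma> \<in> Aut v"
  then obtain d where d: "sim \<gamma> d v (act v \<gamma> v)" "act v \<gamma> v \<in> Sk v" by (rule act_sim)
  have "sim (inv\<^bsub>G\<^esub> \<gamma>) (\<lambda>x. inverse (d x)) (act v \<gamma> v) v" by (rule sim_inv[OF d(1) Sk_self d(2)])
  then obtain w where "w \<in> Sk v" "sim (inv\<^bsub>G\<^esub> \<gamma>) (\<lambda>x. inverse (d x)) v w"
    using Sk_sim[OF Sk_sym[OF rd d(2)]] by blast
  then show "inv\<^bsub>G\<^esub> \<gamma> \<in> Aut v" using AutI by blast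
next
  fix \<gamma> \<delta> assume "\<gamma> \<in> Aut v" "\<delta> \<in> Aut v"
  then obtain d e w where "w \<in> Sk v" "sim (\<gamma> \<otimes>\<^bsub>G\<^esub> \<delta>) e v w" by (rule act_mult_sim)
  then show "\<gamma> \<otimes>\<^bsub>G\<^esub> \<delta> \<in> Aut v" using AutI by blast
qed

lemma AutG_simps:
  "carrier (AutG v) = Aut v" "\<gamma> \<otimes>\<^bsub>AutG v\<^esub> \<delta> = \<gamma> \<otimes>\<^bsub>G\<^esub> \<delta>" "\<one>\<^bsub>AutG v\<^esub> = \<one>\<^bsub>G\<^esub>"
  by (simp_all add: AutG_def)

sublocale A: group "AutG v"
  unfolding AutG_def by (rule subgroup.subgroup_is_group[OF subgroup_Aut G.group_axioms])

lemma SkD_iff: "u \<in> SkD v \<longleftrightarrow> u \<in> Sk v \<and> (\<exists>\<gamma> d. sim \<gamma> d v u)"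
  unfolding SkD_def using D_equivalent_sim[OF rd] D_equivalent_of_sim by blast

lemma act_image: "(\<lambda>\<gamma>. act v \<gamma> v) ` Aut v = SkD v"
proof
  show "(\<lambda>\<gamma>. act v \<gamma> v) ` Aut v \<subseteq> SkD v"
  proof clarify
    fix \<gamma> assume "\<gamma> \<in> Aut v"
    then obtain d where "sim \<gamma> d v (act v \<gamma> v)" "act v \<gamma> v \<in> Sk v" by (rule act_sim)
    then show "act v \<gamma> v \<in> SkD v" unfolding SkD_iff by blast
  qed
  show "SkD v \<subseteq> (\<lambda>\<gamma>. act v \<gamma> v) ` Aut v"
  proof
    fix u assume "u \<in> SkD v"
    then obtain \<gamma> d where "u \<in> Sk v" "sim \<gamma> d v u" unfolding SkD_iff by blast
    then show "u \<in> (\<lambda>\<gamma>. act v \<gamma> v) ` Aut v" using act_eq AutI by (metis image_eqI)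
  qed
qed

text \<open>The chain from \<open>v\<close> to \<open>u'\<close> is carried by \<gamma> to the chain
  with the same names from \<open>u\<close> to \<open>w\<close>. Any other chain gives a target of
  the same \<gamma>, hence the same vertex, which justifies the definite description.\<close>

lemma SkDG_mult:
  assumes "sim \<gamma> d v u" "sim \<gamma> d u' w" "u \<in> Sk v" "u' \<in> Sk v" "w \<in> Sk v"
  shows "u \<otimes>\<^bsub>SkDG v\<^esub> u' = w"
proof -
  have *: "w1 = w" if xs: "chain v xs u'" "chain u xs w1" for xs w1
  proof -
    obtain w2 where w2: "chain u xs w2" "sim \<gamma> d u' w2" using chain_sim[OF xs(1) assms(1)] by blast
    then have "w2 = w1" using chain_unique xs(2) by blast
    moreover have "w1 \<in> Sk v" using Sk_trans[OF assms(3)] xs(2) by (auto simp: Sk_def)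
    ultimately show ?thesis using sim_target_unique[OF _ assms(2,4) _ assms(5)] w2(2) by blast
  qed
  obtain xs where xs: "chain v xs u'" using assms(4) by (auto simp: Sk_def)
  then obtain w1 where w1: "chain u xs w1" using chain_sim[OF xs assms(1)] by blast
  have "(THE w. \<exists>xs. chain v xs u' \<and> chain u xs w) = w"
    using * xs w1 by (intro the_equality) blast+
  then show ?thesis by (simp add: SkDG_def)
qed

lemma SkDG_simps: "carrier (SkDG v) = SkD v" "\<one>\<^bsub>SkDG v\<^esub> = v"
  by (simp_all add: SkDG_def)

lemma act_hom: "(\<lambda>\<gamma>. act v \<gamma> v) \<in> hom (AutG v) (SkDG v)"
proof (rule homI)
  fix \<gamma> assume "\<gamma> \<in> carrier (AutG v)"
  then show "act v \<gamma> v \<in> carrier (SkDG v)" using act_image by (auto simp: AutG_simps SkDG_simps)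
next
  fix \<gamma> \<delta> assume "\<gamma> \<in> carrier (AutG v)" "\<delta> \<in> carrier (AutG v)"
  then have gd: "\<gamma> \<in> Aut v" "\<delta> \<in> Aut v" by (auto simp: AutG_simps)
  then obtain d e w where w: "w \<in> Sk v" "sim \<gamma> d v (act v \<gamma> v)" "sim \<gamma> d (act v \<delta> v) w"
    "sim (\<gamma> \<otimes>\<^bsub>G\<^esub> \<delta>) e v w" by (rule act_mult_sim)
  have "act v \<gamma> v \<in> Sk v" "act v \<delta> v \<in> Sk v" using gd act_sim by blast+
  then have "act v \<gamma> v \<otimes>\<^bsub>SkDG v\<^esub> act v \<delta> v = w" using SkDG_mult[OF w(2,3) _ _ w(1)] by blast
  then show "act v (\<gamma> \<otimes>\<^bsub>AutG v\<^esub> \<delta>) v = act v \<gamma> v \<otimes>\<^bsub>SkDG v\<^esub> act v \<delta> v"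
    using act_eq[OF w(4,1)] by (simp add: AutG_simps)
qed

text \<open>The group axioms are inherited: the structure is the image of \<open>AutG v\<close>
  under a homomorphism that is onto by \<open>act_image\<close>.\<close>

sublocale D: group "SkDG v"
proof -
  have "act v \<one>\<^bsub>AutG v\<^esub> v = v" using act_eq[OF sim_one[OF Sk_self] Sk_self] by (simp add: AutG_simps)
  then have "(SkDG v)\<lparr>carrier := (\<lambda>\<gamma>. act v \<gamma> v) ` carrier (AutG v), one := act v \<one>\<^bsub>AutG v\<^esub> v\<rparr> = SkDG v"
    using act_image by (simp add: AutG_simps SkDG_def)
  then show "group (SkDG v)" using A.hom_imp_img_group[OF act_hom] by simp
qed

sublocale act: group_hom "AutG v" "SkDG v" "\<lambda>\<gamma>. act v \<gamma> v"
  by unfold_locales (rule act_hom)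

lemma kernel_act: "kernel (AutG v) (SkDG v) (\<lambda>\<gamma>. act v \<gamma> v) = K v"
proof (intro Set.set_eqI iffI)
  fix \<gamma> assume "\<gamma> \<in> kernel (AutG v) (SkDG v) (\<lambda>\<gamma>. act v \<gamma> v)"
  then have g: "\<gamma> \<in> Aut v" "act v \<gamma> v = v" by (auto simp: kernel_def AutG_simps SkDG_simps)
  from g(1) obtain d where "sim \<gamma> d v (act v \<gamma> v)" by (rule act_sim)
  then show "\<gamma> \<in> K v" using g(2) K_iff[OF rd] by auto
next
  fix \<gamma> assume "\<gamma> \<in> K v"
  then obtain d where d: "sim \<gamma> d v v" using K_iff[OF rd] by blast
  then show "\<gamma> \<in> kernel (AutG v) (SkDG v) (\<lambda>\<gamma>. act v \<gamma> v)"
    using act_eq[OF d Sk_self] AutI[OF d Sk_self] by (simp add: kernel_def AutG_simps SkDG_simps)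
qed

lemma K_normal: "K v \<lhd> AutG v"
  using act.normal_kernel unfolding kernel_act .

lemma Aut_mod_K:
  "\<exists>\<phi>\<in>Group.iso (AutG v Mod K v) (SkDG v). \<forall>\<gamma>\<in>Aut v. \<phi> (K v #>\<^bsub>AutG v\<^esub> \<gamma>) = act v \<gamma> v"
proof (intro bexI ballI)
  show "(\<lambda>X. the_elem ((\<lambda>\<gamma>. act v \<gamma> v) ` X)) \<in> Group.iso (AutG v Mod K v) (SkDG v)"
    using act.FactGroup_iso_set act_image unfolding kernel_act by (simp add: AutG_simps SkDG_simps)
  fix \<gamma> assume g: "\<gamma> \<in> Aut v"
  interpret K: normal "K v" "AutG v" by (rule K_normal)
  have "act v (k \<otimes>\<^bsub>AutG v\<^esub> \<gamma>) v = act v \<gamma> v" if "k \<in> K v" for k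
  proof -
    have "k \<in> carrier (AutG v)" "act v k v = \<one>\<^bsub>SkDG v\<^esub>"
      using that unfolding kernel_act[symmetric] by (auto simp: kernel_def)
    then show ?thesis using g act.hom_mult[of k \<gamma>] act.hom_closed[of \<gamma>] by (simp add: AutG_simps)
  qed
  then have "(\<lambda>\<gamma>. act v \<gamma> v) ` (K v #>\<^bsub>AutG v\<^esub> \<gamma>) = (\<lambda>_. act v \<gamma> v) ` K v"
    by (auto simp: r_coset_def image_UN)
  then have "(\<lambda>\<gamma>. act v \<gamma> v) ` (K v #>\<^bsub>AutG v\<^esub> \<gamma>) = {act v \<gamma> v}"
    using K.one_closed by (metis image_constant)
  then show "the_elem ((\<lambda>\<gamma>. act v \<gamma> v) ` (K v #>\<^bsub>AutG v\<^esub> \<gamma>)) = act v \<gamma> v" by simp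
qed

section \<open>The Weyl group\<close>

abbreviation "reflections \<equiv> {root_reflection u x | u x. u \<in> Sk v \<and> reflectable u x \<and> cartan u x x \<noteq> 0}"

lemma word_mult: "word j w' \<Longrightarrow> word k w \<Longrightarrow> word (j + k) (w \<otimes>\<^bsub>G\<^esub> w')"
proof (induction rule: word.induct)
  case Nil
  then show ?case using word_carrier by simp
next
  case (Snoc j w' u x)
  then show ?case
    using word.Snoc[OF Snoc.IH[OF Snoc.prems] Snoc.hyps(2,3)] word_carrier[OF Snoc.hyps(1)]
      word_carrier[OF Snoc.prems] refl_carrier[OF Sp_Sk[OF Snoc.hyps(2)] Snoc.hyps(3)]
    by (simp add: G.m_assoc)
qed

lemma inv_reflection: "u \<in> Sk v \<Longrightarrow> aniso u x \<Longrightarrow> inv\<^bsub>G\<^esub> (root_reflection u x) = root_reflection u x"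
  using refl_carrier sim_refl(4) by (intro G.inv_equality) auto

lemma word_inv: "word k w \<Longrightarrow> word k (inv\<^bsub>G\<^esub> w)"
proof (induction rule: word.induct)
  case Nil
  then show ?case using word.Nil by simp
next
  case (Snoc k w u x)
  note u = Sp_Sk[OF Snoc.hyps(2)]
  show ?case
    using word_left[OF Snoc.hyps(2,3) Snoc.IH] word_carrier[OF Snoc.hyps(1)]
      refl_carrier[OF u Snoc.hyps(3)] inv_reflection[OF u Snoc.hyps(3)]
    by (simp add: G.inv_mult_group)
qed

text \<open>A reflection at an arbitrary vertex \<open>u = w(u')\<close> is the conjugate by the
  word \<open>w\<close> of a reflection at \<open>u'\<close> in \<open>Sp v\<close>, so principal
  reflections already generate.\<close>

lemma Weyl_iff: "w \<in> Weyl v \<longleftrightarrow> (\<exists>k. word k w)"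
proof
  assume "w \<in> Weyl v"
  moreover have "subgroup {w. \<exists>k. word k w} G"
    by (rule G.subgroupI) (use word_carrier word.Nil word_mult word_inv in blast)+
  moreover have "reflections \<subseteq> {w. \<exists>k. word k w}"
  proof clarify
    fix u x assume u: "u \<in> Sk v" "reflectable u x" "cartan u x x \<noteq> 0"
    obtain k w u' where w: "word k w" "u' \<in> Sp v" "sim w (\<lambda>_. 1) u' u"
      using Sk_decomp[OF u(1)] by blast
    have an: "aniso u x" using u by (simp add: aniso_def)
    then have an': "aniso u' x" using sim_aniso[OF w(3)] by blast
    note u'S = Sp_Sk[OF w(2)]
    note car = word_carrier[OF w(1)] refl_carrier[OF u(1) an] refl_carrier[OF u'S an']
    have "w \<otimes>\<^bsub>G\<^esub> root_reflection u' x = root_reflection u x \<otimes>\<^bsub>G\<^esub> w"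
      using sim_conjugates_root_reflection[OF w(3)] an' Sk_space[OF u(1)] Sk_space[OF u'S]
      by (simp add: aniso_def)
    then have "root_reflection u x = (w \<otimes>\<^bsub>G\<^esub> root_reflection u' x) \<otimes>\<^bsub>G\<^esub> inv\<^bsub>G\<^esub> w"
      using car by (simp add: G.m_assoc)
    then show "\<exists>k. word k (root_reflection u x)"
      using word_mult[OF word_inv[OF w(1)] word.Snoc[OF w(1,2) an']] by metis
  qed
  ultimately show "\<exists>k. word k w"
    unfolding Weyl_def using G.generate_subgroup_incl by blast
next
  assume "\<exists>k. word k w"
  then obtain k where "word k w" by blast
  then show "w \<in> Weyl v"
  proof (induction rule: word.induct)
    case Nil
    show ?case unfolding Weyl_def by (rule generate.one)
  next
    case (Snoc k w u x)
    then have "root_reflection u x \<in> reflections" using Sp_Sk by (auto simp: aniso_def)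
    then show ?case
      unfolding Weyl_def by (rule generate.eng[OF Snoc.IH[unfolded Weyl_def] generate.incl])
  qed
qed

lemma Weyl_sim:
  assumes "w \<in> Weyl v" shows "sim w (\<lambda>_. 1) v (act v w v)" "act v w v \<in> Sk v"
proof -
  obtain k where "word k w" using assms Weyl_iff by blast
  then obtain u where u: "u \<in> Sk v" "sim w (\<lambda>_. 1) v u" using word_moves(1) Sk_self by blast
  then have "act v w v = u" by (intro act_eq)
  then show "sim w (\<lambda>_. 1) v (act v w v)" "act v w v \<in> Sk v" using u by simp_all
qed

lemma Weyl_Aut: "Weyl v \<subseteq> Aut v"
  using AutI Weyl_sim by blast

lemma Weyl_trivial: "w \<in> Weyl v \<Longrightarrow> act v w v \<in> Sp v \<Longrightarrow> w = \<one>\<^bsub>G\<^esub>"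
  using word_Sp_trivial Weyl_sim Weyl_iff by blast

text \<open>An automorphism carries \<open>u\<close> to another vertex \<open>w\<close> of the
  skeleton and conjugates the reflection of \<open>b_of u x\<close> into that of
  \<open>b_of w x\<close>, so the generating set itself is stable under conjugation.\<close>

lemma Weyl_normal: "Weyl v \<lhd> AutG v"
proof -
  have refl_Aut: "reflections \<subseteq> Aut v"
    using Weyl_Aut unfolding Weyl_def by (blast intro: generate.incl)
  then have "Weyl v = generate (AutG v) reflections"
    unfolding Weyl_def AutG_def using G.generate_consistent[OF _ subgroup_Aut] by blast
  moreover have "generate (AutG v) reflections \<lhd> AutG v"
  proof (rule A.normal_generateI)
    show "reflections \<subseteq> carrier (AutG v)" using refl_Aut by (simp add: AutG_simps)
    fix s g assume s: "s \<in> reflections" and g: "g \<in> carrier (AutG v)"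
    obtain u x where u: "u \<in> Sk v" "reflectable u x" "cartan u x x \<noteq> 0" "s = root_reflection u x"
      using s by blast
    have gA: "g \<in> Aut v" using g by (simp add: AutG_simps)
    from gA u(1) obtain d w where w: "w \<in> Sk v" "sim g d u w" by (rule Aut_moves)
    have wr: "root_reflection w x \<in> reflections"
      using w u sim_reflectable[OF w(2)] sim_cartan[OF w(2), of x x] by auto
    have "g \<otimes>\<^bsub>G\<^esub> s = root_reflection w x \<otimes>\<^bsub>G\<^esub> g"
      using sim_conjugates_root_reflection[OF w(2) _ u(3)] Sk_space[OF u(1)] Sk_space[OF w(1)] u(4) by simp
    then have "g \<otimes>\<^bsub>AutG v\<^esub> s = root_reflection w x \<otimes>\<^bsub>AutG v\<^esub> g" by (simp add: AutG_simps)
    moreover have "root_reflection w x \<in> carrier (AutG v)"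
      using wr refl_Aut by (auto simp: AutG_simps)
    ultimately have "g \<otimes>\<^bsub>AutG v\<^esub> s \<otimes>\<^bsub>AutG v\<^esub> inv\<^bsub>AutG v\<^esub> g = root_reflection w x"
      using g by (simp add: A.m_assoc)
    then show "g \<otimes>\<^bsub>AutG v\<^esub> s \<otimes>\<^bsub>AutG v\<^esub> inv\<^bsub>AutG v\<^esub> g \<in> reflections" using wr by simp
  qed
  ultimately show ?thesis by simp
qed

text \<open>Injectivity comes from \<open>Weyl_trivial\<close>, since \<open>v\<close> itself lies
  in \<open>Sp v\<close>.\<close>

lemma Weyl_iso:
  "(\<lambda>w. act v w v) \<in> Group.iso ((AutG v)\<lparr>carrier := Weyl v\<rparr>)
     ((SkDG v)\<lparr>carrier := (\<lambda>w. act v w v) ` Weyl v\<rparr>)"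
proof -
  interpret W: normal "Weyl v" "AutG v" by (rule Weyl_normal)
  have "inj_on (\<lambda>w. act v w v) (Weyl v)"
  proof (rule inj_onI)
    fix w w' assume w: "w \<in> Weyl v" "w' \<in> Weyl v" "act v w v = act v w' v"
    then have car: "w \<in> carrier (AutG v)" "w' \<in> carrier (AutG v)"
      using Weyl_Aut by (auto simp: AutG_simps)
    then have "act v (w \<otimes>\<^bsub>AutG v\<^esub> inv\<^bsub>AutG v\<^esub> w') v = \<one>\<^bsub>SkDG v\<^esub>"
      using w(3) by (simp add: act.hom_mult act.hom_inv)
    moreover have "w \<otimes>\<^bsub>AutG v\<^esub> inv\<^bsub>AutG v\<^esub> w' \<in> Weyl v" using w by simp
    ultimately have "w \<otimes>\<^bsub>AutG v\<^esub> inv\<^bsub>AutG v\<^esub> w' = \<one>\<^bsub>G\<^esub>"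
      by (intro Weyl_trivial) (simp_all only: SkDG_simps Sp.base)
    then have "w \<otimes>\<^bsub>AutG v\<^esub> inv\<^bsub>AutG v\<^esub> w' = \<one>\<^bsub>AutG v\<^esub>" by (simp only: AutG_simps)
    then show "w = w'" using car A.inv_solve_right'[of "\<one>\<^bsub>AutG v\<^esub>" w w'] by simp
  qed
  moreover have "(\<lambda>w. act v w v) \<in> hom ((AutG v)\<lparr>carrier := Weyl v\<rparr>)
     ((SkDG v)\<lparr>carrier := (\<lambda>w. act v w v) ` Weyl v\<rparr>)"
    using Weyl_Aut act.hom_mult by (intro homI) (auto simp: AutG_simps)
  ultimately show ?thesis by (simp add: Group.iso_def bij_betw_def)
qed

section \<open>Isotropic chains and the semidirect product\<close>

lemma Sp_trans: "u \<in> Sp v \<Longrightarrow> w \<in> Sp u \<Longrightarrow> w \<in> Sp v"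
  by (erule Sp.induct) (auto intro: Sp.step)

lemma Sp_sim: "u' \<in> Sp p \<Longrightarrow> sim \<gamma> d p u \<Longrightarrow> \<exists>w\<in>Sp u. sim \<gamma> d u' w"
proof (induction rule: Sp.induct)
  case base
  then show ?case using Sp.base by blast
next
  case (step q x)
  then obtain w where w: "w \<in> Sp u" "sim \<gamma> d q w" by blast
  have "reflectable w x" "cartan w x x = 0"
    using step.hyps sim_reflectable[OF w(2)] sim_cartan[OF w(2), of x x] simD(4)[OF w(2), of x] by auto
  then show ?case using Sp.step[OF w(1)] sim_reflexion[OF w(2)] by blast
qed

lemma Sp_sym: "u \<in> Sp v \<Longrightarrow> v \<in> Sp u"
proof (induction rule: Sp.induct)
  case base
  show ?case by (rule Sp.base)
next
  case (step u x)
  have i: "local.iso u x" using step.hyps by (simp add: iso_def)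
  note uS = Sp_Sk[OF step.hyps(1)]
  have "local.iso (reflexion x u) x" by (rule iso_reflexion[OF uS i])
  then have "reflexion x (reflexion x u) \<in> Sp (reflexion x u)"
    by (intro Sp.step Sp.base) (auto simp: iso_def)
  then have "u \<in> Sp (reflexion x u)" by (simp add: reflexion_reflexion[OF Sk_rd[OF uS]])
  have tr: "w \<in> Sp (reflexion x u)" if "w \<in> Sp u" for w
    using that by (induction rule: Sp.induct) (use \<open>u \<in> Sp (reflexion x u)\<close> in \<open>auto intro: Sp.step\<close>)
  show ?case by (rule tr[OF step.IH])
qed

lemma SpD_iff: "u \<in> SpD v \<longleftrightarrow> u \<in> Sp v \<and> (\<exists>\<gamma> d. sim \<gamma> d v u)"
  unfolding SpD_def Int_iff SkD_iff using Sp_Sk by blast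

lemma subgroup_SpD: "subgroup (SpD v) (SkDG v)"
proof (rule D.subgroupI)
  show "SpD v \<subseteq> carrier (SkDG v)" by (auto simp: SpD_def SkDG_simps)
  show "SpD v \<noteq> {}" using SpD_iff Sp.base sim_one[OF Sk_self] by blast
next
  fix u assume "u \<in> SpD v"
  then obtain \<gamma> d where u: "u \<in> Sp v" "sim \<gamma> d v u" unfolding SpD_iff by blast
  note uS = Sp_Sk[OF u(1)]
  have inv: "sim (inv\<^bsub>G\<^esub> \<gamma>) (\<lambda>x. inverse (d x)) u v" by (rule sim_inv[OF u(2) Sk_self uS])
  \<comment> \<open>The inverse of \<gamma> carries \<open>u\<close> to \<open>v\<close>, hence the
    isotropic chain from \<open>u\<close> back to \<open>v\<close> to one from \<open>v\<close> to
    \<open>q\<close>; its end is the inverse vertex.\<close>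
  obtain q where q: "q \<in> Sp v" "sim (inv\<^bsub>G\<^esub> \<gamma>) (\<lambda>x. inverse (d x)) v q"
    using Sp_sim[OF Sp_sym[OF u(1)] inv] by blast
  then have qD: "q \<in> SpD v" unfolding SpD_iff by blast
  have uD: "u \<in> carrier (SkDG v)" "q \<in> carrier (SkDG v)"
    using qD SkD_iff[of u] u(2) uS unfolding SkDG_simps SpD_def by blast+
  have "q \<otimes>\<^bsub>SkDG v\<^esub> u = v"
    by (rule SkDG_mult[OF q(2) inv Sp_Sk[OF q(1)] uS Sk_self])
  then have "inv\<^bsub>SkDG v\<^esub> u = q" using uD by (intro D.inv_equality) (simp_all add: SkDG_simps)
  then show "inv\<^bsub>SkDG v\<^esub> u \<in> SpD v" using qD by simp
next
  fix u u' assume "u \<in> SpD v" "u' \<in> SpD v"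
  then obtain \<gamma> d \<delta> e where u: "u \<in> Sp v" "sim \<gamma> d v u" and u': "u' \<in> Sp v" "sim \<delta> e v u'"
    unfolding SpD_iff by blast
  obtain w where w: "w \<in> Sp u" "sim \<gamma> d u' w" using Sp_sim[OF u'(1) u(2)] by blast
  have wS: "w \<in> Sp v" by (rule Sp_trans[OF u(1) w(1)])
  note S = Sp_Sk[OF u(1)] Sp_Sk[OF u'(1)] Sp_Sk[OF wS]
  have "u \<otimes>\<^bsub>SkDG v\<^esub> u' = w" by (rule SkDG_mult[OF u(2) w(2) S])
  moreover have "sim (\<gamma> \<otimes>\<^bsub>G\<^esub> \<delta>) (\<lambda>x. e x * d x) v w"
    using sim_mult[OF u'(2) w(2)] S Sk_space by blast
  ultimately show "u \<otimes>\<^bsub>SkDG v\<^esub> u' \<in> SpD v" using wS unfolding SpD_iff by blast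
qed

lemma Weyl_image_normal: "(\<lambda>w. act v w v) ` Weyl v \<lhd> SkDG v"
proof -
  interpret W: normal "Weyl v" "AutG v" by (rule Weyl_normal)
  have "subgroup ((\<lambda>w. act v w v) ` Weyl v) (SkDG v)"
    by (rule act.subgroup_img_is_subgroup[OF W.subgroup_axioms])
  moreover have "u \<otimes>\<^bsub>SkDG v\<^esub> q \<otimes>\<^bsub>SkDG v\<^esub> inv\<^bsub>SkDG v\<^esub> u \<in> (\<lambda>w. act v w v) ` Weyl v"
    if u: "u \<in> carrier (SkDG v)" and q: "q \<in> (\<lambda>w. act v w v) ` Weyl v" for u q
  proof -
    obtain \<gamma> where g: "\<gamma> \<in> carrier (AutG v)" "u = act v \<gamma> v"
      using u act_image by (auto simp: SkDG_simps AutG_simps)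
    obtain w where w: "w \<in> Weyl v" "q = act v w v" using q by blast
    have "w \<in> carrier (AutG v)" using w Weyl_Aut by (auto simp: AutG_simps)
    then have "u \<otimes>\<^bsub>SkDG v\<^esub> q \<otimes>\<^bsub>SkDG v\<^esub> inv\<^bsub>SkDG v\<^esub> u
        = act v (\<gamma> \<otimes>\<^bsub>AutG v\<^esub> w \<otimes>\<^bsub>AutG v\<^esub> inv\<^bsub>AutG v\<^esub> \<gamma>) v"
      using g w by (simp add: act.hom_mult act.hom_inv)
    then show ?thesis using W.inv_op_closed2[OF g(1) w(1)] by blast
  qed
  ultimately show ?thesis unfolding D.normal_inv_iff by blast
qed

lemma SkDG_semidirect: "semidirect_product (SkDG v) ((\<lambda>w. act v w v) ` Weyl v) (SpD v)"
  unfolding semidirect_product_def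
proof (intro conjI)
  let ?N = "(\<lambda>w. act v w v) ` Weyl v"
  show "?N \<lhd> SkDG v" by (rule Weyl_image_normal)
  then have sub: "subgroup ?N (SkDG v)" by (simp add: D.normal_inv_iff)
  show "subgroup (SpD v) (SkDG v)" by (rule subgroup_SpD)
  show "?N \<inter> SpD v = {\<one>\<^bsub>SkDG v\<^esub>}"
  proof
    show "{\<one>\<^bsub>SkDG v\<^esub>} \<subseteq> ?N \<inter> SpD v"
      using subgroup.one_closed[OF sub] subgroup.one_closed[OF subgroup_SpD] by simp
    show "?N \<inter> SpD v \<subseteq> {\<one>\<^bsub>SkDG v\<^esub>}"
    proof clarify
      fix w assume "w \<in> Weyl v" "act v w v \<in> SpD v"
      then have "w = \<one>\<^bsub>AutG v\<^esub>" using Weyl_trivial by (simp add: SpD_iff AutG_simps)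
      then show "act v w v = \<one>\<^bsub>SkDG v\<^esub>" using act.hom_one by simp
    qed
  qed
  show "?N <#>\<^bsub>SkDG v\<^esub> SpD v = carrier (SkDG v)"
  proof
    show "?N <#>\<^bsub>SkDG v\<^esub> SpD v \<subseteq> carrier (SkDG v)"
      using D.set_mult_closed subgroup.subset[OF sub] subgroup.subset[OF subgroup_SpD] by blast
    show "carrier (SkDG v) \<subseteq> ?N <#>\<^bsub>SkDG v\<^esub> SpD v"
    proof
      fix u assume "u \<in> carrier (SkDG v)"
      then obtain \<gamma> d where u: "u \<in> Sk v" "sim \<gamma> d v u" unfolding SkDG_simps SkD_iff by blast
      obtain k w u' where w: "word k w" "u' \<in> Sp v" "sim w (\<lambda>_. 1) u' u" using Sk_decomp[OF u(1)] by blast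
      have wW: "w \<in> Weyl v" using w(1) Weyl_iff by blast
      note u'S = Sp_Sk[OF w(2)]
      \<comment> \<open>As \<open>w\<close> carries \<open>v\<close> to \<open>act v w v\<close> and
        \<open>u'\<close> to \<open>u\<close>, the vertex \<open>u\<close> is the product of
        \<open>act v w v\<close> and \<open>u'\<close>.\<close>
      have "act v w v \<otimes>\<^bsub>SkDG v\<^esub> u' = u"
        by (rule SkDG_mult[OF Weyl_sim(1)[OF wW] w(3) Weyl_sim(2)[OF wW] u'S u(1)])
      \<comment> \<open>\<gamma> carries \<open>v\<close> to \<open>u\<close> and the inverse of
        \<open>w\<close> carries \<open>u\<close> to \<open>u'\<close>, so the composite shows that
        \<open>u'\<close> is D-equivalent to \<open>v\<close>.\<close>
      moreover have "sim (inv\<^bsub>G\<^esub> w \<otimes>\<^bsub>G\<^esub> \<gamma>) (\<lambda>x. d x * inverse 1) v u'"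
        by (rule sim_mult[OF u(2) sim_inv[OF w(3) u'S u(1)]]) (simp_all add: Sk_space[OF u(1)] Sk_space[OF u'S])
      then have "u' \<in> SpD v" using w(2) unfolding SpD_iff by blast
      ultimately show "u \<in> ?N <#>\<^bsub>SkDG v\<^esub> SpD v"
        using wW unfolding set_mult_def by blast
    qed
  qed
qed

end

theorem proposition5p4p7:
  fixes R0 :: "('b::complex_vector, 'x::finite) rdatum set"
    and v :: "('b, 'x) rdatum"
  assumes "component R0" and "indecomposable R0" and "admissible R0" and "v \<in> R0"
  shows "Weyl v \<lhd> AutG v
    \<and> K v \<lhd> AutG v
    \<and> group (SkDG v)
    \<and> (\<exists>\<phi> \<in> iso (AutG v Mod K v) (SkDG v).
         \<forall>\<gamma> \<in> Aut v. \<phi> (K v #>\<^bsub>AutG v\<^esub> \<gamma>) = act v \<gamma> v)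
    \<and> (\<lambda>w. act v w v) \<in> iso ((AutG v)\<lparr>carrier := Weyl v\<rparr>)
                              ((SkDG v)\<lparr>carrier := (\<lambda>w. act v w v) ` Weyl v\<rparr>)
    \<and> semidirect_product (SkDG v) ((\<lambda>w. act v w v) ` Weyl v) (SpD v)"
proof -
  interpret admissible_datum v by (rule admissible_datumI[OF assms(1,3,4)])
  show ?thesis
    using Weyl_normal K_normal D.group_axioms Aut_mod_K Weyl_iso SkDG_semidirect by blast
qed

end
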